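(* Let $\mathcal S$ be a monoidal admissible class of spans in a monoidal category $\mathsf C$ such that every cospan in $\mathsf C$ whose legs are in $\mathcal S$ has an $\mathcal S$-relative pullback. Then the following two categories are equivalent. $\bullet$ The category $\mathsf{SplitEpiMon}_{\mathcal S}(\mathsf C)$. An object consists of monoids $A,B$ in $\mathsf C$ and monoid morphisms $i:B\to A$ and $s:A\to B$ with $s\circ i=1_B$, subject to: (a) the span $A\xleftarrow{1}A\xrightarrow{s}B$ belongs to $\mathcal S$ (so that the $\mathcal S$-relative pullback $A\Box_B I$ of $A\xrightarrow{s}B\xleftarrow{u}I$ exists, with projections $p_A:A\Box_BI\to A$ and $p_I:A\Box_BI\to I$); (b) the morphism $q:=m\circ(p_A\otimes i):(A\Box_BI)\otimes B\to A$ is invertible. A morphism from $(B,A,i,s)$ to $(B',A',i',s')$ is a pair of monoid morphisms $(b:B\to B',\ a:A\to A')$ such that $s'\circ a=b\circ s$ and $i'\circ b=a\circ i$. $\bullet$ The category $\mathsf{DistLaw}_{\mathcal S}(\mathsf C)$. An object consists of monoids $B$ and $Y$ in $\mathsf C$, a monoid morphism $e:Y\to I$ and a distributive law $x:B\otimes Y\to Y\otimes B$, subject to: (a') the spans $Y\xleftarrow{1}Y\xrightarrow{e}I$ and $B\xleftarrow{1}B\xrightarrow{1}B$ belong to $\mathcal S$ (then also $Y\otimes B\xleftarrow{1}Y\otimes B\xrightarrow{e\otimes1}B$ belongs to $\mathcal S$, so the $\mathcal S$-relative pullback $(Y\otimes B)\Box_BI$ of $Y\otimes B\xrightarrow{e\otimes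 1}B\xleftarrow{u}I$ exists); (b') $(e\otimes1)\circ x=1\otimes e$ (as morphisms $B\otimes Y\to B$); (c') the unique morphism $f:Y\to(Y\otimes B)\Box_BI$ with $p_{Y\otimes B}\circ f=1\otimes u$ and $p_I\circ f=e$ is invertible. A morphism from $(B,Y,e,x)$ to $(B',Y',e',x')$ is a pair of monoid morphisms $(b:B\to B',\ y:Y\to Y')$ such that $e'\circ y=e$ and $x'\circ(b\otimes y)=(y\otimes b)\circ x$.
   Context: Notation. $\mathsf C$ is a monoidal category with product $\otimes$ and unit $I$; its coherence isomorphisms are suppressed. Identity morphisms are written $1$. The multiplication and unit of any monoid are denoted $m$ and $u$; $I$ is regarded as a monoid in the trivial way. Admissible class. A class $\mathcal S$ of spans in a category is admissible if: (POST) if $X\xleftarrow{f}A\xrightarrow{g}Y$ is in $\mathcal S$ then so is $X'\xleftarrow{f'\circ f}A\xrightarrow{g'\circ g}Y'$ for all morphisms $f':X\to X'$, $g':Y\to Y'$; (PRE) if $X\xleftarrow{f}A\xrightarrow{g}Y$ is in $\mathcal S$ then so is $X\xleftarrow{f\circ h}D\xrightarrow{g\circ h}Y$ for every $h:D\to A$. Monoidal class. A class $\mathcal S$ of spans in $\mathsf C$ is monoidal if it is unital, i.e. $I\xleftarrow{1}I\xrightarrow{1}I$ is in $\mathcal S$, and multiplicative, i.e. whenever $X\xleftarrow{f}A\xrightarrow{g}Y$ and $X'\xleftarrow{f'}A'\xrightarrow{g'}Y'$ are in $\mathcal S$, so is $X\otimes X'\xleftarrow{f\otimes f'}A\otimes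 A'\xrightarrow{g\otimes g'}Y\otimes Y'$. Legs. A cospan $A\xrightarrow{f}B\xleftarrow{g}C$ has its legs in $\mathcal S$ if the spans $A\xleftarrow{1}A\xrightarrow{f}B$ and $B\xleftarrow{g}C\xrightarrow{1}C$ are in $\mathcal S$. Relative pullback. An $\mathcal S$-relative pullback of a cospan $A\xrightarrow{f}B\xleftarrow{g}C$ is a span $A\xleftarrow{p_A}A\Box_BC\xrightarrow{p_C}C$ in $\mathcal S$ with $f\circ p_A=g\circ p_C$ such that: (universality) for every span $A\xleftarrow{a}D\xrightarrow{c}C$ in $\mathcal S$ with $f\circ a=g\circ c$ there is a unique $h:D\to A\Box_BC$ with $p_A\circ h=a$, $p_C\circ h=c$; (reflection) if for some $d:D\to A\Box_BC$, $e:D\to E$ both spans $A\xleftarrow{p_A\circ d}D\xrightarrow{e}E$ and $C\xleftarrow{p_C\circ d}D\xrightarrow{e}E$ are in $\mathcal S$, then so is $A\Box_BC\xleftarrow{d}D\xrightarrow{e}E$, and symmetrically, if both $E\xleftarrow{e}D\xrightarrow{p_A\circ d}A$ and $E\xleftarrow{e}D\xrightarrow{p_C\circ d}C$ are in $\mathcal S$, then so is $E\xleftarrow{e}D\xrightarrow{d}A\Box_BC$. If $f,g$ are monoid morphisms (and $\mathcal S$ is monoidal admissible), $A\Box_BC$ carries the unique monoid structure making $p_A,p_C$ monoid morphisms. Distributive law. For monoids $B,Y$, a distributive law is a morphism $x:B\otimes Y\to Y\otimes B$ with $x\circ(u\otimes1)=1\otimes u$, $x\circ(1\otimes u)=u\otimes1$,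 $x\circ(m\otimes1)=(1\otimes m)\circ(x\otimes1)\circ(1\otimes x)$ and $x\circ(1\otimes m)=(m\otimes1)\circ(1\otimes x)\circ(x\otimes1)$. *)

theory Defs
  imports Main
begin

section \<open>Categories, functors, equivalence\<close>

record ('o, 'a) cat =
  Ob :: "'o set"
  Ar :: "'a set"
  Dom :: "'a \<Rightarrow> 'o"
  Cod :: "'a \<Rightarrow> 'o"
  Id :: "'o \<Rightarrow> 'a" ("\<one>\<index>")
  Comp :: "'a \<Rightarrow> 'a \<Rightarrow> 'a" (infixl "\<cdot>\<index>" 60)

definition hom :: "('o, 'a, 'z) cat_scheme \<Rightarrow> 'o \<Rightarrow> 'o \<Rightarrow> 'a set" where
  "hom C X Y = {f \<in> Ar C. Dom C f = X \<and> Cod C f = Y}"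

locale category =
  fixes C :: "('o, 'a, 'z) cat_scheme" (structure)
  assumes Dom_Ob: "f \<in> Ar C \<Longrightarrow> Dom C f \<in> Ob C"
    and Cod_Ob: "f \<in> Ar C \<Longrightarrow> Cod C f \<in> Ob C"
    and Id_hom: "X \<in> Ob C \<Longrightarrow> \<one> X \<in> hom C X X"
    and Comp_hom: "f \<in> hom C X Y \<Longrightarrow> g \<in> hom C Y Z \<Longrightarrow> g \<cdot> f \<in> hom C X Z"
    and Comp_Id_left: "f \<in> hom C X Y \<Longrightarrow> \<one> Y \<cdot> f = f"
    and Comp_Id_right: "f \<in> hom C X Y \<Longrightarrow> f \<cdot> \<one> X = f"
    and Comp_assoc: "f \<in> hom C W X \<Longrightarrow> g \<in> hom C X Y \<Longrightarrow> h \<in> hom C Y Z \<Longrightarrow>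
      (h \<cdot> g) \<cdot> f = h \<cdot> (g \<cdot> f)"

definition inverse_arrows :: "('o, 'a, 'z) cat_scheme \<Rightarrow> 'a \<Rightarrow> 'a \<Rightarrow> bool" where
  "inverse_arrows C f g \<longleftrightarrow>
     f \<in> Ar C \<and> g \<in> hom C (Cod C f) (Dom C f) \<and>
     g \<cdot> f = \<one> (Dom C f) \<and> f \<cdot> g = \<one> (Cod C f)"
  for C (structure)

definition invertible :: "('o, 'a, 'z) cat_scheme \<Rightarrow> 'a \<Rightarrow> bool" where
  "invertible C f \<longleftrightarrow> (\<exists>g. inverse_arrows C f g)"

definition inv_arrow :: "('o, 'a, 'z) cat_scheme \<Rightarrow> 'a \<Rightarrow> 'a" where
  "inv_arrow C f = (THE g. inverse_arrows C f g)"

definition is_functor :: "('o, 'a, 'z) cat_scheme \<Rightarrow> ('p, 'b, 'y) cat_scheme \<Rightarrow>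
    ('o \<Rightarrow> 'p) \<Rightarrow> ('a \<Rightarrow> 'b) \<Rightarrow> bool" where
  "is_functor C D Fo Fa \<longleftrightarrow>
     (\<forall>X \<in> Ob C. Fo X \<in> Ob D) \<and>
     (\<forall>f \<in> Ar C. Fa f \<in> hom D (Fo (Dom C f)) (Fo (Cod C f))) \<and>
     (\<forall>X \<in> Ob C. Fa (\<one>\<^bsub>C\<^esub> X) = \<one>\<^bsub>D\<^esub> (Fo X)) \<and>
     (\<forall>f \<in> Ar C. \<forall>g \<in> Ar C. Cod C f = Dom C g \<longrightarrow> Fa (g \<cdot>\<^bsub>C\<^esub> f) = Fa g \<cdot>\<^bsub>D\<^esub> Fa f)"

definition is_natural_iso :: "('o, 'a, 'z) cat_scheme \<Rightarrow> ('p, 'b, 'y) cat_scheme \<Rightarrow>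
    ('o \<Rightarrow> 'p) \<Rightarrow> ('a \<Rightarrow> 'b) \<Rightarrow> ('o \<Rightarrow> 'p) \<Rightarrow> ('a \<Rightarrow> 'b) \<Rightarrow> ('o \<Rightarrow> 'b) \<Rightarrow> bool" where
  "is_natural_iso C D Fo Fa Go Ga \<eta> \<longleftrightarrow>
     (\<forall>X \<in> Ob C. \<eta> X \<in> hom D (Fo X) (Go X) \<and> invertible D (\<eta> X)) \<and>
     (\<forall>f \<in> Ar C. \<eta> (Cod C f) \<cdot>\<^bsub>D\<^esub> Fa f = Ga f \<cdot>\<^bsub>D\<^esub> \<eta> (Dom C f))"

definition equivalent_categories ::
    "('o, 'a, 'z) cat_scheme \<Rightarrow> ('p, 'b, 'y) cat_scheme \<Rightarrow> bool" where
  "equivalent_categories C D \<longleftrightarrow>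
     category C \<and> category D \<and>
     (\<exists>Fo Fa Go Ga \<eta> \<epsilon>.
        is_functor C D Fo Fa \<and> is_functor D C Go Ga \<and>
        is_natural_iso C C id id (Go \<circ> Fo) (Ga \<circ> Fa) \<eta> \<and>
        is_natural_iso D D (Fo \<circ> Go) (Fa \<circ> Ga) id id \<epsilon>)"

section \<open>Monoidal categories and monoids\<close>

text \<open>
  The monoidal categories are not assumed to be strict. The product is written
  \<open>\<odot>\<close> on objects and \<open>\<otimes>\<close> on arrows.
\<close>

record ('o, 'a) mcat = "('o, 'a) cat" +
  TensO :: "'o \<Rightarrow> 'o \<Rightarrow> 'o" (infixr "\<odot>\<index>" 75)
  TensA :: "'a \<Rightarrow> 'a \<Rightarrow> 'a" (infixr "\<otimes>\<index>" 75)
  Unit :: "'o" ("\<I>\<index>")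
  Assoc :: "'o \<Rightarrow> 'o \<Rightarrow> 'o \<Rightarrow> 'a" ("\<alpha>\<index>")
  LUnit :: "'o \<Rightarrow> 'a" ("\<ell>\<index>")
  RUnit :: "'o \<Rightarrow> 'a" ("\<rho>\<index>")

locale monoidal_category = category C
  for C :: "('o, 'a, 'z) mcat_scheme" (structure) +
  assumes Unit_Ob: "\<I> \<in> Ob C"
    and TensO_Ob: "X \<in> Ob C \<Longrightarrow> Y \<in> Ob C \<Longrightarrow> X \<odot> Y \<in> Ob C"
    and TensA_hom: "f \<in> hom C X Y \<Longrightarrow> f' \<in> hom C X' Y' \<Longrightarrow> f \<otimes> f' \<in> hom C (X \<odot> X') (Y \<odot> Y')"
    and TensA_Id: "X \<in> Ob C \<Longrightarrow> Y \<in> Ob C \<Longrightarrow> \<one> X \<otimes> \<one> Y = \<one> (X \<odot> Y)"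
    and TensA_Comp: "f \<in> hom C X Y \<Longrightarrow> g \<in> hom C Y Z \<Longrightarrow>
      f' \<in> hom C X' Y' \<Longrightarrow> g' \<in> hom C Y' Z' \<Longrightarrow>
      (g \<cdot> f) \<otimes> (g' \<cdot> f') = (g \<otimes> g') \<cdot> (f \<otimes> f')"
    and Assoc_hom: "X \<in> Ob C \<Longrightarrow> Y \<in> Ob C \<Longrightarrow> Z \<in> Ob C \<Longrightarrow>
      \<alpha> X Y Z \<in> hom C ((X \<odot> Y) \<odot> Z) (X \<odot> (Y \<odot> Z))"
    and Assoc_invertible: "X \<in> Ob C \<Longrightarrow> Y \<in> Ob C \<Longrightarrow> Z \<in> Ob C \<Longrightarrow> invertible C (\<alpha> X Y Z)"
    and Assoc_natural: "f \<in> hom C X X' \<Longrightarrow> g \<in> hom C Y Y' \<Longrightarrow> h \<in> hom C Z Z' \<Longrightarrow>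
      \<alpha> X' Y' Z' \<cdot> ((f \<otimes> g) \<otimes> h) = (f \<otimes> (g \<otimes> h)) \<cdot> \<alpha> X Y Z"
    and LUnit_hom: "X \<in> Ob C \<Longrightarrow> \<ell> X \<in> hom C (\<I> \<odot> X) X"
    and LUnit_invertible: "X \<in> Ob C \<Longrightarrow> invertible C (\<ell> X)"
    and LUnit_natural: "f \<in> hom C X Y \<Longrightarrow> \<ell> Y \<cdot> (\<one> \<I> \<otimes> f) = f \<cdot> \<ell> X"
    and RUnit_hom: "X \<in> Ob C \<Longrightarrow> \<rho> X \<in> hom C (X \<odot> \<I>) X"
    and RUnit_invertible: "X \<in> Ob C \<Longrightarrow> invertible C (\<rho> X)"
    and RUnit_natural: "f \<in> hom C X Y \<Longrightarrow> \<rho> Y \<cdot> (f \<otimes> \<one> \<I>) = f \<cdot> \<rho> X"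
    and pentagon: "W \<in> Ob C \<Longrightarrow> X \<in> Ob C \<Longrightarrow> Y \<in> Ob C \<Longrightarrow> Z \<in> Ob C \<Longrightarrow>
      \<alpha> W X (Y \<odot> Z) \<cdot> \<alpha> (W \<odot> X) Y Z
        = (\<one> W \<otimes> \<alpha> X Y Z) \<cdot> \<alpha> W (X \<odot> Y) Z \<cdot> (\<alpha> W X Y \<otimes> \<one> Z)"
    and triangle: "X \<in> Ob C \<Longrightarrow> Y \<in> Ob C \<Longrightarrow>
      (\<one> X \<otimes> \<ell> Y) \<cdot> \<alpha> X \<I> Y = \<rho> X \<otimes> \<one> Y"

record ('o, 'a) mon =
  obj :: "'o"
  mlt :: "'a"
  unt :: "'a"

definition is_mon :: "('o, 'a, 'z) mcat_scheme \<Rightarrow> ('o, 'a) mon \<Rightarrow> bool" where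
  "is_mon C M \<longleftrightarrow>
     obj M \<in> Ob C \<and>
     mlt M \<in> hom C (obj M \<odot> obj M) (obj M) \<and>
     unt M \<in> hom C \<I> (obj M) \<and>
     mlt M \<cdot> (mlt M \<otimes> \<one> (obj M))
       = mlt M \<cdot> (\<one> (obj M) \<otimes> mlt M) \<cdot> \<alpha> (obj M) (obj M) (obj M) \<and>
     mlt M \<cdot> (unt M \<otimes> \<one> (obj M)) = \<ell> (obj M) \<and>
     mlt M \<cdot> (\<one> (obj M) \<otimes> unt M) = \<rho> (obj M)"
  for C (structure)

definition is_mon_hom ::
    "('o, 'a, 'z) mcat_scheme \<Rightarrow> ('o, 'a) mon \<Rightarrow> ('o, 'a) mon \<Rightarrow> 'a \<Rightarrow> bool" where
  "is_mon_hom C M N f \<longleftrightarrow>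
     f \<in> hom C (obj M) (obj N) \<and>
     f \<cdot> mlt M = mlt N \<cdot> (f \<otimes> f) \<and>
     f \<cdot> unt M = unt N"
  for C (structure)

definition trivial_mon :: "('o, 'a, 'z) mcat_scheme \<Rightarrow> ('o, 'a) mon" where
  "trivial_mon C = \<lparr>obj = \<I>, mlt = \<ell> \<I>, unt = \<one> \<I>\<rparr>"
  for C (structure)

section \<open>Classes of spans and relative pullbacks\<close>

text \<open>
  A span \<open>X \<leftarrow>f- A -g\<rightarrow> Y\<close> is the pair \<open>(f, g)\<close>; its objects are recovered by
  \<^const>\<open>Dom\<close> and \<^const>\<open>Cod\<close>. In a cospan \<open>A -f\<rightarrow> B \<leftarrow>g- C\<close> both arrows point to \<open>B\<close>.
\<close>

definition spans :: "('o, 'a, 'z) cat_scheme \<Rightarrow> ('a \<times> 'a) set" where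
  "spans C = {(f, g). f \<in> Ar C \<and> g \<in> Ar C \<and> Dom C f = Dom C g}"

definition is_cospan :: "('o, 'a, 'z) cat_scheme \<Rightarrow> 'a \<Rightarrow> 'a \<Rightarrow> bool" where
  "is_cospan C f g \<longleftrightarrow> f \<in> Ar C \<and> g \<in> Ar C \<and> Cod C f = Cod C g"

definition admissible :: "('o, 'a, 'z) cat_scheme \<Rightarrow> ('a \<times> 'a) set \<Rightarrow> bool" where
  "admissible C S \<longleftrightarrow>
     S \<subseteq> spans C \<and>
     (\<forall>f g f' g'. (f, g) \<in> S \<and> f' \<in> Ar C \<and> g' \<in> Ar C \<and> Dom C f' = Cod C f \<and> Dom C g' = Cod C g
        \<longrightarrow> (f' \<cdot> f, g' \<cdot> g) \<in> S) \<and>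
     (\<forall>f g h. (f, g) \<in> S \<and> h \<in> Ar C \<and> Cod C h = Dom C f \<longrightarrow> (f \<cdot> h, g \<cdot> h) \<in> S)"
  for C (structure)

definition monoidal_class :: "('o, 'a, 'z) mcat_scheme \<Rightarrow> ('a \<times> 'a) set \<Rightarrow> bool" where
  "monoidal_class C S \<longleftrightarrow>
     S \<subseteq> spans C \<and>
     (\<one> \<I>, \<one> \<I>) \<in> S \<and>
     (\<forall>f g f' g'. (f, g) \<in> S \<and> (f', g') \<in> S \<longrightarrow> (f \<otimes> f', g \<otimes> g') \<in> S)"
  for C (structure)

definition legs_in :: "('o, 'a, 'z) cat_scheme \<Rightarrow> ('a \<times> 'a) set \<Rightarrow> 'a \<Rightarrow> 'a \<Rightarrow> bool" where
  "legs_in C S f g \<longleftrightarrow> (\<one> (Dom C f), f) \<in> S \<and> (g, \<one> (Dom C g)) \<in> S"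
  for C (structure)

definition is_rel_pullback ::
    "('o, 'a, 'z) cat_scheme \<Rightarrow> ('a \<times> 'a) set \<Rightarrow> 'a \<Rightarrow> 'a \<Rightarrow> 'a \<Rightarrow> 'a \<Rightarrow> bool" where
  "is_rel_pullback C S f g p q \<longleftrightarrow>
     (p, q) \<in> S \<and> Cod C p = Dom C f \<and> Cod C q = Dom C g \<and> f \<cdot> p = g \<cdot> q \<and>
     (\<forall>a c. (a, c) \<in> S \<and> Cod C a = Dom C f \<and> Cod C c = Dom C g \<and> f \<cdot> a = g \<cdot> c
        \<longrightarrow> (\<exists>!h. h \<in> hom C (Dom C a) (Dom C p) \<and> p \<cdot> h = a \<and> q \<cdot> h = c)) \<and>
     (\<forall>d e. d \<in> Ar C \<and> e \<in> Ar C \<and> Dom C e = Dom C d \<and> Cod C d = Dom C p \<and>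
        (p \<cdot> d, e) \<in> S \<and> (q \<cdot> d, e) \<in> S \<longrightarrow> (d, e) \<in> S) \<and>
     (\<forall>d e. d \<in> Ar C \<and> e \<in> Ar C \<and> Dom C e = Dom C d \<and> Cod C d = Dom C p \<and>
        (e, p \<cdot> d) \<in> S \<and> (e, q \<cdot> d) \<in> S \<longrightarrow> (e, d) \<in> S)"
  for C (structure)

text \<open>
  The relative pullback is unique up to isomorphism. We select one span of projections; the
  invertibility conditions below do not depend on the selection.
\<close>

definition rel_pullback ::
    "('o, 'a, 'z) cat_scheme \<Rightarrow> ('a \<times> 'a) set \<Rightarrow> 'a \<Rightarrow> 'a \<Rightarrow> 'a \<times> 'a" where
  "rel_pullback C S f g = (SOME (p, q). is_rel_pullback C S f g p q)"

definition pr1 :: "('o, 'a, 'z) cat_scheme \<Rightarrow> ('a \<times> 'a) set \<Rightarrow> 'a \<Rightarrow> 'a \<Rightarrow> 'a" where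
  "pr1 C S f g = fst (rel_pullback C S f g)"

definition pr2 :: "('o, 'a, 'z) cat_scheme \<Rightarrow> ('a \<times> 'a) set \<Rightarrow> 'a \<Rightarrow> 'a \<Rightarrow> 'a" where
  "pr2 C S f g = snd (rel_pullback C S f g)"

definition pb_obj :: "('o, 'a, 'z) cat_scheme \<Rightarrow> ('a \<times> 'a) set \<Rightarrow> 'a \<Rightarrow> 'a \<Rightarrow> 'o" where
  "pb_obj C S f g = Dom C (pr1 C S f g)"

definition has_rel_pullbacks :: "('o, 'a, 'z) cat_scheme \<Rightarrow> ('a \<times> 'a) set \<Rightarrow> bool" where
  "has_rel_pullbacks C S \<longleftrightarrow>
     (\<forall>f g. is_cospan C f g \<and> legs_in C S f g \<longrightarrow> (\<exists>p q. is_rel_pullback C S f g p q))"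

section \<open>Split epimorphisms of monoids\<close>

type_synonym ('o, 'a) split_epi = "('o, 'a) mon \<times> ('o, 'a) mon \<times> 'a \<times> 'a"

definition is_split_epi ::
    "('o, 'a, 'z) mcat_scheme \<Rightarrow> ('a \<times> 'a) set \<Rightarrow> ('o, 'a) split_epi \<Rightarrow> bool" where
  "is_split_epi C S = (\<lambda>(B, A, i, s).
     is_mon C B \<and> is_mon C A \<and> is_mon_hom C B A i \<and> is_mon_hom C A B s \<and>
     s \<cdot> i = \<one> (obj B) \<and>
     (\<one> (obj A), s) \<in> S \<and>
     invertible C (mlt A \<cdot> (pr1 C S s (unt B) \<otimes> i)))"
  for C (structure)

definition is_split_epi_hom :: "('o, 'a, 'z) mcat_scheme \<Rightarrow>
    ('o, 'a) split_epi \<Rightarrow> ('o, 'a) split_epi \<Rightarrow> 'a \<Rightarrow> 'a \<Rightarrow> bool" where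
  "is_split_epi_hom C = (\<lambda>(B, A, i, s) (B', A', i', s') b a.
     is_mon_hom C B B' b \<and> is_mon_hom C A A' a \<and>
     s' \<cdot> a = b \<cdot> s \<and> i' \<cdot> b = a \<cdot> i)"
  for C (structure)

text \<open>
  An arrow of the categories below carries its source and target explicitly, followed by the
  pair of underlying arrows of \<open>C\<close>.
\<close>

definition SplitEpiMon :: "('o, 'a, 'z) mcat_scheme \<Rightarrow> ('a \<times> 'a) set \<Rightarrow>
    (('o, 'a) split_epi, ('o, 'a) split_epi \<times> ('o, 'a) split_epi \<times> 'a \<times> 'a) cat" where
  "SplitEpiMon C S = \<lparr>
     Ob = {E. is_split_epi C S E},
     Ar = {(E, E', b, a). is_split_epi C S E \<and> is_split_epi C S E' \<and> is_split_epi_hom C E E' b a},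
     Dom = (\<lambda>(E, E', b, a). E),
     Cod = (\<lambda>(E, E', b, a). E'),
     Id = (\<lambda>(B, A, i, s). ((B, A, i, s), (B, A, i, s), \<one> (obj B), \<one> (obj A))),
     Comp = (\<lambda>(E', E'', b', a') (E, _, b, a). (E, E'', b' \<cdot> b, a' \<cdot> a))\<rparr>"
  for C (structure)

section \<open>Distributive laws\<close>

text \<open>
  Coherence isomorphisms are inserted so that both sides have the same source; for example the
  first two equations are between arrows \<open>\<I> \<odot> Y \<rightarrow> Y \<odot> B\<close> and \<open>B \<odot> \<I> \<rightarrow> Y \<odot> B\<close>.
\<close>

definition is_distributive_law ::
    "('o, 'a, 'z) mcat_scheme \<Rightarrow> ('o, 'a) mon \<Rightarrow> ('o, 'a) mon \<Rightarrow> 'a \<Rightarrow> bool" where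
  "is_distributive_law C MB MY x \<longleftrightarrow> (let B = obj MB; Y = obj MY in
     x \<in> hom C (B \<odot> Y) (Y \<odot> B) \<and>
     x \<cdot> (unt MB \<otimes> \<one> Y) = (\<one> Y \<otimes> unt MB) \<cdot> inv_arrow C (\<rho> Y) \<cdot> \<ell> Y \<and>
     x \<cdot> (\<one> B \<otimes> unt MY) = (unt MY \<otimes> \<one> B) \<cdot> inv_arrow C (\<ell> B) \<cdot> \<rho> B \<and>
     x \<cdot> (mlt MB \<otimes> \<one> Y)
       = (\<one> Y \<otimes> mlt MB) \<cdot> \<alpha> Y B B \<cdot> (x \<otimes> \<one> B) \<cdot> inv_arrow C (\<alpha> B Y B)
           \<cdot> (\<one> B \<otimes> x) \<cdot> \<alpha> B B Y \<and>
     x \<cdot> (\<one> B \<otimes> mlt MY)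
       = (mlt MY \<otimes> \<one> B) \<cdot> inv_arrow C (\<alpha> Y Y B) \<cdot> (\<one> Y \<otimes> x) \<cdot> \<alpha> Y B Y
           \<cdot> (x \<otimes> \<one> Y) \<cdot> inv_arrow C (\<alpha> B Y Y))"
  for C (structure)

type_synonym ('o, 'a) dist_law = "('o, 'a) mon \<times> ('o, 'a) mon \<times> 'a \<times> 'a"

text \<open>
  \<open>dl_proj\<close> is \<open>e \<otimes> 1 : Y \<otimes> B \<rightarrow> B\<close>, and \<open>dl_comparison\<close> is the arrow from \<open>Y\<close> to the
  relative pullback of \<open>e \<otimes> 1\<close> along the unit of \<open>B\<close> that is induced by \<open>1 \<otimes> u : Y \<rightarrow> Y \<otimes> B\<close>
  and \<open>e\<close>.
\<close>

definition dl_proj :: "('o, 'a, 'z) mcat_scheme \<Rightarrow> ('o, 'a) mon \<Rightarrow> 'a \<Rightarrow> 'a" where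
  "dl_proj C B e = \<ell> (obj B) \<cdot> (e \<otimes> \<one> (obj B))"
  for C (structure)

definition is_dl_comparison :: "('o, 'a, 'z) mcat_scheme \<Rightarrow> ('a \<times> 'a) set \<Rightarrow>
    ('o, 'a) mon \<Rightarrow> ('o, 'a) mon \<Rightarrow> 'a \<Rightarrow> 'a \<Rightarrow> bool" where
  "is_dl_comparison C S B Y e f \<longleftrightarrow>
     f \<in> hom C (obj Y) (pb_obj C S (dl_proj C B e) (unt B)) \<and>
     pr1 C S (dl_proj C B e) (unt B) \<cdot> f = (\<one> (obj Y) \<otimes> unt B) \<cdot> inv_arrow C (\<rho> (obj Y)) \<and>
     pr2 C S (dl_proj C B e) (unt B) \<cdot> f = e"
  for C (structure)

definition dl_comparison :: "('o, 'a, 'z) mcat_scheme \<Rightarrow> ('a \<times> 'a) set \<Rightarrow>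
    ('o, 'a) mon \<Rightarrow> ('o, 'a) mon \<Rightarrow> 'a \<Rightarrow> 'a" where
  "dl_comparison C S B Y e = (THE f. is_dl_comparison C S B Y e f)"

definition is_dist_law ::
    "('o, 'a, 'z) mcat_scheme \<Rightarrow> ('a \<times> 'a) set \<Rightarrow> ('o, 'a) dist_law \<Rightarrow> bool" where
  "is_dist_law C S = (\<lambda>(B, Y, e, x).
     is_mon C B \<and> is_mon C Y \<and> is_mon_hom C Y (trivial_mon C) e \<and>
     is_distributive_law C B Y x \<and>
     (\<one> (obj Y), e) \<in> S \<and> (\<one> (obj B), \<one> (obj B)) \<in> S \<and>
     dl_proj C B e \<cdot> x = \<rho> (obj B) \<cdot> (\<one> (obj B) \<otimes> e) \<and>
     invertible C (dl_comparison C S B Y e))"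
  for C (structure)

definition is_dist_law_hom :: "('o, 'a, 'z) mcat_scheme \<Rightarrow>
    ('o, 'a) dist_law \<Rightarrow> ('o, 'a) dist_law \<Rightarrow> 'a \<Rightarrow> 'a \<Rightarrow> bool" where
  "is_dist_law_hom C = (\<lambda>(B, Y, e, x) (B', Y', e', x') b y.
     is_mon_hom C B B' b \<and> is_mon_hom C Y Y' y \<and>
     e' \<cdot> y = e \<and> x' \<cdot> (b \<otimes> y) = (y \<otimes> b) \<cdot> x)"
  for C (structure)

definition DistLaw :: "('o, 'a, 'z) mcat_scheme \<Rightarrow> ('a \<times> 'a) set \<Rightarrow>
    (('o, 'a) dist_law, ('o, 'a) dist_law \<times> ('o, 'a) dist_law \<times> 'a \<times> 'a) cat" where
  "DistLaw C S = \<lparr>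
     Ob = {L. is_dist_law C S L},
     Ar = {(L, L', b, y). is_dist_law C S L \<and> is_dist_law C S L' \<and> is_dist_law_hom C L L' b y},
     Dom = (\<lambda>(L, L', b, y). L),
     Cod = (\<lambda>(L, L', b, y). L'),
     Id = (\<lambda>(B, Y, e, x). ((B, Y, e, x), (B, Y, e, x), \<one> (obj B), \<one> (obj Y))),
     Comp = (\<lambda>(L', L'', b', y') (L, _, b, y). (L, L'', b' \<cdot> b, y' \<cdot> y))\<rparr>"
  for C (structure)

section \<open>The selected pullbacks and comparison arrows exist\<close>

lemma invertible_inv_arrow:
  fixes C (structure)
  assumes "category C" and "invertible C f"
  shows "inverse_arrows C f (inv_arrow C f)"
proof -
  interpret category C by fact
  obtain g where g: "inverse_arrows C f g"
    using assms(2) unfolding invertible_def by blast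
  have "g' = g" if g': "inverse_arrows C f g'" for g'
  proof -
    let ?X = "Dom C f" and ?Y = "Cod C f"
    have f: "f \<in> hom C ?X ?Y" and h: "g \<in> hom C ?Y ?X" and h': "g' \<in> hom C ?Y ?X"
      using g g' unfolding inverse_arrows_def hom_def by auto
    have "g' = g' \<cdot> (f \<cdot> g)" using g Comp_Id_right[OF h'] by (simp add: inverse_arrows_def)
    also have "\<dots> = (g' \<cdot> f) \<cdot> g" using Comp_assoc[OF h f h'] by simp
    also have "\<dots> = g" using g' Comp_Id_left[OF h] by (simp add: inverse_arrows_def)
    finally show ?thesis .
  qed
  then show ?thesis unfolding inv_arrow_def using g by (metis theI)
qed

lemma is_rel_pullback_pr:
  assumes "has_rel_pullbacks C S" and "is_cospan C f g" and "legs_in C S f g"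
  shows "is_rel_pullback C S f g (pr1 C S f g) (pr2 C S f g)"
proof -
  have "\<exists>pq. case pq of (p, q) \<Rightarrow> is_rel_pullback C S f g p q"
    using assms unfolding has_rel_pullbacks_def by auto
  then have "case rel_pullback C S f g of (p, q) \<Rightarrow> is_rel_pullback C S f g p q"
    unfolding rel_pullback_def by (rule someI_ex)
  then show ?thesis by (simp add: pr1_def pr2_def split: prod.splits)
qed

lemma unt_leg:
  fixes C (structure)
  assumes "monoidal_category C" and "admissible C S" and "monoidal_class C S" and "is_mon C B"
  shows "(unt B, \<one> \<I>) \<in> S"
proof -
  interpret monoidal_category C by fact
  have "unt B \<in> hom C \<I> (obj B)" and "\<one> \<I> \<in> hom C \<I> \<I>"
    using assms(4) Unit_Ob Id_hom by (auto simp: is_mon_def)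
  moreover have "(\<one> \<I>, \<one> \<I>) \<in> S" using assms(3) by (simp add: monoidal_class_def)
  ultimately have "(unt B \<cdot> \<one> \<I>, \<one> \<I> \<cdot> \<one> \<I>) \<in> S"
    using assms(2) unfolding admissible_def hom_def by auto
  then show ?thesis
    using Comp_Id_right \<open>unt B \<in> hom C \<I> (obj B)\<close> \<open>\<one> \<I> \<in> hom C \<I> \<I>\<close> by simp
qed

lemma split_epi_rel_pullback:
  fixes C (structure)
  assumes "monoidal_category C" and "admissible C S" and "monoidal_class C S"
    and "has_rel_pullbacks C S"
    and "is_mon C B" and "is_mon_hom C A B s" and "(\<one> (obj A), s) \<in> S"
  shows "is_rel_pullback C S s (unt B) (pr1 C S s (unt B)) (pr2 C S s (unt B))"
  using assms(5-7) unt_leg[OF assms(1-3,5)]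
  by (intro is_rel_pullback_pr[OF assms(4)])
    (auto simp: is_cospan_def legs_in_def is_mon_def is_mon_hom_def hom_def)

lemma dl_proj_leg:
  fixes C (structure)
  assumes "monoidal_category C" and "admissible C S" and "monoidal_class C S"
    and "is_mon C B" and "is_mon C Y" and "is_mon_hom C Y (trivial_mon C) e"
    and "(\<one> (obj Y), e) \<in> S" and "(\<one> (obj B), \<one> (obj B)) \<in> S"
  shows "dl_proj C B e \<in> hom C (obj Y \<odot> obj B) (obj B)"
    and "(\<one> (obj Y \<odot> obj B), dl_proj C B e) \<in> S"
proof -
  interpret monoidal_category C by fact
  have B: "obj B \<in> Ob C" and Y: "obj Y \<in> Ob C" and e: "e \<in> hom C (obj Y) \<I>"
    using assms(4-6) by (auto simp: is_mon_def is_mon_hom_def trivial_mon_def)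
  have t: "e \<otimes> \<one> (obj B) \<in> hom C (obj Y \<odot> obj B) (\<I> \<odot> obj B)"
    using TensA_hom[OF e Id_hom[OF B]] .
  show "dl_proj C B e \<in> hom C (obj Y \<odot> obj B) (obj B)"
    unfolding dl_proj_def using Comp_hom[OF t LUnit_hom[OF B]] .
  have i: "\<one> (obj Y \<odot> obj B) \<in> hom C (obj Y \<odot> obj B) (obj Y \<odot> obj B)"
    using Id_hom[OF TensO_Ob[OF Y B]] .
  have "(\<one> (obj Y \<odot> obj B), e \<otimes> \<one> (obj B)) \<in> S"
    using assms(3,7,8) unfolding monoidal_class_def TensA_Id[OF Y B, symmetric] by blast
  then have "(\<one> (obj Y \<odot> obj B) \<cdot> \<one> (obj Y \<odot> obj B), \<ell> (obj B) \<cdot> (e \<otimes> \<one> (obj B))) \<in> S"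
    using assms(2) i t LUnit_hom[OF B] unfolding admissible_def hom_def by auto
  then show "(\<one> (obj Y \<odot> obj B), dl_proj C B e) \<in> S"
    unfolding dl_proj_def using Comp_Id_right[OF i] by simp
qed

lemma dl_rel_pullback:
  fixes C (structure)
  assumes "monoidal_category C" and "admissible C S" and "monoidal_class C S"
    and "has_rel_pullbacks C S"
    and "is_mon C B" and "is_mon C Y" and "is_mon_hom C Y (trivial_mon C) e"
    and "(\<one> (obj Y), e) \<in> S" and "(\<one> (obj B), \<one> (obj B)) \<in> S"
  shows "is_rel_pullback C S (dl_proj C B e) (unt B)
    (pr1 C S (dl_proj C B e) (unt B)) (pr2 C S (dl_proj C B e) (unt B))"
  using dl_proj_leg[OF assms(1-3,5-9)] unt_leg[OF assms(1-3,5)] assms(5)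
  by (intro is_rel_pullback_pr[OF assms(4)])
    (auto simp: is_cospan_def legs_in_def is_mon_def hom_def)

lemma dl_comparison_unique_existence:
  fixes C (structure)
  assumes "monoidal_category C" and "admissible C S" and "monoidal_class C S"
    and "has_rel_pullbacks C S"
    and "is_mon C B" and "is_mon C Y" and "is_mon_hom C Y (trivial_mon C) e"
    and "(\<one> (obj Y), e) \<in> S" and "(\<one> (obj B), \<one> (obj B)) \<in> S"
  shows "\<exists>!f. is_dl_comparison C S B Y e f"
proof -
  interpret monoidal_category C by fact
  let ?B = "obj B" and ?Y = "obj Y" and ?r = "inv_arrow C (\<rho> (obj Y))"
  have B: "?B \<in> Ob C" and Y: "?Y \<in> Ob C" and e: "e \<in> hom C ?Y \<I>"
    and u: "unt B \<in> hom C \<I> ?B"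
    using assms(5-7) by (auto simp: is_mon_def is_mon_hom_def trivial_mon_def)
  have r: "?r \<in> hom C ?Y (?Y \<odot> \<I>)" and r2: "\<rho> ?Y \<cdot> ?r = \<one> ?Y"
    using invertible_inv_arrow[OF category_axioms RUnit_invertible[OF Y]] RUnit_hom[OF Y]
    by (auto simp: inverse_arrows_def hom_def)
  have Id_Y: "\<one> ?Y \<in> hom C ?Y ?Y" and Id_B: "\<one> ?B \<in> hom C ?B ?B"
    and Id_I: "\<one> \<I> \<in> hom C \<I> \<I>"
    using Id_hom B Y Unit_Ob by auto
  have t: "\<one> ?Y \<otimes> unt B \<in> hom C (?Y \<odot> \<I>) (?Y \<odot> ?B)" using TensA_hom[OF Id_Y u] .
  let ?a = "(\<one> ?Y \<otimes> unt B) \<cdot> ?r"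
  have a: "?a \<in> hom C ?Y (?Y \<odot> ?B)" using Comp_hom[OF r t] .
  have "(?a \<cdot> \<one> ?Y, \<one> \<I> \<cdot> e) \<in> S"
    using assms(2,8) a e Id_Y Id_I unfolding admissible_def hom_def by auto
  then have S: "(?a, e) \<in> S" using Comp_Id_right[OF a] Comp_Id_left[OF e] by simp
  have eB: "e \<otimes> \<one> ?B \<in> hom C (?Y \<odot> ?B) (\<I> \<odot> ?B)" using TensA_hom[OF e Id_B] .
  have eI: "e \<otimes> \<one> \<I> \<in> hom C (?Y \<odot> \<I>) (\<I> \<odot> \<I>)" using TensA_hom[OF e Id_I] .
  have Iu: "\<one> \<I> \<otimes> unt B \<in> hom C (\<I> \<odot> \<I>) (\<I> \<odot> ?B)" using TensA_hom[OF Id_I u] .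
  have l: "\<ell> ?B \<in> hom C (\<I> \<odot> ?B) ?B" using LUnit_hom[OF B] .
  have slide: "(e \<otimes> \<one> ?B) \<cdot> (\<one> ?Y \<otimes> unt B) = (\<one> \<I> \<otimes> unt B) \<cdot> (e \<otimes> \<one> \<I>)"
    using TensA_Comp[OF Id_Y e u Id_B] TensA_Comp[OF e Id_I Id_I u]
      Comp_Id_left[OF e] Comp_Id_right[OF e] Comp_Id_left[OF u] Comp_Id_right[OF u] by simp
  have units: "unt B \<cdot> \<ell> \<I> = unt B \<cdot> \<rho> \<I>"
  proof -
    have m: "mlt B \<in> hom C (?B \<odot> ?B) ?B"
      and ml: "mlt B \<cdot> (unt B \<otimes> \<one> ?B) = \<ell> ?B" and mr: "mlt B \<cdot> (\<one> ?B \<otimes> unt B) = \<rho> ?B"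
      using assms(5) by (auto simp: is_mon_def)
    have uB: "unt B \<otimes> \<one> ?B \<in> hom C (\<I> \<odot> ?B) (?B \<odot> ?B)"
      and Bu: "\<one> ?B \<otimes> unt B \<in> hom C (?B \<odot> \<I>) (?B \<odot> ?B)"
      and uI: "unt B \<otimes> \<one> \<I> \<in> hom C (\<I> \<odot> \<I>) (?B \<odot> \<I>)"
      using TensA_hom u Id_B Id_I by auto
    have "unt B \<cdot> \<ell> \<I> = \<ell> ?B \<cdot> (\<one> \<I> \<otimes> unt B)" using LUnit_natural[OF u] by simp
    also have "\<dots> = mlt B \<cdot> ((unt B \<otimes> \<one> ?B) \<cdot> (\<one> \<I> \<otimes> unt B))"
      using Comp_assoc[OF Iu uB m] ml by simp
    also have "(unt B \<otimes> \<one> ?B) \<cdot> (\<one> \<I> \<otimes> unt B) = (\<one> ?B \<otimes> unt B) \<cdot> (unt B \<otimes> \<one> \<I>)"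
      using TensA_Comp[OF Id_I u u Id_B] TensA_Comp[OF u Id_B Id_I u]
        Comp_Id_left[OF u] Comp_Id_right[OF u] by simp
    also have "mlt B \<cdot> \<dots> = \<rho> ?B \<cdot> (unt B \<otimes> \<one> \<I>)"
      using Comp_assoc[OF uI Bu m] mr by simp
    also have "\<dots> = unt B \<cdot> \<rho> \<I>" using RUnit_natural[OF u] .
    finally show ?thesis .
  qed
  have "dl_proj C B e \<cdot> ?a = \<ell> ?B \<cdot> ((e \<otimes> \<one> ?B) \<cdot> ?a)"
    unfolding dl_proj_def using Comp_assoc[OF a eB l] .
  also have "(e \<otimes> \<one> ?B) \<cdot> ?a = (\<one> \<I> \<otimes> unt B) \<cdot> (e \<otimes> \<one> \<I>) \<cdot> ?r"
    using Comp_assoc[OF r t eB] slide by simp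
  also have "\<dots> = (\<one> \<I> \<otimes> unt B) \<cdot> ((e \<otimes> \<one> \<I>) \<cdot> ?r)"
    using Comp_assoc[OF r eI Iu] .
  also have "\<ell> ?B \<cdot> \<dots> = (unt B \<cdot> \<ell> \<I>) \<cdot> ((e \<otimes> \<one> \<I>) \<cdot> ?r)"
    using Comp_assoc[OF Comp_hom[OF r eI] Iu l] LUnit_natural[OF u] by simp
  also have "\<dots> = unt B \<cdot> (\<rho> \<I> \<cdot> ((e \<otimes> \<one> \<I>) \<cdot> ?r))"
    using Comp_assoc[OF Comp_hom[OF r eI] RUnit_hom[OF Unit_Ob] u] units by simp
  also have "\<rho> \<I> \<cdot> ((e \<otimes> \<one> \<I>) \<cdot> ?r) = e"
    using Comp_assoc[OF r eI RUnit_hom[OF Unit_Ob]] RUnit_natural[OF e]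
      Comp_assoc[OF r RUnit_hom[OF Y] e] r2 Comp_Id_right[OF e] by simp
  finally have eq: "dl_proj C B e \<cdot> ?a = unt B \<cdot> e" .
  have "\<exists>!h. h \<in> hom C (Dom C ?a) (Dom C (pr1 C S (dl_proj C B e) (unt B))) \<and>
      pr1 C S (dl_proj C B e) (unt B) \<cdot> h = ?a \<and> pr2 C S (dl_proj C B e) (unt B) \<cdot> h = e"
  proof -
    have "Cod C ?a = Dom C (dl_proj C B e)" "Cod C e = Dom C (unt B)"
      using a e u dl_proj_leg(1)[OF assms(1-3,5-9)] by (auto simp: hom_def)
    then show ?thesis
      using dl_rel_pullback[OF assms] S eq unfolding is_rel_pullback_def by blast
  qed
  moreover have "Dom C ?a = ?Y" using a by (simp add: hom_def)
  ultimately show ?thesis unfolding is_dl_comparison_def pb_obj_def by simp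
qed

end

theory Submission
  imports Defs
begin

text \<open>
  For arrows \<open>f\<close> and \<open>g\<close> into a monoid \<open>A\<close> write \<open>f \<star> g = m \<cdot> (f \<otimes> g)\<close>. This convolution is
  associative and unital up to the constraints, and monoid morphisms preserve it. Most diagrams
  below become short computations with it.

  Let \<open>(B, A, i, s)\<close> be a split epimorphism. The relative pullback \<open>p : P \<rightarrow> A\<close>, \<open>e : P \<rightarrow> \<I>\<close> of \<open>s\<close>
  along the unit of \<open>B\<close> is a monoid, because the spans \<open>(p \<star> p, e \<star> e)\<close> and \<open>(u, 1)\<close> are in the
  class and lift to it. Since \<open>q = p \<star> i : P \<odot> B \<rightarrow> A\<close> is invertible, there is exactly one \<open>x\<close> with
  \<open>q \<cdot> x = i \<star> p\<close>. Composed with \<open>q\<close>, the axioms of a distributive law for \<open>x\<close> say that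
  products such as \<open>i \<star> i \<star> p\<close> may be bracketed in either way. Moreover \<open>s \<cdot> q = e \<otimes> 1\<close>, so \<open>q\<close>
  carries the pullback of \<open>e \<otimes> 1\<close> to the pullback of \<open>s\<close>, which is \<open>P\<close>; hence the comparison
  arrow for \<open>x\<close> is invertible. This defines a functor from split epimorphisms to distributive
  laws, and it suffices to show that it is fully faithful and essentially surjective
  (\<open>equivalent_categories_fully_faithful\<close>).

  Both properties rest on the wreath product: a distributive law \<open>x\<close> makes \<open>Y \<odot> B\<close> a monoid, and
  monoid morphisms \<open>i : B \<rightarrow> N\<close> and \<open>j : Y \<rightarrow> N\<close> with \<open>i \<star> j = (j \<star> i) \<cdot> x\<close> combine to a monoid
  morphism \<open>j \<star> i\<close> from it to \<open>N\<close> (\<open>wreath_universal\<close>). For a split epimorphism, \<open>q\<close> is therefore an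
  isomorphism of monoids from the wreath product to \<open>A\<close>. A morphism \<open>(b, y)\<close> of distributive laws
  comes from exactly one \<open>a\<close>, namely the one with \<open>a \<cdot> q = (p' \<cdot> y) \<star> (i' \<cdot> b)\<close>. An arbitrary
  distributive law is, up to isomorphism, the law of the split epimorphism formed by its wreath
  product, the inclusion of \<open>B\<close> and the projection \<open>e \<otimes> 1\<close>: the condition on the comparison
  arrow says that the kernel of this projection is \<open>Y\<close>.

  The step in which coherence matters is the associativity of the wreath product. It is obtained by
  reading the pentagon axiom as a statement about five associativity squares, of which any one
  follows from the other four in the cases that occur (\<open>associative_mA_mA\<close>).
\<close>

section \<open>Arrow calculus\<close>

text \<open>
  The rewrite rules carry conditions on domains and codomains in place of membership in hom-sets:
  such conditions contain no unknown objects, so that the simplifier can discharge them.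
  Composites are nested to the right.
\<close>

context category begin

lemma in_hom [simp]: "f \<in> hom C X Y \<longleftrightarrow> f \<in> Ar C \<and> Dom C f = X \<and> Cod C f = Y"
  by (auto simp: hom_def)

lemma Dom_Cod_Ob [simp]:
  assumes "f \<in> Ar C" shows "Dom C f \<in> Ob C" "Cod C f \<in> Ob C"
  using assms Dom_Ob Cod_Ob by auto

lemma Id_simps [simp]:
  assumes "X \<in> Ob C" shows "\<one> X \<in> Ar C" "Dom C (\<one> X) = X" "Cod C (\<one> X) = X"
  using Id_hom[OF assms] by auto

lemma Comp_simps [simp]:
  assumes "f \<in> Ar C" "g \<in> Ar C" "Cod C f = Dom C g"
  shows "g \<cdot> f \<in> Ar C" "Dom C (g \<cdot> f) = Dom C f" "Cod C (g \<cdot> f) = Cod C g"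
  using Comp_hom[of f "Dom C f" "Dom C g" g "Cod C g"] assms by auto

lemma Comp_Id_simps [simp]:
  assumes "f \<in> Ar C"
  shows "Cod C f = Y \<Longrightarrow> \<one> Y \<cdot> f = f" "Dom C f = X \<Longrightarrow> f \<cdot> \<one> X = f"
  using assms Comp_Id_left Comp_Id_right by auto

lemma Comp_assoc' [simp]:
  assumes "f \<in> Ar C" "g \<in> Ar C" "h \<in> Ar C" "Cod C f = Dom C g" "Cod C g = Dom C h"
  shows "(h \<cdot> g) \<cdot> f = h \<cdot> (g \<cdot> f)"
  using assms by (intro Comp_assoc) auto

text \<open>
  Because composites are nested to the right, an equation \<open>g \<cdot> f = k\<close> matches inside a longer
  composite only in this form.
\<close>
lemma Comp_reassoc:
  assumes "g \<cdot> f = k" "t \<in> Ar C" "f \<in> Ar C" "g \<in> Ar C" "Cod C f = Dom C g" "Cod C t = Dom C f"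
  shows "g \<cdot> (f \<cdot> t) = k \<cdot> t"
  using assms by (metis Comp_assoc')

lemma inv_arrow_simps [simp]:
  assumes "invertible C f"
  shows "f \<in> Ar C" "inv_arrow C f \<in> Ar C"
    "Dom C (inv_arrow C f) = Cod C f" "Cod C (inv_arrow C f) = Dom C f"
    "inv_arrow C f \<cdot> f = \<one> (Dom C f)" "f \<cdot> inv_arrow C f = \<one> (Cod C f)"
  using invertible_inv_arrow[OF category_axioms assms] by (auto simp: inverse_arrows_def)

lemma inv_arrow_cancel [simp]:
  assumes "invertible C f" "t \<in> Ar C"
  shows "Cod C t = Dom C f \<Longrightarrow> inv_arrow C f \<cdot> (f \<cdot> t) = t"
    "Cod C t = Cod C f \<Longrightarrow> f \<cdot> (inv_arrow C f \<cdot> t) = t"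
  using assms by (simp_all flip: Comp_assoc')

lemma invertibleI:
  assumes "f \<in> hom C X Y" "g \<in> hom C Y X" "g \<cdot> f = \<one> X" "f \<cdot> g = \<one> Y"
  shows "invertible C f"
  using assms unfolding invertible_def inverse_arrows_def in_hom by (intro exI[of _ g]) simp

lemma cancel_left:
  assumes "invertible C k" "k \<cdot> f = k \<cdot> g" "f \<in> Ar C" "g \<in> Ar C" "Cod C f = Dom C k" "Cod C g = Dom C k"
  shows "f = g"
  using assms by (metis inv_arrow_cancel(1))

lemma cancel_right:
  assumes "invertible C k" "f \<cdot> k = g \<cdot> k" "f \<in> Ar C" "g \<in> Ar C" "Dom C f = Cod C k" "Dom C g = Cod C k"
  shows "f = g"
proof -
  have "(f \<cdot> k) \<cdot> inv_arrow C k = (g \<cdot> k) \<cdot> inv_arrow C k" using assms by simp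
  then show ?thesis using assms(1,3-) by simp
qed

lemma invertible_Comp:
  assumes "invertible C f" "invertible C g" "Cod C f = Dom C g"
  shows "invertible C (g \<cdot> f)"
  using assms by (intro invertibleI[where g = "inv_arrow C f \<cdot> inv_arrow C g"]) auto

lemma invertible_Id [simp]: "X \<in> Ob C \<Longrightarrow> invertible C (\<one> X)"
  by (rule invertibleI[where g = "\<one> X"]) auto

lemma inv_arrow_Id [simp]: "X \<in> Ob C \<Longrightarrow> inv_arrow C (\<one> X) = \<one> X"
  using inv_arrow_simps(2,3,5)[of "\<one> X"] by simp

lemma inv_arrow_invertible [simp]: "invertible C f \<Longrightarrow> invertible C (inv_arrow C f)"
  by (rule invertibleI[where g = f]) auto

end

context monoidal_category begin

declare Unit_Ob [simp] TensO_Ob [simp]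

lemma TensA_simps [simp]:
  assumes "f \<in> Ar C" "g \<in> Ar C"
  shows "f \<otimes> g \<in> Ar C" "Dom C (f \<otimes> g) = Dom C f \<odot> Dom C g" "Cod C (f \<otimes> g) = Cod C f \<odot> Cod C g"
  using TensA_hom[of f "Dom C f" "Cod C f" g "Dom C g" "Cod C g"] assms by auto

declare TensA_Id [simp]

text \<open>
  This direction merges layers, so that both composites in \<open>(f \<otimes> 1) \<cdot> (1 \<otimes> g) = (1 \<otimes> g) \<cdot> (f \<otimes> 1)\<close>
  get the normal form \<open>f \<otimes> g\<close>.
\<close>
lemma interchange [simp]:
  assumes "f \<in> Ar C" "g \<in> Ar C" "f' \<in> Ar C" "g' \<in> Ar C" "Cod C f = Dom C g" "Cod C f' = Dom C g'"
  shows "(g \<otimes> g') \<cdot> (f \<otimes> f') = (g \<cdot> f) \<otimes> (g' \<cdot> f')"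
  using assms by (intro TensA_Comp[symmetric]) auto

lemma interchange_reassoc [simp]:
  assumes "f \<in> Ar C" "g \<in> Ar C" "f' \<in> Ar C" "g' \<in> Ar C" "Cod C f = Dom C g" "Cod C f' = Dom C g'"
    "t \<in> Ar C" "Cod C t = Dom C f \<odot> Dom C f'"
  shows "(g \<otimes> g') \<cdot> ((f \<otimes> f') \<cdot> t) = ((g \<cdot> f) \<otimes> (g' \<cdot> f')) \<cdot> t"
  using assms by (simp flip: Comp_assoc')

lemma Assoc_simps [simp]:
  assumes "X \<in> Ob C" "Y \<in> Ob C" "Z \<in> Ob C"
  shows "\<alpha> X Y Z \<in> Ar C" "Dom C (\<alpha> X Y Z) = (X \<odot> Y) \<odot> Z" "Cod C (\<alpha> X Y Z) = X \<odot> (Y \<odot> Z)"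
    "invertible C (\<alpha> X Y Z)"
  using Assoc_hom[OF assms] Assoc_invertible[OF assms] by auto

lemma Unit_simps [simp]:
  assumes "X \<in> Ob C"
  shows "\<ell> X \<in> Ar C" "Dom C (\<ell> X) = \<I> \<odot> X" "Cod C (\<ell> X) = X" "invertible C (\<ell> X)"
    "\<rho> X \<in> Ar C" "Dom C (\<rho> X) = X \<odot> \<I>" "Cod C (\<rho> X) = X" "invertible C (\<rho> X)"
  using LUnit_hom[OF assms] LUnit_invertible[OF assms] RUnit_hom[OF assms] RUnit_invertible[OF assms]
  by auto

lemma invertible_TensA [simp]:
  assumes "invertible C f" "invertible C g" shows "invertible C (f \<otimes> g)"
  using assms by (intro invertibleI[where g = "inv_arrow C f \<otimes> inv_arrow C g"]) auto

lemma Assoc_nat: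
  assumes "f \<in> Ar C" "g \<in> Ar C" "h \<in> Ar C" "Dom C f = X" "Dom C g = Y" "Dom C h = Z"
    "Cod C f = X'" "Cod C g = Y'" "Cod C h = Z'"
  shows "\<alpha> X' Y' Z' \<cdot> ((f \<otimes> g) \<otimes> h) = (f \<otimes> (g \<otimes> h)) \<cdot> \<alpha> X Y Z"
  using assms by (intro Assoc_natural) auto

lemma LUnit_nat: "f \<in> Ar C \<Longrightarrow> Cod C f = Y \<Longrightarrow> \<ell> Y \<cdot> (\<one> \<I> \<otimes> f) = f \<cdot> \<ell> (Dom C f)"
  by (intro LUnit_natural) auto

lemma RUnit_nat: "f \<in> Ar C \<Longrightarrow> Cod C f = Y \<Longrightarrow> \<rho> Y \<cdot> (f \<otimes> \<one> \<I>) = f \<cdot> \<rho> (Dom C f)"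
  by (intro RUnit_natural) auto

lemma Assoc_inv_nat:
  assumes "f \<in> Ar C" "g \<in> Ar C" "h \<in> Ar C" "Dom C f = X" "Dom C g = Y" "Dom C h = Z"
    "Cod C f = X'" "Cod C g = Y'" "Cod C h = Z'"
  shows "inv_arrow C (\<alpha> X' Y' Z') \<cdot> (f \<otimes> (g \<otimes> h)) = ((f \<otimes> g) \<otimes> h) \<cdot> inv_arrow C (\<alpha> X Y Z)"
proof (rule cancel_left)
  have [simp]: "X \<in> Ob C" "Y \<in> Ob C" "Z \<in> Ob C" "X' \<in> Ob C" "Y' \<in> Ob C" "Z' \<in> Ob C"
    using assms by auto
  show "invertible C (\<alpha> X' Y' Z')" by simp
  have "\<alpha> X' Y' Z' \<cdot> (((f \<otimes> g) \<otimes> h) \<cdot> inv_arrow C (\<alpha> X Y Z))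
      = (\<alpha> X' Y' Z' \<cdot> ((f \<otimes> g) \<otimes> h)) \<cdot> inv_arrow C (\<alpha> X Y Z)"
    using assms by simp
  also have "\<dots> = f \<otimes> (g \<otimes> h)"
    unfolding Assoc_nat[OF assms] using assms by simp
  finally show "\<alpha> X' Y' Z' \<cdot> (inv_arrow C (\<alpha> X' Y' Z') \<cdot> (f \<otimes> (g \<otimes> h)))
      = \<alpha> X' Y' Z' \<cdot> (((f \<otimes> g) \<otimes> h) \<cdot> inv_arrow C (\<alpha> X Y Z))"
    using assms by simp
qed (use assms in auto)

lemma LUnit_inv_nat:
  assumes "f \<in> Ar C" "Dom C f = X" "Cod C f = Y"
  shows "inv_arrow C (\<ell> Y) \<cdot> f = (\<one> \<I> \<otimes> f) \<cdot> inv_arrow C (\<ell> X)"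
proof (rule cancel_left)
  have [simp]: "X \<in> Ob C" "Y \<in> Ob C" using assms by auto
  show "invertible C (\<ell> Y)" by simp
  have "\<ell> Y \<cdot> ((\<one> \<I> \<otimes> f) \<cdot> inv_arrow C (\<ell> X)) = f \<cdot> \<ell> X \<cdot> inv_arrow C (\<ell> X)"
    using assms LUnit_nat[of f Y] by (subst Comp_reassoc[of "\<ell> Y" _ "f \<cdot> \<ell> X"]) simp_all
  then show "\<ell> Y \<cdot> (inv_arrow C (\<ell> Y) \<cdot> f) = \<ell> Y \<cdot> ((\<one> \<I> \<otimes> f) \<cdot> inv_arrow C (\<ell> X))"
    using assms by simp
qed (use assms in auto)

lemma RUnit_inv_nat:
  assumes "f \<in> Ar C" "Dom C f = X" "Cod C f = Y"
  shows "inv_arrow C (\<rho> Y) \<cdot> f = (f \<otimes> \<one> \<I>) \<cdot> inv_arrow C (\<rho> X)"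
proof (rule cancel_left)
  have [simp]: "X \<in> Ob C" "Y \<in> Ob C" using assms by auto
  show "invertible C (\<rho> Y)" by simp
  have "\<rho> Y \<cdot> ((f \<otimes> \<one> \<I>) \<cdot> inv_arrow C (\<rho> X)) = f \<cdot> \<rho> X \<cdot> inv_arrow C (\<rho> X)"
    using assms RUnit_nat[of f Y] by (subst Comp_reassoc[of "\<rho> Y" _ "f \<cdot> \<rho> X"]) simp_all
  then show "\<rho> Y \<cdot> (inv_arrow C (\<rho> Y) \<cdot> f) = \<rho> Y \<cdot> ((f \<otimes> \<one> \<I>) \<cdot> inv_arrow C (\<rho> X))"
    using assms by simp
qed (use assms in auto)

section \<open>Coherence of the unit constraints\<close>

text \<open>
  By naturality of the unit constraint, \<open>f\<close> is recovered from \<open>\<one> \<I> \<otimes> f\<close> by conjugation. Equations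
  may therefore be checked after tensoring with \<open>\<I>\<close>, where the pentagon and the triangle apply.
\<close>
lemma Unit_faithful_left:
  assumes "f \<in> hom C X Y" "g \<in> hom C X Y" "\<one> \<I> \<otimes> f = \<one> \<I> \<otimes> g"
  shows "f = g"
proof -
  have "f \<cdot> \<ell> X = g \<cdot> \<ell> X" using assms LUnit_nat[of f Y] LUnit_nat[of g Y] by simp
  moreover have "X \<in> Ob C" using assms by auto
  ultimately show ?thesis using assms by (intro cancel_right[of "\<ell> X" f g]) auto
qed

lemma Unit_faithful_right:
  assumes "f \<in> hom C X Y" "g \<in> hom C X Y" "f \<otimes> \<one> \<I> = g \<otimes> \<one> \<I>"
  shows "f = g"
proof -
  have "f \<cdot> \<rho> X = g \<cdot> \<rho> X" using assms RUnit_nat[of f Y] RUnit_nat[of g Y] by simp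
  moreover have "X \<in> Ob C" using assms by auto
  ultimately show ?thesis using assms by (intro cancel_right[of "\<rho> X" f g]) auto
qed

text \<open>
  Kelly's argument: the pentagon for \<open>\<I>, \<I>, X, Y\<close> followed by the triangle gives the equation
  tensored with \<open>\<I>\<close> on the left and precomposed with an isomorphism \<open>?k\<close>.
\<close>
lemma LUnit_TensO:
  assumes X [simp]: "X \<in> Ob C" and Y [simp]: "Y \<in> Ob C"
  shows "\<ell> (X \<odot> Y) \<cdot> \<alpha> \<I> X Y = \<ell> X \<otimes> \<one> Y"
proof (rule Unit_faithful_left)
  let ?k = "\<alpha> \<I> (\<I> \<odot> X) Y \<cdot> (\<alpha> \<I> \<I> X \<otimes> \<one> Y)"
  have k: "invertible C ?k" by (intro invertible_Comp) auto
  have "(\<one> \<I> \<otimes> (\<ell> (X \<odot> Y) \<cdot> \<alpha> \<I> X Y)) \<cdot> ?k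
      = (\<one> \<I> \<otimes> \<ell> (X \<odot> Y)) \<cdot> ((\<one> \<I> \<otimes> \<alpha> \<I> X Y) \<cdot> \<alpha> \<I> (\<I> \<odot> X) Y \<cdot> (\<alpha> \<I> \<I> X \<otimes> \<one> Y))"
    by simp
  also have "\<dots> = (\<one> \<I> \<otimes> \<ell> (X \<odot> Y)) \<cdot> (\<alpha> \<I> \<I> (X \<odot> Y) \<cdot> \<alpha> (\<I> \<odot> \<I>) X Y)"
    by (simp only: pentagon[OF Unit_Ob Unit_Ob X Y])
  also have "\<dots> = (\<rho> \<I> \<otimes> (\<one> X \<otimes> \<one> Y)) \<cdot> \<alpha> (\<I> \<odot> \<I>) X Y"
    using triangle[of \<I> "X \<odot> Y"] by (simp flip: Comp_assoc')
  also have "\<dots> = \<alpha> \<I> X Y \<cdot> (((\<one> \<I> \<otimes> \<ell> X) \<cdot> \<alpha> \<I> \<I> X) \<otimes> \<one> Y)"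
    unfolding triangle[OF Unit_Ob X] by (rule Assoc_nat[symmetric]) auto
  also have "\<dots> = (\<alpha> \<I> X Y \<cdot> ((\<one> \<I> \<otimes> \<ell> X) \<otimes> \<one> Y)) \<cdot> (\<alpha> \<I> \<I> X \<otimes> \<one> Y)"
    by simp
  also have "\<alpha> \<I> X Y \<cdot> ((\<one> \<I> \<otimes> \<ell> X) \<otimes> \<one> Y) = (\<one> \<I> \<otimes> (\<ell> X \<otimes> \<one> Y)) \<cdot> \<alpha> \<I> (\<I> \<odot> X) Y"
    by (rule Assoc_nat) auto
  finally have "(\<one> \<I> \<otimes> (\<ell> (X \<odot> Y) \<cdot> \<alpha> \<I> X Y)) \<cdot> ?k = (\<one> \<I> \<otimes> (\<ell> X \<otimes> \<one> Y)) \<cdot> ?k"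
    by simp
  from cancel_right[OF k this] show "\<one> \<I> \<otimes> (\<ell> (X \<odot> Y) \<cdot> \<alpha> \<I> X Y) = \<one> \<I> \<otimes> (\<ell> X \<otimes> \<one> Y)"
    by simp
qed auto

text \<open>
  The mirror image, from the pentagon for \<open>X, Y, \<I>, \<I>\<close>.
\<close>
lemma RUnit_TensO:
  assumes X [simp]: "X \<in> Ob C" and Y [simp]: "Y \<in> Ob C"
  shows "(\<one> X \<otimes> \<rho> Y) \<cdot> \<alpha> X Y \<I> = \<rho> (X \<odot> Y)"
proof (rule Unit_faithful_right)
  have "\<alpha> X Y \<I> \<cdot> (((\<one> X \<otimes> \<rho> Y) \<cdot> \<alpha> X Y \<I>) \<otimes> \<one> \<I>)
      = (\<alpha> X Y \<I> \<cdot> ((\<one> X \<otimes> \<rho> Y) \<otimes> \<one> \<I>)) \<cdot> (\<alpha> X Y \<I> \<otimes> \<one> \<I>)"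
    by simp
  also have "\<alpha> X Y \<I> \<cdot> ((\<one> X \<otimes> \<rho> Y) \<otimes> \<one> \<I>) = (\<one> X \<otimes> (\<rho> Y \<otimes> \<one> \<I>)) \<cdot> \<alpha> X (Y \<odot> \<I>) \<I>"
    by (rule Assoc_nat) auto
  also have "\<one> X \<otimes> (\<rho> Y \<otimes> \<one> \<I>) = (\<one> X \<otimes> (\<one> Y \<otimes> \<ell> \<I>)) \<cdot> (\<one> X \<otimes> \<alpha> Y \<I> \<I>)"
    by (simp add: triangle)
  also have "\<dots> \<cdot> \<alpha> X (Y \<odot> \<I>) \<I> \<cdot> (\<alpha> X Y \<I> \<otimes> \<one> \<I>)
      = (\<one> X \<otimes> (\<one> Y \<otimes> \<ell> \<I>)) \<cdot> ((\<one> X \<otimes> \<alpha> Y \<I> \<I>) \<cdot> \<alpha> X (Y \<odot> \<I>) \<I> \<cdot> (\<alpha> X Y \<I> \<otimes> \<one> \<I>))"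
    by simp
  also have "\<dots> = (\<one> X \<otimes> (\<one> Y \<otimes> \<ell> \<I>)) \<cdot> (\<alpha> X Y (\<I> \<odot> \<I>) \<cdot> \<alpha> (X \<odot> Y) \<I> \<I>)"
    by (simp only: pentagon[OF X Y Unit_Ob Unit_Ob])
  also have "\<dots> = ((\<one> X \<otimes> (\<one> Y \<otimes> \<ell> \<I>)) \<cdot> \<alpha> X Y (\<I> \<odot> \<I>)) \<cdot> \<alpha> (X \<odot> Y) \<I> \<I>"
    by simp
  also have "(\<one> X \<otimes> (\<one> Y \<otimes> \<ell> \<I>)) \<cdot> \<alpha> X Y (\<I> \<odot> \<I>) = \<alpha> X Y \<I> \<cdot> ((\<one> X \<otimes> \<one> Y) \<otimes> \<ell> \<I>)"
    by (rule Assoc_nat[symmetric]) auto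
  also have "\<dots> \<cdot> \<alpha> (X \<odot> Y) \<I> \<I> = \<alpha> X Y \<I> \<cdot> (\<rho> (X \<odot> Y) \<otimes> \<one> \<I>)"
    by (simp add: triangle)
  finally show "((\<one> X \<otimes> \<rho> Y) \<cdot> \<alpha> X Y \<I>) \<otimes> \<one> \<I> = \<rho> (X \<odot> Y) \<otimes> \<one> \<I>"
    by (rule cancel_left[rotated]) auto
qed auto

text \<open>
  This equation makes \<open>\<I>\<close> satisfy the right unit law of a monoid.
\<close>
lemma LUnit_eq_RUnit: "\<ell> \<I> = \<rho> \<I>"
proof (rule Unit_faithful_right)
  have "\<ell> \<I> \<cdot> (\<one> \<I> \<otimes> \<ell> \<I>) = \<ell> \<I> \<cdot> \<ell> (\<I> \<odot> \<I>)" by (simp add: LUnit_nat)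
  then have "\<one> \<I> \<otimes> \<ell> \<I> = \<ell> (\<I> \<odot> \<I>)" by (rule cancel_left[rotated]) auto
  then show "\<ell> \<I> \<otimes> \<one> \<I> = \<rho> \<I> \<otimes> \<one> \<I>"
    using LUnit_TensO[of \<I> \<I>] triangle[of \<I> \<I>] by simp
qed auto

text \<open>
  The triangle and its two variants, solved for inverse constraints as they occur in
  computations with the arrows \<open>X \<rightarrow> X \<odot> \<I>\<close> and \<open>X \<rightarrow> \<I> \<odot> X\<close>.
\<close>
lemma Assoc_Unit_inv:
  assumes [simp]: "X \<in> Ob C" "Y \<in> Ob C"
  shows "\<alpha> X \<I> Y \<cdot> (inv_arrow C (\<rho> X) \<otimes> \<one> Y) = \<one> X \<otimes> inv_arrow C (\<ell> Y)"
    "\<alpha> \<I> X Y \<cdot> (inv_arrow C (\<ell> X) \<otimes> \<one> Y) = inv_arrow C (\<ell> (X \<odot> Y))"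
    "inv_arrow C (\<alpha> X \<I> Y) \<cdot> (\<one> X \<otimes> inv_arrow C (\<ell> Y)) = inv_arrow C (\<rho> X) \<otimes> \<one> Y"
    "inv_arrow C (\<alpha> X Y \<I>) \<cdot> (\<one> X \<otimes> inv_arrow C (\<rho> Y)) = inv_arrow C (\<rho> (X \<odot> Y))"
proof -
  show 1: "\<alpha> X \<I> Y \<cdot> (inv_arrow C (\<rho> X) \<otimes> \<one> Y) = \<one> X \<otimes> inv_arrow C (\<ell> Y)"
    by (rule cancel_left[of "\<one> X \<otimes> \<ell> Y"])
      (simp_all add: Comp_reassoc[OF triangle])
  show "\<alpha> \<I> X Y \<cdot> (inv_arrow C (\<ell> X) \<otimes> \<one> Y) = inv_arrow C (\<ell> (X \<odot> Y))"
    by (rule cancel_left[of "\<ell> (X \<odot> Y)"])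
      (simp_all add: Comp_reassoc[OF LUnit_TensO])
  show "inv_arrow C (\<alpha> X \<I> Y) \<cdot> (\<one> X \<otimes> inv_arrow C (\<ell> Y)) = inv_arrow C (\<rho> X) \<otimes> \<one> Y"
    by (simp flip: 1)
  have 4: "\<rho> (X \<odot> Y) \<cdot> (inv_arrow C (\<alpha> X Y \<I>) \<cdot> t) = (\<one> X \<otimes> \<rho> Y) \<cdot> t"
    if "t \<in> Ar C" "Cod C t = X \<odot> (Y \<odot> \<I>)" for t
    using that RUnit_TensO[of X Y, symmetric] by simp
  show "inv_arrow C (\<alpha> X Y \<I>) \<cdot> (\<one> X \<otimes> inv_arrow C (\<rho> Y)) = inv_arrow C (\<rho> (X \<odot> Y))"
    by (rule cancel_left[of "\<rho> (X \<odot> Y)"])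
      (simp_all add: 4)
qed

end

section \<open>A criterion for equivalence\<close>

text \<open>
  A quasi-inverse chooses for each object \<open>Y\<close> an isomorphism \<open>k Y\<close> from \<open>Y\<close> to some \<open>Fo (Go Y)\<close>. It
  sends an arrow to the unique lift of its conjugate by these isomorphisms, and the unit of the
  equivalence is the lift of \<open>k (Fo X)\<close>. All equations between lifts follow from faithfulness.
\<close>
lemma equivalent_categories_fully_faithful:
  fixes C :: "('o, 'a, 'z) cat_scheme" and D :: "('p, 'b, 'y) cat_scheme"
  assumes C: "category C" and D: "category D" and F: "is_functor C D Fo Fa"
    and full_faithful: "\<And>X X' g. X \<in> Ob C \<Longrightarrow> X' \<in> Ob C \<Longrightarrow> g \<in> hom D (Fo X) (Fo X') \<Longrightarrow>
      \<exists>!f. f \<in> hom C X X' \<and> Fa f = g"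
    and surjective: "\<And>Y. Y \<in> Ob D \<Longrightarrow> \<exists>X \<in> Ob C. \<exists>k \<in> hom D Y (Fo X). invertible D k"
  shows "equivalent_categories C D"
proof -
  interpret C: category C by fact
  interpret D: category D by fact
  have Fo [simp]: "X \<in> Ob C \<Longrightarrow> Fo X \<in> Ob D"
    and Fa [simp]: "f \<in> Ar C \<Longrightarrow> Fa f \<in> Ar D" "f \<in> Ar C \<Longrightarrow> Dom D (Fa f) = Fo (Dom C f)"
      "f \<in> Ar C \<Longrightarrow> Cod D (Fa f) = Fo (Cod C f)"
    and Fa_Id [simp]: "X \<in> Ob C \<Longrightarrow> Fa (\<one>\<^bsub>C\<^esub> X) = \<one>\<^bsub>D\<^esub> (Fo X)"
    and Fa_Comp [simp]: "f \<in> Ar C \<Longrightarrow> g \<in> Ar C \<Longrightarrow> Cod C f = Dom C g \<Longrightarrow>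
      Fa (g \<cdot>\<^bsub>C\<^esub> f) = Fa g \<cdot>\<^bsub>D\<^esub> Fa f" for f g X
    using F unfolding is_functor_def by auto
  \<comment> \<open>Object and isomorphism are chosen together, as a pair.\<close>
  have "\<forall>Y \<in> Ob D. \<exists>Xk. fst Xk \<in> Ob C \<and> snd Xk \<in> hom D Y (Fo (fst Xk)) \<and> invertible D (snd Xk)"
    by (metis surjective fst_conv snd_conv)
  then obtain Xk where Xk: "\<forall>Y \<in> Ob D. fst (Xk Y) \<in> Ob C \<and> snd (Xk Y) \<in> hom D Y (Fo (fst (Xk Y))) \<and>
      invertible D (snd (Xk Y))"
    by (rule bchoice[THEN exE])
  define Go k where "Go = (\<lambda>Y. fst (Xk Y))" and "k = (\<lambda>Y. snd (Xk Y))"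
  have k [simp]: "Y \<in> Ob D \<Longrightarrow> Go Y \<in> Ob C" "Y \<in> Ob D \<Longrightarrow> invertible D (k Y)"
    "Y \<in> Ob D \<Longrightarrow> Dom D (k Y) = Y" "Y \<in> Ob D \<Longrightarrow> Cod D (k Y) = Fo (Go Y)" for Y
    using Xk by (auto simp: Go_def k_def)
  define lift where "lift X X' g = (THE f. f \<in> hom C X X' \<and> Fa f = g)" for X X' g
  have lift: "lift X X' g \<in> hom C X X' \<and> Fa (lift X X' g) = g"
    if "X \<in> Ob C" "X' \<in> Ob C" "g \<in> hom D (Fo X) (Fo X')" for X X' g
    unfolding lift_def using theI'[OF full_faithful[OF that]] .
  have lift_simps [simp]: "lift X X' g \<in> Ar C" "Dom C (lift X X' g) = X" "Cod C (lift X X' g) = X'"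
    "Fa (lift X X' g) = g"
    if "X \<in> Ob C" "X' \<in> Ob C" "g \<in> Ar D" "Dom D g = Fo X" "Cod D g = Fo X'" for X X' g
    using lift[of X X' g] that by auto
  have faithful: "f = f'"
    if "f \<in> Ar C" "f' \<in> Ar C" "Dom C f = Dom C f'" "Cod C f = Cod C f'" "Fa f = Fa f'" for f f'
    using full_faithful[of "Dom C f'" "Cod C f'" "Fa f'"] that by fastforce
  define Ga where "Ga g = lift (Go (Dom D g)) (Go (Cod D g)) (k (Cod D g) \<cdot>\<^bsub>D\<^esub> (g \<cdot>\<^bsub>D\<^esub> inv_arrow D (k (Dom D g))))"
    for g
  define \<eta> where "\<eta> X = lift X (Go (Fo X)) (k (Fo X))" for X
  have Ga [simp]: "Ga g \<in> Ar C" "Dom C (Ga g) = Go (Dom D g)" "Cod C (Ga g) = Go (Cod D g)"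
      "Fa (Ga g) = k (Cod D g) \<cdot>\<^bsub>D\<^esub> (g \<cdot>\<^bsub>D\<^esub> inv_arrow D (k (Dom D g)))" if "g \<in> Ar D" for g
    unfolding Ga_def using that by simp_all
  have \<eta> [simp]: "\<eta> X \<in> Ar C" "Dom C (\<eta> X) = X" "Cod C (\<eta> X) = Go (Fo X)" "Fa (\<eta> X) = k (Fo X)"
    if "X \<in> Ob C" for X
    unfolding \<eta>_def using that by simp_all
  have "is_functor D C Go Ga"
    unfolding is_functor_def
  proof (intro conjI ballI impI)
    show "Ga (\<one>\<^bsub>D\<^esub> Y) = \<one>\<^bsub>C\<^esub> (Go Y)" if "Y \<in> Ob D" for Y
      using that by (intro faithful) simp_all
    show "Ga (g \<cdot>\<^bsub>D\<^esub> f) = Ga g \<cdot>\<^bsub>C\<^esub> Ga f" if "f \<in> Ar D" "g \<in> Ar D" "Cod D f = Dom D g" for f g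
      using that by (intro faithful) simp_all
  qed simp_all
  moreover have "invertible C (\<eta> X)" if X [simp]: "X \<in> Ob C" for X
  proof -
    let ?h = "lift (Go (Fo X)) X (inv_arrow D (k (Fo X)))"
    have "?h \<cdot>\<^bsub>C\<^esub> \<eta> X = \<one>\<^bsub>C\<^esub> X" "\<eta> X \<cdot>\<^bsub>C\<^esub> ?h = \<one>\<^bsub>C\<^esub> (Go (Fo X))"
      by (intro faithful; simp)+
    then show ?thesis by (intro C.invertibleI[of _ X "Go (Fo X)" ?h]) simp_all
  qed
  then have "is_natural_iso C C id id (Go \<circ> Fo) (Ga \<circ> Fa) \<eta>"
    unfolding is_natural_iso_def by (auto intro!: faithful)
  moreover have "is_natural_iso D D (Fo \<circ> Go) (Fa \<circ> Ga) id id (\<lambda>Y. inv_arrow D (k Y))"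
    unfolding is_natural_iso_def by simp
  ultimately show ?thesis
    unfolding equivalent_categories_def using C D F by blast
qed

section \<open>Monoids and convolution\<close>

context monoidal_category begin

lemma is_mon_simps [simp]:
  assumes "is_mon C M"
  shows "obj M \<in> Ob C" "mlt M \<in> Ar C" "Dom C (mlt M) = obj M \<odot> obj M" "Cod C (mlt M) = obj M"
    "unt M \<in> Ar C" "Dom C (unt M) = \<I>" "Cod C (unt M) = obj M"
  using assms unfolding is_mon_def by auto

lemma is_mon_laws:
  assumes "is_mon C M"
  shows "mlt M \<cdot> (mlt M \<otimes> \<one> (obj M)) = mlt M \<cdot> ((\<one> (obj M) \<otimes> mlt M) \<cdot> \<alpha> (obj M) (obj M) (obj M))"
    "mlt M \<cdot> (unt M \<otimes> \<one> (obj M)) = \<ell> (obj M)"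
    "mlt M \<cdot> (\<one> (obj M) \<otimes> unt M) = \<rho> (obj M)"
  using assms is_mon_simps[OF assms] unfolding is_mon_def by auto

lemma is_mon_unt_reassoc:
  assumes "is_mon C M" "t \<in> Ar C"
  shows "Cod C t = \<I> \<odot> obj M \<Longrightarrow> mlt M \<cdot> ((unt M \<otimes> \<one> (obj M)) \<cdot> t) = \<ell> (obj M) \<cdot> t"
    "Cod C t = obj M \<odot> \<I> \<Longrightarrow> mlt M \<cdot> ((\<one> (obj M) \<otimes> unt M) \<cdot> t) = \<rho> (obj M) \<cdot> t"
  using assms is_mon_laws[OF assms(1)] by (auto intro!: Comp_reassoc)

text \<open>
  The product of two generalised elements \<open>f : X \<rightarrow> M\<close> and \<open>g : Z \<rightarrow> M\<close>, itself a generalised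
  element at \<open>X \<odot> Z\<close>.
\<close>
definition conv :: "'a \<Rightarrow> ('o, 'a) mon \<Rightarrow> 'a \<Rightarrow> 'a" ("(_ \<star>\<^bsub>_\<^esub> _)" [70, 0, 71] 70) where
  "f \<star>\<^bsub>M\<^esub> g = mlt M \<cdot> (f \<otimes> g)"

lemma conv_simps [simp]:
  assumes "is_mon C M" "f \<in> Ar C" "g \<in> Ar C" "Cod C f = obj M" "Cod C g = obj M"
  shows "f \<star>\<^bsub>M\<^esub> g \<in> Ar C" "Dom C (f \<star>\<^bsub>M\<^esub> g) = Dom C f \<odot> Dom C g" "Cod C (f \<star>\<^bsub>M\<^esub> g) = obj M"
  using assms by (auto simp: conv_def)

lemma conv_TensA [simp]:
  assumes "is_mon C M" "f \<in> Ar C" "g \<in> Ar C" "Cod C f = obj M" "Cod C g = obj M"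
    "h \<in> Ar C" "k \<in> Ar C" "Cod C h = Dom C f" "Cod C k = Dom C g"
  shows "f \<star>\<^bsub>M\<^esub> g \<cdot> (h \<otimes> k) = (f \<cdot> h) \<star>\<^bsub>M\<^esub> (g \<cdot> k)"
  using assms by (simp add: conv_def)

lemma conv_TensA_reassoc [simp]:
  assumes "is_mon C M" "f \<in> Ar C" "g \<in> Ar C" "Cod C f = obj M" "Cod C g = obj M"
    "h \<in> Ar C" "k \<in> Ar C" "Cod C h = Dom C f" "Cod C k = Dom C g"
    "t \<in> Ar C" "Cod C t = Dom C h \<odot> Dom C k"
  shows "f \<star>\<^bsub>M\<^esub> g \<cdot> ((h \<otimes> k) \<cdot> t) = (f \<cdot> h) \<star>\<^bsub>M\<^esub> (g \<cdot> k) \<cdot> t"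
  using assms by (intro Comp_reassoc) auto

text \<open>
  The associativity of \<open>M\<close> transported along \<open>(f \<otimes> g) \<otimes> h\<close>. Left to right, the rule absorbs an
  associator into the bracketing, so that no constraint remains in the computations below.
\<close>
lemma conv_assoc [simp]:
  assumes "is_mon C M" "f \<in> Ar C" "g \<in> Ar C" "h \<in> Ar C" "Cod C f = obj M" "Cod C g = obj M"
    "Cod C h = obj M" "Dom C f = X" "Dom C g = Y" "Dom C h = Z"
  shows "f \<star>\<^bsub>M\<^esub> (g \<star>\<^bsub>M\<^esub> h) \<cdot> \<alpha> X Y Z = f \<star>\<^bsub>M\<^esub> g \<star>\<^bsub>M\<^esub> h"
proof -
  let ?M = "obj M" and ?m = "mlt M"
  have "f \<star>\<^bsub>M\<^esub> g \<star>\<^bsub>M\<^esub> h = (?m \<cdot> (?m \<otimes> \<one> ?M)) \<cdot> ((f \<otimes> g) \<otimes> h)"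
    using assms by (simp add: conv_def)
  also have "\<dots> = ?m \<cdot> ((\<one> ?M \<otimes> ?m) \<cdot> (\<alpha> ?M ?M ?M \<cdot> ((f \<otimes> g) \<otimes> h)))"
    using assms by (simp add: is_mon_laws(1))
  also have "\<alpha> ?M ?M ?M \<cdot> ((f \<otimes> g) \<otimes> h) = (f \<otimes> (g \<otimes> h)) \<cdot> \<alpha> X Y Z"
    using assms by (intro Assoc_nat) auto
  also have "?m \<cdot> ((\<one> ?M \<otimes> ?m) \<cdot> \<dots>) = f \<star>\<^bsub>M\<^esub> (g \<star>\<^bsub>M\<^esub> h) \<cdot> \<alpha> X Y Z"
    using assms by (auto simp: conv_def)
  finally show ?thesis ..
qed

lemma conv_assoc_variants [simp]:
  assumes "is_mon C M" "f \<in> Ar C" "g \<in> Ar C" "h \<in> Ar C" "Cod C f = obj M" "Cod C g = obj M"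
    "Cod C h = obj M" "Dom C f = X" "Dom C g = Y" "Dom C h = Z"
  shows "f \<star>\<^bsub>M\<^esub> g \<star>\<^bsub>M\<^esub> h \<cdot> inv_arrow C (\<alpha> X Y Z) = f \<star>\<^bsub>M\<^esub> (g \<star>\<^bsub>M\<^esub> h)"
    "t \<in> Ar C \<Longrightarrow> Cod C t = (X \<odot> Y) \<odot> Z \<Longrightarrow>
      f \<star>\<^bsub>M\<^esub> (g \<star>\<^bsub>M\<^esub> h) \<cdot> (\<alpha> X Y Z \<cdot> t) = f \<star>\<^bsub>M\<^esub> g \<star>\<^bsub>M\<^esub> h \<cdot> t"
    "t \<in> Ar C \<Longrightarrow> Cod C t = X \<odot> Y \<odot> Z \<Longrightarrow>
      f \<star>\<^bsub>M\<^esub> g \<star>\<^bsub>M\<^esub> h \<cdot> (inv_arrow C (\<alpha> X Y Z) \<cdot> t) = f \<star>\<^bsub>M\<^esub> (g \<star>\<^bsub>M\<^esub> h) \<cdot> t"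
proof -
  have XYZ: "X \<in> Ob C" "Y \<in> Ob C" "Z \<in> Ob C" using assms(2-4,8-10) by auto
  have *: "f \<star>\<^bsub>M\<^esub> g \<star>\<^bsub>M\<^esub> h \<cdot> inv_arrow C (\<alpha> X Y Z) = f \<star>\<^bsub>M\<^esub> (g \<star>\<^bsub>M\<^esub> h)"
    using assms XYZ by (subst conv_assoc[OF assms, symmetric]) (simp del: conv_assoc)
  then show "f \<star>\<^bsub>M\<^esub> g \<star>\<^bsub>M\<^esub> h \<cdot> inv_arrow C (\<alpha> X Y Z) = f \<star>\<^bsub>M\<^esub> (g \<star>\<^bsub>M\<^esub> h)" .
  show "f \<star>\<^bsub>M\<^esub> (g \<star>\<^bsub>M\<^esub> h) \<cdot> (\<alpha> X Y Z \<cdot> t) = f \<star>\<^bsub>M\<^esub> g \<star>\<^bsub>M\<^esub> h \<cdot> t"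
    if "t \<in> Ar C" "Cod C t = (X \<odot> Y) \<odot> Z"
    using that assms XYZ by (intro Comp_reassoc[OF conv_assoc]) auto
  show "f \<star>\<^bsub>M\<^esub> g \<star>\<^bsub>M\<^esub> h \<cdot> (inv_arrow C (\<alpha> X Y Z) \<cdot> t) = f \<star>\<^bsub>M\<^esub> (g \<star>\<^bsub>M\<^esub> h) \<cdot> t"
    if "t \<in> Ar C" "Cod C t = X \<odot> Y \<odot> Z"
    using that assms XYZ by (intro Comp_reassoc[OF *]) auto
qed

lemma conv_unt [simp]:
  assumes "is_mon C M" "f \<in> Ar C" "Cod C f = obj M"
  shows "unt M \<star>\<^bsub>M\<^esub> f = f \<cdot> \<ell> (Dom C f)" "f \<star>\<^bsub>M\<^esub> unt M = f \<cdot> \<rho> (Dom C f)"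
proof -
  have "unt M \<star>\<^bsub>M\<^esub> f = (mlt M \<cdot> (unt M \<otimes> \<one> (obj M))) \<cdot> (\<one> \<I> \<otimes> f)"
    using assms by (simp add: conv_def)
  then show "unt M \<star>\<^bsub>M\<^esub> f = f \<cdot> \<ell> (Dom C f)"
    using assms by (simp only: is_mon_laws LUnit_nat)
  have "f \<star>\<^bsub>M\<^esub> unt M = (mlt M \<cdot> (\<one> (obj M) \<otimes> unt M)) \<cdot> (f \<otimes> \<one> \<I>)"
    using assms by (simp add: conv_def)
  then show "f \<star>\<^bsub>M\<^esub> unt M = f \<cdot> \<rho> (Dom C f)"
    using assms by (simp only: is_mon_laws RUnit_nat)
qed

lemma conv_unt_Comp:
  assumes "is_mon C M" "f \<in> Ar C" "Cod C f = \<I>" "g \<in> Ar C" "Cod C g = obj M"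
  shows "(unt M \<cdot> f) \<star>\<^bsub>M\<^esub> g = g \<cdot> (\<ell> (Dom C g) \<cdot> (f \<otimes> \<one> (Dom C g)))"
    and "g \<star>\<^bsub>M\<^esub> (unt M \<cdot> f) = g \<cdot> (\<rho> (Dom C g) \<cdot> (\<one> (Dom C g) \<otimes> f))"
  using assms conv_TensA[of M "unt M" g f "\<one> (Dom C g)"] conv_TensA[of M g "unt M" "\<one> (Dom C g)" f]
  by simp_all

lemma is_mon_hom_iff:
  "is_mon_hom C M N f \<longleftrightarrow> f \<in> hom C (obj M) (obj N) \<and> f \<cdot> mlt M = f \<star>\<^bsub>N\<^esub> f \<and> f \<cdot> unt M = unt N"
  by (simp add: is_mon_hom_def conv_def)

lemma is_mon_hom_simps:
  assumes "is_mon_hom C M N f"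
  shows "f \<in> Ar C" "Dom C f = obj M" "Cod C f = obj N" "f \<cdot> mlt M = f \<star>\<^bsub>N\<^esub> f" "f \<cdot> unt M = unt N"
  using assms by (auto simp: is_mon_hom_iff)

lemma is_mon_hom_conv:
  assumes "is_mon C M" "is_mon C N" "is_mon_hom C M N h"
    "f \<in> Ar C" "g \<in> Ar C" "Cod C f = obj M" "Cod C g = obj M"
  shows "h \<cdot> f \<star>\<^bsub>M\<^esub> g = (h \<cdot> f) \<star>\<^bsub>N\<^esub> (h \<cdot> g)"
proof -
  note [simp] = is_mon_hom_simps(1-3)[OF assms(3)]
  have "h \<cdot> f \<star>\<^bsub>M\<^esub> g = (h \<cdot> mlt M) \<cdot> (f \<otimes> g)"
    using assms by (simp add: conv_def)
  also have "\<dots> = h \<star>\<^bsub>N\<^esub> h \<cdot> (f \<otimes> g)"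
    by (simp only: is_mon_hom_simps(4)[OF assms(3)])
  finally show ?thesis using assms by simp
qed

lemma is_mon_hom_Id: "is_mon C M \<Longrightarrow> is_mon_hom C M M (\<one> (obj M))"
  by (simp add: is_mon_hom_def)

lemma is_mon_hom_Comp:
  assumes "is_mon C L" "is_mon C M" "is_mon C N" "is_mon_hom C L M f" "is_mon_hom C M N g"
  shows "is_mon_hom C L N (g \<cdot> f)"
proof -
  note [simp] = is_mon_hom_simps[OF assms(4)] is_mon_hom_simps[OF assms(5)]
  show ?thesis
    using assms(1-3) is_mon_hom_conv[OF assms(2,3,5), of f f] by (simp add: is_mon_hom_iff)
qed

text \<open>
  The inverse respects products because \<open>f\<close> does and \<open>f\<close> can be cancelled.
\<close>
lemma is_mon_hom_inv_arrow:
  assumes "is_mon C M" "is_mon C N" "is_mon_hom C M N f" "invertible C f"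
  shows "is_mon_hom C N M (inv_arrow C f)"
proof -
  note [simp] = is_mon_hom_simps(1-3)[OF assms(3)]
  let ?g = "inv_arrow C f"
  have "f \<cdot> ?g \<star>\<^bsub>M\<^esub> ?g = mlt N"
    using assms is_mon_hom_conv[OF assms(1-3), of ?g ?g] by (simp add: conv_def)
  then have "?g \<cdot> mlt N = ?g \<cdot> (f \<cdot> ?g \<star>\<^bsub>M\<^esub> ?g)" by simp
  then have "?g \<cdot> mlt N = ?g \<star>\<^bsub>M\<^esub> ?g"
    using assms by simp
  moreover have "?g \<cdot> unt N = ?g \<cdot> (f \<cdot> unt M)" by (simp only: is_mon_hom_simps(5)[OF assms(3)])
  then have "?g \<cdot> unt N = unt M"
    using assms by simp
  ultimately show ?thesis using assms by (simp add: is_mon_hom_iff)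
qed

lemma trivial_mon_simps [simp]:
  "obj (trivial_mon C) = \<I>" "mlt (trivial_mon C) = \<ell> \<I>" "unt (trivial_mon C) = \<one> \<I>"
  by (simp_all add: trivial_mon_def)

lemma is_mon_trivial_mon [simp]: "is_mon C (trivial_mon C)"
  using triangle[of \<I> \<I>] by (simp add: is_mon_def LUnit_eq_RUnit)

lemma is_mon_hom_unt:
  assumes "is_mon C M" shows "is_mon_hom C (trivial_mon C) M (unt M)"
  using assms by (simp add: is_mon_hom_iff LUnit_eq_RUnit)

end

section \<open>Relative pullbacks of monoids\<close>

locale monoidal_span_class = monoidal_category C
  for C :: "('o, 'a, 'z) mcat_scheme" (structure) +
  fixes S :: "('a \<times> 'a) set"
  assumes admissible: "admissible C S" and monoidal_class: "monoidal_class C S"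
begin

lemma span_simps:
  assumes "(f, g) \<in> S" shows "f \<in> Ar C" "g \<in> Ar C" "Dom C f = Dom C g"
  using assms admissible by (auto simp: admissible_def spans_def)

lemma POST:
  assumes "(f, g) \<in> S" "f' \<in> Ar C" "g' \<in> Ar C" "Dom C f' = Cod C f" "Dom C g' = Cod C g"
  shows "(f' \<cdot> f, g' \<cdot> g) \<in> S"
  using assms admissible unfolding admissible_def by blast

lemma PRE:
  assumes "(f, g) \<in> S" "h \<in> Ar C" "Cod C h = Dom C f"
  shows "(f \<cdot> h, g \<cdot> h) \<in> S"
  using assms admissible unfolding admissible_def by blast

lemma span_TensA: "(f, g) \<in> S \<Longrightarrow> (f', g') \<in> S \<Longrightarrow> (f \<otimes> f', g \<otimes> g') \<in> S"
  using monoidal_class unfolding monoidal_class_def by blast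

lemma span_unit: "(\<one> \<I>, \<one> \<I>) \<in> S"
  using monoidal_class unfolding monoidal_class_def by blast

lemma rel_pullback_simps:
  assumes "is_rel_pullback C S f g p q"
  shows "(p, q) \<in> S" "p \<in> Ar C" "q \<in> Ar C" "Dom C q = Dom C p" "Cod C p = Dom C f" "Cod C q = Dom C g"
    "f \<cdot> p = g \<cdot> q"
  using assms span_simps[of p q] unfolding is_rel_pullback_def by auto

lemma rel_pullback_lift:
  assumes "is_rel_pullback C S f g p q" "(a, c) \<in> S" "Cod C a = Dom C f" "Cod C c = Dom C g"
    "f \<cdot> a = g \<cdot> c"
  shows "\<exists>h. h \<in> hom C (Dom C a) (Dom C p) \<and> p \<cdot> h = a \<and> q \<cdot> h = c"
  using assms unfolding is_rel_pullback_def by blast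

lemma rel_pullback_reflect:
  assumes "is_rel_pullback C S f g p q" "d \<in> Ar C" "k \<in> Ar C" "Dom C k = Dom C d" "Cod C d = Dom C p"
    "(p \<cdot> d, k) \<in> S" "(q \<cdot> d, k) \<in> S"
  shows "(d, k) \<in> S"
  using assms unfolding is_rel_pullback_def by blast

text \<open>
  The universal property speaks of spans in the class only. It applies here because
  \<open>(p \<cdot> h, q \<cdot> h)\<close> is obtained from \<open>(p, q)\<close> by precomposition.
\<close>
lemma rel_pullback_jointly_monic:
  assumes pb: "is_rel_pullback C S f g p q" and fg: "f \<in> Ar C" "g \<in> Ar C" "Cod C f = Cod C g"
    and h: "h \<in> hom C D (Dom C p)" "k \<in> hom C D (Dom C p)" and eq: "p \<cdot> h = p \<cdot> k" "q \<cdot> h = q \<cdot> k"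
  shows "h = k"
proof -
  note [simp] = rel_pullback_simps(2-6)[OF pb]
  have "(p \<cdot> h, q \<cdot> h) \<in> S" using h by (intro PRE[OF rel_pullback_simps(1)[OF pb]]) auto
  moreover have "(f \<cdot> p) \<cdot> h = (g \<cdot> q) \<cdot> h" by (simp only: rel_pullback_simps(7)[OF pb])
  then have "f \<cdot> (p \<cdot> h) = g \<cdot> (q \<cdot> h)" using h fg by simp
  ultimately have "\<exists>!l. l \<in> hom C D (Dom C p) \<and> p \<cdot> l = p \<cdot> h \<and> q \<cdot> l = q \<cdot> h"
    using pb h unfolding is_rel_pullback_def by (elim conjE allE[of _ "p \<cdot> h"] allE[of _ "q \<cdot> h"]) simp
  then show ?thesis using h eq by metis
qed

text \<open>
  The multiplication lifts \<open>(p \<star> p, q \<star> q)\<close>, which is in the class by multiplicativity and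
  closure under postcomposition; the unit lifts the pair of units, which is in the class because
  \<open>(\<one> \<I>, \<one> \<I>)\<close> is. The monoid laws hold because they hold after composition with \<open>p\<close> and with \<open>q\<close>.
\<close>
lemma rel_pullback_mon:
  assumes pb: "is_rel_pullback C S f g p q"
    and mon: "is_mon C A" "is_mon C B" "is_mon C D"
    and f: "is_mon_hom C A B f" and g: "is_mon_hom C D B g"
  shows "\<exists>P. is_mon C P \<and> obj P = Dom C p \<and> is_mon_hom C P A p \<and> is_mon_hom C P D q"
proof -
  note [simp] = rel_pullback_simps(2-6)[OF pb] mon
  note f' [simp] = is_mon_hom_simps[OF f] and g' [simp] = is_mon_hom_simps[OF g]
  let ?P = "Dom C p"
  have S: "(p, q) \<in> S" and sq: "f \<cdot> p = g \<cdot> q" using rel_pullback_simps[OF pb] by auto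
  have unique: "h = k" if "h \<in> hom C D' ?P" "k \<in> hom C D' ?P" "p \<cdot> h = p \<cdot> k" "q \<cdot> h = q \<cdot> k" for h k D'
    using rel_pullback_jointly_monic[OF pb _ _ _ that] by simp
  have "(p \<star>\<^bsub>A\<^esub> p, q \<star>\<^bsub>D\<^esub> q) \<in> S"
    unfolding conv_def by (intro POST span_TensA S) auto
  moreover have "f \<cdot> p \<star>\<^bsub>A\<^esub> p = g \<cdot> q \<star>\<^bsub>D\<^esub> q"
    using is_mon_hom_conv[OF mon(1,2) f, of p p] is_mon_hom_conv[OF mon(3,2) g, of q q] sq by simp
  ultimately obtain m where m: "m \<in> hom C (?P \<odot> ?P) ?P" "p \<cdot> m = p \<star>\<^bsub>A\<^esub> p" "q \<cdot> m = q \<star>\<^bsub>D\<^esub> q"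
    using rel_pullback_lift[OF pb, of "p \<star>\<^bsub>A\<^esub> p" "q \<star>\<^bsub>D\<^esub> q"] by auto
  have "(unt A \<cdot> \<one> \<I>, unt D \<cdot> \<one> \<I>) \<in> S"
    by (intro POST span_unit) auto
  then have "(unt A, unt D) \<in> S" by simp
  then obtain u where u: "u \<in> hom C \<I> ?P" "p \<cdot> u = unt A" "q \<cdot> u = unt D"
    using rel_pullback_lift[OF pb, of "unt A" "unt D"] by auto
  have [simp]: "m \<in> Ar C" "Dom C m = ?P \<odot> ?P" "Cod C m = ?P" "u \<in> Ar C" "Dom C u = \<I>" "Cod C u = ?P"
    using m u by auto
  have [simp]: "p \<cdot> (m \<cdot> t) = p \<star>\<^bsub>A\<^esub> p \<cdot> t" "q \<cdot> (m \<cdot> t) = q \<star>\<^bsub>D\<^esub> q \<cdot> t"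
    if "t \<in> Ar C" "Cod C t = ?P \<odot> ?P" for t
    using that m by (simp_all flip: Comp_assoc')
  have "is_mon C \<lparr>obj = ?P, mlt = m, unt = u\<rparr>"
    unfolding is_mon_def
  proof (simp, intro conjI)
    show "m \<cdot> (m \<otimes> \<one> ?P) = m \<cdot> ((\<one> ?P \<otimes> m) \<cdot> \<alpha> ?P ?P ?P)"
      by (rule unique[of _ "(?P \<odot> ?P) \<odot> ?P"]) (simp_all add: m)
    show "m \<cdot> (u \<otimes> \<one> ?P) = \<ell> ?P"
      by (rule unique[of _ "\<I> \<odot> ?P"]) (simp_all add: u)
    show "m \<cdot> (\<one> ?P \<otimes> u) = \<rho> ?P"
      by (rule unique[of _ "?P \<odot> \<I>"]) (simp_all add: u)
  qed
  then show ?thesis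
    using m u by (intro exI[of _ "\<lparr>obj = ?P, mlt = m, unt = u\<rparr>"]) (simp add: is_mon_hom_iff)
qed

lemma rel_pullback_mon_hom:
  assumes pb: "is_rel_pullback C S f g p q"
    and fg: "f \<in> Ar C" "g \<in> Ar C" "Cod C f = Cod C g"
    and mon: "is_mon C M" "is_mon C P" "is_mon C A" "is_mon C D" and P: "obj P = Dom C p"
    and p: "is_mon_hom C P A p" and q: "is_mon_hom C P D q"
    and h: "h \<in> hom C (obj M) (obj P)"
    and ph: "is_mon_hom C M A (p \<cdot> h)" and qh: "is_mon_hom C M D (q \<cdot> h)"
  shows "is_mon_hom C M P h"
proof -
  note [simp] = mon is_mon_hom_simps(1,2,3,5)[OF p] is_mon_hom_simps(1,2,3,5)[OF q]
  have h' [simp]: "h \<in> Ar C" "Dom C h = obj M" "Cod C h = obj P" using h by auto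
  note unique = rel_pullback_jointly_monic[OF pb fg, folded P]
  have [simp]: "p \<cdot> (h \<cdot> mlt M) = p \<cdot> h \<star>\<^bsub>P\<^esub> h" "q \<cdot> (h \<cdot> mlt M) = q \<cdot> h \<star>\<^bsub>P\<^esub> h"
    using is_mon_hom_simps(4)[OF ph] is_mon_hom_simps(4)[OF qh]
    by (simp_all add: is_mon_hom_conv[OF mon(2,3) p] is_mon_hom_conv[OF mon(2,4) q])
  have [simp]: "p \<cdot> (h \<cdot> unt M) = unt A" "q \<cdot> (h \<cdot> unt M) = unt D"
    using is_mon_hom_simps(5)[OF ph] is_mon_hom_simps(5)[OF qh] by simp_all
  have "h \<cdot> mlt M = h \<star>\<^bsub>P\<^esub> h"
    by (rule unique[of _ "obj M \<odot> obj M"]) simp_all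
  moreover have "h \<cdot> unt M = unt P"
    by (rule unique[of _ \<I>]) simp_all
  ultimately show ?thesis by (simp add: is_mon_hom_iff)
qed

end

section \<open>The distributive law of a factorised monoid\<close>

context monoidal_category begin

lemma is_distributive_law_simps:
  assumes "is_distributive_law C B Y x"
  shows "x \<in> Ar C" "Dom C x = obj B \<odot> obj Y" "Cod C x = obj Y \<odot> obj B"
  using assms unfolding is_distributive_law_def Let_def in_hom by blast+

text \<open>
  If \<open>A\<close> is factorised by the monoids \<open>Y\<close> and \<open>B\<close>, that is \<open>j \<star> i : Y \<odot> B \<rightarrow> A\<close> is invertible, then
  rewriting a product \<open>i \<star> j\<close> in the form \<open>j \<star> i\<close> is a distributive law. Both sides of an axiom are
  composed with \<open>j \<star> i\<close>. The two multiplication axioms then read \<open>(i \<star> i) \<star> j\<close> and \<open>i \<star> (j \<star> j)\<close>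
  on either side, and the unit axioms read \<open>u \<star> j = j\<close> and \<open>i \<star> u = i\<close>.
\<close>
lemma is_distributive_law_factorization:
  assumes mon: "is_mon C A" "is_mon C B" "is_mon C Y"
    and i: "is_mon_hom C B A i" and j: "is_mon_hom C Y A j"
    and inv: "invertible C (j \<star>\<^bsub>A\<^esub> i)"
    and x: "x \<in> hom C (obj B \<odot> obj Y) (obj Y \<odot> obj B)" and qx: "j \<star>\<^bsub>A\<^esub> i \<cdot> x = i \<star>\<^bsub>A\<^esub> j"
  shows "is_distributive_law C B Y x"
proof -
  note [simp] = mon is_mon_hom_simps[OF i] is_mon_hom_simps[OF j]
  let ?B = "obj B" and ?Y = "obj Y"
  have [simp]: "x \<in> Ar C" "Dom C x = ?B \<odot> ?Y" "Cod C x = ?Y \<odot> ?B" "j \<star>\<^bsub>A\<^esub> i \<cdot> x = i \<star>\<^bsub>A\<^esub> j"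
    using x qx by auto
  have [simp]: "j \<star>\<^bsub>A\<^esub> i \<cdot> (x \<cdot> t) = i \<star>\<^bsub>A\<^esub> j \<cdot> t" if "t \<in> Ar C" "Cod C t = ?B \<odot> ?Y" for t
    using that by (intro Comp_reassoc[OF qx]) auto
  note cancel = cancel_left[OF inv]
  show ?thesis
    unfolding is_distributive_law_def Let_def
    by (intro conjI; (rule cancel)?) (simp_all (no_asm))
qed

end

section \<open>Associative squares of pairings\<close>

context monoidal_category begin

text \<open>
  The law \<open>(xy)z = x(yz)\<close> for four possibly different pairings: \<open>xy : X \<odot> Y \<rightarrow> P\<close>,
  \<open>pz : P \<odot> Z \<rightarrow> T\<close>, \<open>yz : Y \<odot> Z \<rightarrow> Q\<close> and \<open>xq : X \<odot> Q \<rightarrow> T\<close>. Associativity of monoids, action laws,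
  linearity of a map between modules and the multiplication axioms of a distributive law are all of
  this form. The objects \<open>P\<close>, \<open>Q\<close> and \<open>T\<close> are read off from the arrows.
\<close>
definition associative ::
    "'o \<Rightarrow> 'o \<Rightarrow> 'o \<Rightarrow> 'a \<Rightarrow> 'a \<Rightarrow> 'a \<Rightarrow> 'a \<Rightarrow> bool" where
  "associative X Y Z xy pz yz xq \<longleftrightarrow>
     X \<in> Ob C \<and> Y \<in> Ob C \<and> Z \<in> Ob C \<and>
     xy \<in> Ar C \<and> Dom C xy = X \<odot> Y \<and> pz \<in> Ar C \<and> Dom C pz = Cod C xy \<odot> Z \<and>
     yz \<in> Ar C \<and> Dom C yz = Y \<odot> Z \<and> xq \<in> Ar C \<and> Dom C xq = X \<odot> Cod C yz \<and>
     Cod C xq = Cod C pz \<and>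
     pz \<cdot> (xy \<otimes> \<one> Z) = xq \<cdot> ((\<one> X \<otimes> yz) \<cdot> \<alpha> X Y Z)"

lemma associative_simps:
  assumes "associative X Y Z xy pz yz xq"
  shows "X \<in> Ob C" "Y \<in> Ob C" "Z \<in> Ob C"
    "xy \<in> Ar C" "Dom C xy = X \<odot> Y" "pz \<in> Ar C" "Dom C pz = Cod C xy \<odot> Z"
    "yz \<in> Ar C" "Dom C yz = Y \<odot> Z" "xq \<in> Ar C" "Dom C xq = X \<odot> Cod C yz"
    "Cod C xq = Cod C pz"
  using assms unfolding associative_def by blast+

lemma associative_eq:
  assumes "associative X Y Z xy pz yz xq"
  shows "pz \<cdot> (xy \<otimes> \<one> Z) = xq \<cdot> ((\<one> X \<otimes> yz) \<cdot> \<alpha> X Y Z)"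
  using assms unfolding associative_def by blast

text \<open>
  For pairings of four factors \<open>X, Y, Z, W\<close>, write \<open>P, Q, R\<close> for the products of neighbours, \<open>T\<close> and
  \<open>V\<close> for the products of \<open>X, Y, Z\<close> and of \<open>Y, Z, W\<close>, and \<open>E\<close> for the product of all. There are
  five squares, for the triples \<open>(X, Y, Z)\<close>, \<open>(Y, Z, W)\<close>, \<open>(X, Q, W)\<close>, \<open>(P, Z, W)\<close> and \<open>(X, Y, R)\<close>;
  they are the edges of the pentagon. The first three of them form the long path from \<open>((xy)z)w\<close> to
  \<open>x(y(zw))\<close>, and the pentagon axiom turns this path into the short one.
\<close>
lemma associative_pentagon_path:
  assumes 1: "associative X Y Z xy pz yz xq" and 2: "associative Y Z W yz qw zw yr"
    and 3: "tw \<cdot> (xq \<otimes> \<one> W) = xv \<cdot> ((\<one> X \<otimes> qw) \<cdot> \<alpha> X (Cod C yz) W)"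
    and tw: "tw \<in> Ar C" "Dom C tw = Cod C pz \<odot> W" and xv: "xv \<in> Ar C" "Dom C xv = X \<odot> Cod C qw"
  shows "tw \<cdot> ((pz \<cdot> (xy \<otimes> \<one> Z)) \<otimes> \<one> W)
    = (xv \<cdot> ((\<one> X \<otimes> yr) \<cdot> \<alpha> X Y (Cod C zw))) \<cdot> ((\<one> (X \<odot> Y) \<otimes> zw) \<cdot> \<alpha> (X \<odot> Y) Z W)"
proof -
  note [simp] = associative_simps[OF 1] associative_simps[OF 2]
  have W: "W \<in> Ob C" and X: "X \<in> Ob C" "Y \<in> Ob C" "Z \<in> Ob C" by simp_all
  note [simp] = tw xv
  note eq1 = associative_eq[OF 1] and eq2 = associative_eq[OF 2]
  have "tw \<cdot> ((pz \<cdot> (xy \<otimes> \<one> Z)) \<otimes> \<one> W) = tw \<cdot> ((xq \<cdot> ((\<one> X \<otimes> yz) \<cdot> \<alpha> X Y Z)) \<otimes> \<one> W)"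
    by (simp only: eq1)
  also have "\<dots> = (tw \<cdot> (xq \<otimes> \<one> W)) \<cdot> (((\<one> X \<otimes> yz) \<otimes> \<one> W) \<cdot> (\<alpha> X Y Z \<otimes> \<one> W))"
    by simp
  also have "\<dots> = xv \<cdot> ((\<one> X \<otimes> qw) \<cdot> ((\<alpha> X (Cod C yz) W \<cdot> ((\<one> X \<otimes> yz) \<otimes> \<one> W)) \<cdot> (\<alpha> X Y Z \<otimes> \<one> W)))"
    unfolding 3 by simp
  also have "\<alpha> X (Cod C yz) W \<cdot> ((\<one> X \<otimes> yz) \<otimes> \<one> W) = (\<one> X \<otimes> (yz \<otimes> \<one> W)) \<cdot> \<alpha> X (Y \<odot> Z) W"
    by (intro Assoc_nat) auto
  also have "xv \<cdot> ((\<one> X \<otimes> qw) \<cdot> (\<dots> \<cdot> (\<alpha> X Y Z \<otimes> \<one> W)))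
      = xv \<cdot> ((\<one> X \<otimes> (qw \<cdot> (yz \<otimes> \<one> W))) \<cdot> (\<alpha> X (Y \<odot> Z) W \<cdot> (\<alpha> X Y Z \<otimes> \<one> W)))"
    by simp
  also have "\<dots> = xv \<cdot> ((\<one> X \<otimes> yr) \<cdot> ((\<one> X \<otimes> (\<one> Y \<otimes> zw)) \<cdot>
      ((\<one> X \<otimes> \<alpha> Y Z W) \<cdot> \<alpha> X (Y \<odot> Z) W \<cdot> (\<alpha> X Y Z \<otimes> \<one> W))))"
    by (simp add: eq2)
  also have "\<dots> = xv \<cdot> ((\<one> X \<otimes> yr) \<cdot> ((\<one> X \<otimes> (\<one> Y \<otimes> zw)) \<cdot> (\<alpha> X Y (Z \<odot> W) \<cdot> \<alpha> (X \<odot> Y) Z W)))"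
    by (simp only: pentagon[OF X W])
  also have "\<dots> = xv \<cdot> ((\<one> X \<otimes> yr) \<cdot> (((\<one> X \<otimes> (\<one> Y \<otimes> zw)) \<cdot> \<alpha> X Y (Z \<odot> W)) \<cdot> \<alpha> (X \<odot> Y) Z W))"
    by simp
  also have "(\<one> X \<otimes> (\<one> Y \<otimes> zw)) \<cdot> \<alpha> X Y (Z \<odot> W) = \<alpha> X Y (Cod C zw) \<cdot> ((\<one> X \<otimes> \<one> Y) \<otimes> zw)"
    by (intro Assoc_nat[symmetric]) auto
  finally show ?thesis by simp
qed

text \<open>tetrahedra\<close>

text \<open>
  Four of the five squares imply the fifth one precomposed with one pairing, here \<open>X \<odot> Y \<rightarrow> P\<close>.
  When that pairing is an identity, the fifth square itself follows. The next two lemmas are the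
  analogous statements for the products of \<open>Y, Z\<close> and of \<open>Z, W\<close>.
\<close>
lemma associative_right_face:
  assumes 1: "associative X Y Z (\<one> (X \<odot> Y)) pz yz xq" and 2: "associative Y Z W yz qw zw yr"
    and 3: "associative X Q W xq tw qw xv"
    and 4: "associative X Y R (\<one> (X \<odot> Y)) pr yr xv"
    and Q [simp]: "Cod C yz = Q" and R [simp]: "Cod C zw = R"
  shows "associative (X \<odot> Y) Z W pz tw zw pr"
proof -
  note [simp] = associative_simps[OF 1] associative_simps[OF 2] associative_simps[OF 3]
    associative_simps[OF 4]
  have [simp]: "Cod C pr = Cod C tw"
    using associative_simps(12)[OF 3] associative_simps(12)[OF 4] by metis
  have 5: "xv \<cdot> ((\<one> X \<otimes> yr) \<cdot> \<alpha> X Y R) = pr"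
    using associative_eq[OF 4] by simp
  have "tw \<cdot> ((pz \<cdot> (\<one> (X \<odot> Y) \<otimes> \<one> Z)) \<otimes> \<one> W)
      = (xv \<cdot> ((\<one> X \<otimes> yr) \<cdot> \<alpha> X Y R)) \<cdot> ((\<one> (X \<odot> Y) \<otimes> zw) \<cdot> \<alpha> (X \<odot> Y) Z W)"
    using associative_pentagon_path[OF 1 2, of tw xv] associative_eq[OF 3] by simp
  then show ?thesis unfolding 5 by (simp add: associative_def)
qed

lemma associative_middle_face:
  assumes 1: "associative X Y Z xy pz (\<one> (Y \<odot> Z)) xq"
    and 2: "associative Y Z W (\<one> (Y \<odot> Z)) qw zw yr"
    and 3: "associative P Z W pz tw zw pr"
    and 4: "associative X Y R xy pr yr xv"
    and P [simp]: "Cod C xy = P" and R [simp]: "Cod C zw = R"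
  shows "associative X (Y \<odot> Z) W xq tw qw xv"
proof -
  note [simp] = associative_simps[OF 1] associative_simps[OF 2] associative_simps[OF 3]
    associative_simps[OF 4]
  have W: "W \<in> Ob C" and X: "X \<in> Ob C" "Y \<in> Ob C" "Z \<in> Ob C" by simp_all
  have eq1: "pz \<cdot> (xy \<otimes> \<one> Z) = xq \<cdot> \<alpha> X Y Z" and eq2: "yr \<cdot> ((\<one> Y \<otimes> zw) \<cdot> \<alpha> Y Z W) = qw"
    using associative_eq[OF 1] associative_eq[OF 2] by simp_all
  note eq3 = associative_eq[OF 3] and eq4 = associative_eq[OF 4]
  have "(tw \<cdot> (xq \<otimes> \<one> W)) \<cdot> (\<alpha> X Y Z \<otimes> \<one> W) = (tw \<cdot> (pz \<otimes> \<one> W)) \<cdot> ((xy \<otimes> \<one> Z) \<otimes> \<one> W)"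
    by (simp add: eq1)
  also have "\<dots> = pr \<cdot> ((\<one> P \<otimes> zw) \<cdot> (\<alpha> P Z W \<cdot> ((xy \<otimes> \<one> Z) \<otimes> \<one> W)))"
    unfolding eq3 by simp
  also have "\<alpha> P Z W \<cdot> ((xy \<otimes> \<one> Z) \<otimes> \<one> W) = (xy \<otimes> (\<one> Z \<otimes> \<one> W)) \<cdot> \<alpha> (X \<odot> Y) Z W"
    by (intro Assoc_nat) auto
  also have "pr \<cdot> ((\<one> P \<otimes> zw) \<cdot> \<dots>)
      = (pr \<cdot> (xy \<otimes> \<one> R)) \<cdot> (((\<one> X \<otimes> \<one> Y) \<otimes> zw) \<cdot> \<alpha> (X \<odot> Y) Z W)"
    by simp
  also have "\<dots> = xv \<cdot> ((\<one> X \<otimes> yr) \<cdot> ((\<alpha> X Y R \<cdot> ((\<one> X \<otimes> \<one> Y) \<otimes> zw)) \<cdot> \<alpha> (X \<odot> Y) Z W))"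
    unfolding eq4 by simp
  also have "\<alpha> X Y R \<cdot> ((\<one> X \<otimes> \<one> Y) \<otimes> zw) = (\<one> X \<otimes> (\<one> Y \<otimes> zw)) \<cdot> \<alpha> X Y (Z \<odot> W)"
    by (intro Assoc_nat) auto
  also have "xv \<cdot> ((\<one> X \<otimes> yr) \<cdot> (\<dots> \<cdot> \<alpha> (X \<odot> Y) Z W))
     = xv \<cdot> ((\<one> X \<otimes> yr) \<cdot> ((\<one> X \<otimes> (\<one> Y \<otimes> zw)) \<cdot> (\<alpha> X Y (Z \<odot> W) \<cdot> \<alpha> (X \<odot> Y) Z W)))"
    by simp
  also have "\<dots> = xv \<cdot> ((\<one> X \<otimes> yr) \<cdot> ((\<one> X \<otimes> (\<one> Y \<otimes> zw)) \<cdot>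
      ((\<one> X \<otimes> \<alpha> Y Z W) \<cdot> \<alpha> X (Y \<odot> Z) W \<cdot> (\<alpha> X Y Z \<otimes> \<one> W))))"
    by (simp only: pentagon[OF X W])
  also have "\<dots> = (xv \<cdot> ((\<one> X \<otimes> (yr \<cdot> ((\<one> Y \<otimes> zw) \<cdot> \<alpha> Y Z W))) \<cdot> \<alpha> X (Y \<odot> Z) W)) \<cdot> (\<alpha> X Y Z \<otimes> \<one> W)"
    by simp
  finally have "tw \<cdot> (xq \<otimes> \<one> W) = xv \<cdot> ((\<one> X \<otimes> (yr \<cdot> ((\<one> Y \<otimes> zw) \<cdot> \<alpha> Y Z W))) \<cdot> \<alpha> X (Y \<odot> Z) W)"
    by (rule cancel_right[rotated]) auto
  then show ?thesis unfolding eq2 by (simp add: associative_def)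
qed

lemma associative_left_face:
  assumes 1: "associative X Y Z xy pz yz xq"
    and 2: "associative Y Z W yz qw (\<one> (Z \<odot> W)) yr"
    and 3: "associative X Q W xq tw qw xv"
    and 4: "associative P Z W pz tw (\<one> (Z \<odot> W)) pr"
    and P [simp]: "Cod C xy = P" and Q [simp]: "Cod C yz = Q"
  shows "associative X Y (Z \<odot> W) xy pr yr xv"
proof -
  note [simp] = associative_simps[OF 1] associative_simps[OF 2] associative_simps[OF 3]
    associative_simps[OF 4]
  have eq4: "pr \<cdot> \<alpha> P Z W = tw \<cdot> (pz \<otimes> \<one> W)"
    using associative_eq[OF 4] by simp
  have "(pr \<cdot> (xy \<otimes> \<one> (Z \<odot> W))) \<cdot> \<alpha> (X \<odot> Y) Z W = pr \<cdot> ((xy \<otimes> (\<one> Z \<otimes> \<one> W)) \<cdot> \<alpha> (X \<odot> Y) Z W)"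
    by simp
  also have "(xy \<otimes> (\<one> Z \<otimes> \<one> W)) \<cdot> \<alpha> (X \<odot> Y) Z W = \<alpha> P Z W \<cdot> ((xy \<otimes> \<one> Z) \<otimes> \<one> W)"
    by (intro Assoc_nat[symmetric]) auto
  also have "pr \<cdot> \<dots> = (pr \<cdot> \<alpha> P Z W) \<cdot> ((xy \<otimes> \<one> Z) \<otimes> \<one> W)"
    by simp
  also have "\<dots> = tw \<cdot> ((pz \<cdot> (xy \<otimes> \<one> Z)) \<otimes> \<one> W)"
    unfolding eq4 by simp
  also have "\<dots> = (xv \<cdot> ((\<one> X \<otimes> yr) \<cdot> \<alpha> X Y (Cod C (\<one> (Z \<odot> W))))) \<cdot> ((\<one> (X \<odot> Y) \<otimes> \<one> (Z \<odot> W)) \<cdot> \<alpha> (X \<odot> Y) Z W)"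
    by (rule associative_pentagon_path[OF 1 2]) (simp_all add: associative_eq[OF 3])
  finally have "(pr \<cdot> (xy \<otimes> \<one> (Z \<odot> W))) \<cdot> \<alpha> (X \<odot> Y) Z W
      = (xv \<cdot> ((\<one> X \<otimes> yr) \<cdot> \<alpha> X Y (Z \<odot> W))) \<cdot> \<alpha> (X \<odot> Y) Z W"
    by simp
  then have "pr \<cdot> (xy \<otimes> \<one> (Z \<odot> W)) = xv \<cdot> ((\<one> X \<otimes> yr) \<cdot> \<alpha> X Y (Z \<odot> W))"
    by (rule cancel_right[rotated]) auto
  then show ?thesis by (simp add: associative_def)
qed

end

section \<open>The monoid of a distributive law\<close>

locale distributive_law = monoidal_category C
  for C :: "('o, 'a, 'z) mcat_scheme" (structure) +
  fixes B Y :: "('o, 'a) mon" and x :: 'a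
  assumes mon_B [simp]: "is_mon C B" and mon_Y [simp]: "is_mon C Y"
    and dist: "is_distributive_law C B Y x"
begin

abbreviation OB where "OB \<equiv> obj B"
abbreviation OY where "OY \<equiv> obj Y"
abbreviation A where "A \<equiv> OY \<odot> OB"

lemma x_simps [simp]: "x \<in> Ar C" "Dom C x = OB \<odot> OY" "Cod C x = A"
  using dist unfolding is_distributive_law_def by (auto simp: Let_def)

text \<open>
  On \<open>A = Y \<odot> B\<close>, the free right action \<open>rB\<close> of \<open>B\<close> and the free left action \<open>lY\<close> of \<open>Y\<close> come from
  the multiplications. The left action \<open>lB\<close> of \<open>B\<close> and the right action \<open>rY\<close> of \<open>Y\<close> first move
  the acting factor past the other one by means of \<open>x\<close>. The product \<open>mA\<close> lets the \<open>B\<close>-part and then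
  the \<open>Y\<close>-part of its first argument act on the second.
\<close>
definition rB :: 'a where "rB = (\<one> OY \<otimes> mlt B) \<cdot> \<alpha> OY OB OB"
definition lY :: 'a where "lY = (mlt Y \<otimes> \<one> OB) \<cdot> inv_arrow C (\<alpha> OY OY OB)"
definition lB :: 'a where "lB = rB \<cdot> ((x \<otimes> \<one> OB) \<cdot> inv_arrow C (\<alpha> OB OY OB))"
definition rY :: 'a where "rY = lY \<cdot> ((\<one> OY \<otimes> x) \<cdot> \<alpha> OY OB OY)"
definition mA :: 'a where "mA = lY \<cdot> ((\<one> OY \<otimes> lB) \<cdot> \<alpha> OY OB A)"

lemma pairing_simps [simp]:
  "rB \<in> Ar C" "Dom C rB = A \<odot> OB" "Cod C rB = A"
  "lY \<in> Ar C" "Dom C lY = OY \<odot> A" "Cod C lY = A"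
  "lB \<in> Ar C" "Dom C lB = OB \<odot> A" "Cod C lB = A"
  "rY \<in> Ar C" "Dom C rY = A \<odot> OY" "Cod C rY = A"
  "mA \<in> Ar C" "Dom C mA = A \<odot> A" "Cod C mA = A"
  by (simp_all add: rB_def lY_def lB_def rY_def mA_def)

lemma lY_Assoc: "lY \<cdot> \<alpha> OY OY OB = mlt Y \<otimes> \<one> OB"
  by (simp add: lY_def)

lemma lB_Assoc: "lB \<cdot> \<alpha> OB OY OB = rB \<cdot> (x \<otimes> \<one> OB)"
  by (simp add: lB_def)

text \<open>
  The monoid axioms, the definitions of the pairings and the multiplication axioms of \<open>x\<close> are
  the squares from which associativity is built.
\<close>
lemma associative_mlt:
  "associative OB OB OB (mlt B) (mlt B) (mlt B) (mlt B)"
  "associative OY OY OY (mlt Y) (mlt Y) (mlt Y) (mlt Y)"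
  by (simp_all add: associative_def is_mon_laws)

lemma associative_rB: "associative OY OB OB (\<one> A) rB (mlt B) (\<one> A)"
  by (simp add: associative_def rB_def)

lemma associative_lY: "associative OY OY OB (mlt Y) (\<one> A) (\<one> A) lY"
  by (simp add: associative_def lY_Assoc)

lemma associative_lB: "associative OB OY OB x rB (\<one> A) lB"
  by (simp add: associative_def lB_Assoc)

lemma associative_rY: "associative OY OB OY (\<one> A) rY x lY"
  by (simp add: associative_def rY_def)

lemma associative_mA: "associative OY OB A (\<one> A) mA lB lY"
  by (simp add: associative_def mA_def)

lemma associative_law_B: "associative OB OB OY (mlt B) x x lB"
  using dist unfolding is_distributive_law_def
  by (simp add: Let_def associative_def lB_def rB_def)

lemma associative_law_Y: "associative OB OY OY x rY (mlt Y) x"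
proof -
  have "(x \<cdot> (\<one> OB \<otimes> mlt Y)) \<cdot> \<alpha> OB OY OY = rY \<cdot> (x \<otimes> \<one> OY)"
    using dist unfolding is_distributive_law_def
    by (simp add: Let_def lY_def rY_def)
  then show ?thesis by (simp add: associative_def)
qed

text \<open>
  Each step solves a pentagon for one square, the other four being given or found before. The names
  made of three letters list the factors of the square. It suffices that \<open>lB\<close> and \<open>lY\<close> commute with right
  multiplication by \<open>A\<close> (squares \<open>BAA\<close> and \<open>YAA\<close>), since left multiplication by an element
  of \<open>A\<close> is composed of these actions.
\<close>
lemma associative_mA_mA: "associative A A A mA mA mA mA"
proof -
  \<comment> \<open>\<open>rB\<close> is an action, and \<open>lB\<close> and \<open>lY\<close> are linear for it.\<close>
  have right_B: "associative A OB OB rB rB (mlt B) rB"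
    by (rule associative_right_face[OF associative_rB associative_mlt(1) associative_rB associative_rB]) simp_all
  have BAB: "associative OB A OB lB rB rB lB"
    by (rule associative_middle_face[OF associative_lB associative_rB right_B associative_lB]) simp_all
  have YAB: "associative OY A OB lY rB rB lY"
    by (rule associative_middle_face[OF associative_lY associative_rB associative_rB associative_lY]) simp_all
  \<comment> \<open>\<open>lY\<close> and \<open>lB\<close> are actions; the multiplication axiom of \<open>x\<close> for \<open>B\<close> enters here.\<close>
  have left_Y: "associative OY OY A (mlt Y) lY lY lY"
    by (rule associative_left_face[OF associative_mlt(2) associative_lY associative_lY associative_lY]) simp_all
  have left_B: "associative OB OB A (mlt B) lB lB lB"
    by (rule associative_left_face[OF associative_law_B associative_lB BAB associative_lB]) simp_all
  \<comment> \<open>\<open>mA\<close> is balanced: \<open>B\<close> may act on its first argument from the right or on its second from the left.\<close>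
  have ABA: "associative A OB A rB mA lB mA"
    by (rule associative_right_face[OF associative_rB left_B associative_mA associative_mA]) simp_all
  \<comment> \<open>\<open>mA\<close> lets the \<open>Y\<close>-part and then the \<open>B\<close>-part of its second argument act on the first from the right.\<close>
  have AYB: "associative A OY OB rY rB (\<one> A) mA"
    by (rule associative_right_face[OF associative_rY associative_lB YAB associative_mA]) simp_all
  \<comment> \<open>The two left actions are compatible along \<open>x\<close>; this is the multiplication axiom of \<open>x\<close> for \<open>Y\<close>.\<close>
  have BYA: "associative OB OY A x mA lY lB"
    by (rule associative_left_face[OF associative_law_Y associative_lY associative_lB AYB]) simp_all
  \<comment> \<open>Both left actions commute with right multiplication.\<close>
  have YAA: "associative OY A A lY mA mA lY"
    by (rule associative_middle_face[OF associative_lY associative_mA associative_mA left_Y]) simp_all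
  have BAA: "associative OB A A lB mA mA lB"
    by (rule associative_middle_face[OF associative_lB associative_mA ABA BYA]) simp_all
  show ?thesis
    by (rule associative_right_face[OF associative_mA BAA YAA associative_mA]) simp_all
qed

text \<open>
  The inclusions of \<open>B\<close> and \<open>Y\<close> into \<open>A\<close>. The lemmas below evaluate the actions on them;
  combined, they say that multiplying by an included element on the left is the respective left
  action, and by an element of \<open>B\<close> on the right is \<open>rB\<close>.
\<close>
definition iB :: 'a where "iB = (unt Y \<otimes> \<one> OB) \<cdot> inv_arrow C (\<ell> OB)"
definition jY :: 'a where "jY = (\<one> OY \<otimes> unt B) \<cdot> inv_arrow C (\<rho> OY)"

lemma iB_jY_simps [simp]:
  "iB \<in> Ar C" "Dom C iB = OB" "Cod C iB = A"
  "jY \<in> Ar C" "Dom C jY = OY" "Cod C jY = A"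
  by (simp_all add: iB_def jY_def)

lemma x_unt: "x \<cdot> (unt B \<otimes> \<one> OY) = jY \<cdot> \<ell> OY" "x \<cdot> (\<one> OB \<otimes> unt Y) = iB \<cdot> \<rho> OB"
  using dist unfolding is_distributive_law_def jY_def iB_def
  by (simp_all add: Let_def)

lemma rB_unt: "rB \<cdot> (\<one> A \<otimes> unt B) = \<rho> A"
proof -
  have "rB \<cdot> (\<one> A \<otimes> unt B) = (\<one> OY \<otimes> mlt B) \<cdot> (\<alpha> OY OB OB \<cdot> ((\<one> OY \<otimes> \<one> OB) \<otimes> unt B))"
    by (simp add: rB_def)
  also have "\<alpha> OY OB OB \<cdot> ((\<one> OY \<otimes> \<one> OB) \<otimes> unt B) = (\<one> OY \<otimes> (\<one> OB \<otimes> unt B)) \<cdot> \<alpha> OY OB \<I>"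
    by (intro Assoc_nat) simp_all
  finally show ?thesis by (simp add: is_mon_laws RUnit_TensO)
qed

lemma rB_jY: "rB \<cdot> (jY \<otimes> \<one> OB) = \<one> A"
proof -
  have "rB \<cdot> (jY \<otimes> \<one> OB) = (\<one> OY \<otimes> mlt B) \<cdot>
      ((\<alpha> OY OB OB \<cdot> ((\<one> OY \<otimes> unt B) \<otimes> \<one> OB)) \<cdot> (inv_arrow C (\<rho> OY) \<otimes> \<one> OB))"
    by (simp add: rB_def jY_def)
  also have "\<alpha> OY OB OB \<cdot> ((\<one> OY \<otimes> unt B) \<otimes> \<one> OB) = (\<one> OY \<otimes> (unt B \<otimes> \<one> OB)) \<cdot> \<alpha> OY \<I> OB"
    by (intro Assoc_nat) simp_all
  finally show ?thesis by (simp add: is_mon_laws is_mon_unt_reassoc Assoc_Unit_inv)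
qed

lemma rB_iB: "rB \<cdot> (iB \<otimes> \<one> OB) = iB \<cdot> mlt B"
proof -
  have "rB \<cdot> (iB \<otimes> \<one> OB) = (\<one> OY \<otimes> mlt B) \<cdot>
      ((\<alpha> OY OB OB \<cdot> ((unt Y \<otimes> \<one> OB) \<otimes> \<one> OB)) \<cdot> (inv_arrow C (\<ell> OB) \<otimes> \<one> OB))"
    by (simp add: rB_def iB_def)
  also have "\<alpha> OY OB OB \<cdot> ((unt Y \<otimes> \<one> OB) \<otimes> \<one> OB) = (unt Y \<otimes> (\<one> OB \<otimes> \<one> OB)) \<cdot> \<alpha> \<I> OB OB"
    by (intro Assoc_nat) simp_all
  finally show ?thesis by (simp add: iB_def Assoc_Unit_inv LUnit_inv_nat)
qed

lemma lY_unt: "lY \<cdot> (unt Y \<otimes> \<one> A) = \<ell> A"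
proof -
  have "lY \<cdot> (unt Y \<otimes> \<one> A) = (mlt Y \<otimes> \<one> OB) \<cdot> (inv_arrow C (\<alpha> OY OY OB) \<cdot> (unt Y \<otimes> (\<one> OY \<otimes> \<one> OB)))"
    by (simp add: lY_def)
  also have "inv_arrow C (\<alpha> OY OY OB) \<cdot> (unt Y \<otimes> (\<one> OY \<otimes> \<one> OB))
      = ((unt Y \<otimes> \<one> OY) \<otimes> \<one> OB) \<cdot> inv_arrow C (\<alpha> \<I> OY OB)"
    by (intro Assoc_inv_nat) simp_all
  finally show ?thesis by (simp add: is_mon_laws flip: LUnit_TensO)
qed

lemma lB_unt: "lB \<cdot> (unt B \<otimes> \<one> A) = \<ell> A"
proof -
  have "lB \<cdot> (unt B \<otimes> \<one> A) = rB \<cdot> ((x \<otimes> \<one> OB) \<cdot> (inv_arrow C (\<alpha> OB OY OB) \<cdot> (unt B \<otimes> (\<one> OY \<otimes> \<one> OB))))"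
    by (simp add: lB_def)
  also have "inv_arrow C (\<alpha> OB OY OB) \<cdot> (unt B \<otimes> (\<one> OY \<otimes> \<one> OB))
      = ((unt B \<otimes> \<one> OY) \<otimes> \<one> OB) \<cdot> inv_arrow C (\<alpha> \<I> OY OB)"
    by (intro Assoc_inv_nat) simp_all
  also have "rB \<cdot> ((x \<otimes> \<one> OB) \<cdot> \<dots>)
      = (rB \<cdot> (jY \<otimes> \<one> OB)) \<cdot> ((\<ell> OY \<otimes> \<one> OB) \<cdot> inv_arrow C (\<alpha> \<I> OY OB))"
    by (simp add: x_unt)
  also have "\<dots> = \<ell> A" unfolding rB_jY by (simp flip: LUnit_TensO)
  finally show ?thesis .
qed

lemma lY_iB: "lY \<cdot> (\<one> OY \<otimes> iB) = \<one> A"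
proof -
  have "lY \<cdot> (\<one> OY \<otimes> iB) = (mlt Y \<otimes> \<one> OB) \<cdot>
      ((inv_arrow C (\<alpha> OY OY OB) \<cdot> (\<one> OY \<otimes> (unt Y \<otimes> \<one> OB))) \<cdot> (\<one> OY \<otimes> inv_arrow C (\<ell> OB)))"
    by (simp add: lY_def iB_def)
  also have "inv_arrow C (\<alpha> OY OY OB) \<cdot> (\<one> OY \<otimes> (unt Y \<otimes> \<one> OB))
      = ((\<one> OY \<otimes> unt Y) \<otimes> \<one> OB) \<cdot> inv_arrow C (\<alpha> OY \<I> OB)"
    by (intro Assoc_inv_nat) simp_all
  finally show ?thesis by (simp add: is_mon_laws is_mon_unt_reassoc Assoc_Unit_inv)
qed

lemma lB_iB: "lB \<cdot> (\<one> OB \<otimes> iB) = iB \<cdot> mlt B"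
proof -
  have "lB \<cdot> (\<one> OB \<otimes> iB) = rB \<cdot> ((x \<otimes> \<one> OB) \<cdot>
      ((inv_arrow C (\<alpha> OB OY OB) \<cdot> (\<one> OB \<otimes> (unt Y \<otimes> \<one> OB))) \<cdot> (\<one> OB \<otimes> inv_arrow C (\<ell> OB))))"
    by (simp add: lB_def iB_def)
  also have "inv_arrow C (\<alpha> OB OY OB) \<cdot> (\<one> OB \<otimes> (unt Y \<otimes> \<one> OB))
      = ((\<one> OB \<otimes> unt Y) \<otimes> \<one> OB) \<cdot> inv_arrow C (\<alpha> OB \<I> OB)"
    by (intro Assoc_inv_nat) simp_all
  also have "rB \<cdot> ((x \<otimes> \<one> OB) \<cdot> (\<dots> \<cdot> (\<one> OB \<otimes> inv_arrow C (\<ell> OB)))) = rB \<cdot> (iB \<otimes> \<one> OB)"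
    by (simp add: Comp_reassoc[OF x_unt(2)] Assoc_Unit_inv)
  finally show ?thesis by (simp only: rB_iB)
qed

lemma lY_jY: "lY \<cdot> (\<one> OY \<otimes> jY) = jY \<cdot> mlt Y"
proof -
  have "lY \<cdot> (\<one> OY \<otimes> jY) = (mlt Y \<otimes> \<one> OB) \<cdot>
      ((inv_arrow C (\<alpha> OY OY OB) \<cdot> (\<one> OY \<otimes> (\<one> OY \<otimes> unt B))) \<cdot> (\<one> OY \<otimes> inv_arrow C (\<rho> OY)))"
    by (simp add: lY_def jY_def)
  also have "inv_arrow C (\<alpha> OY OY OB) \<cdot> (\<one> OY \<otimes> (\<one> OY \<otimes> unt B))
      = ((\<one> OY \<otimes> \<one> OY) \<otimes> unt B) \<cdot> inv_arrow C (\<alpha> OY OY \<I>)"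
    by (intro Assoc_inv_nat) simp_all
  finally show ?thesis by (simp add: jY_def Assoc_Unit_inv RUnit_inv_nat)
qed

lemma lB_jY: "lB \<cdot> (\<one> OB \<otimes> jY) = x"
proof -
  have "lB \<cdot> (\<one> OB \<otimes> jY) = rB \<cdot> ((x \<otimes> \<one> OB) \<cdot>
      ((inv_arrow C (\<alpha> OB OY OB) \<cdot> (\<one> OB \<otimes> (\<one> OY \<otimes> unt B))) \<cdot> (\<one> OB \<otimes> inv_arrow C (\<rho> OY))))"
    by (simp add: lB_def jY_def)
  also have "inv_arrow C (\<alpha> OB OY OB) \<cdot> (\<one> OB \<otimes> (\<one> OY \<otimes> unt B))
      = ((\<one> OB \<otimes> \<one> OY) \<otimes> unt B) \<cdot> inv_arrow C (\<alpha> OB OY \<I>)"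
    by (intro Assoc_inv_nat) simp_all
  also have "rB \<cdot> ((x \<otimes> \<one> OB) \<cdot> (\<dots> \<cdot> (\<one> OB \<otimes> inv_arrow C (\<rho> OY))))
      = (rB \<cdot> (\<one> A \<otimes> unt B)) \<cdot> ((x \<otimes> \<one> \<I>) \<cdot> inv_arrow C (\<rho> (OB \<odot> OY)))"
    by (simp add: Assoc_Unit_inv)
  also have "\<dots> = x"
    unfolding rB_unt by (simp add: Comp_reassoc[OF RUnit_nat])
  finally show ?thesis .
qed

lemma mA_iB_left: "mA \<cdot> (iB \<otimes> \<one> A) = lB"
proof -
  have "mA \<cdot> (iB \<otimes> \<one> A) = lY \<cdot> ((\<one> OY \<otimes> lB) \<cdot>
      ((\<alpha> OY OB A \<cdot> ((unt Y \<otimes> \<one> OB) \<otimes> \<one> A)) \<cdot> (inv_arrow C (\<ell> OB) \<otimes> \<one> A)))"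
    by (simp add: mA_def iB_def)
  also have "\<alpha> OY OB A \<cdot> ((unt Y \<otimes> \<one> OB) \<otimes> \<one> A) = (unt Y \<otimes> (\<one> OB \<otimes> \<one> A)) \<cdot> \<alpha> \<I> OB A"
    by (intro Assoc_nat) simp_all
  also have "lY \<cdot> ((\<one> OY \<otimes> lB) \<cdot> (\<dots> \<cdot> (inv_arrow C (\<ell> OB) \<otimes> \<one> A)))
      = (lY \<cdot> (unt Y \<otimes> \<one> A)) \<cdot> ((\<one> \<I> \<otimes> lB) \<cdot> inv_arrow C (\<ell> (OB \<odot> A)))"
    by (simp add: Assoc_Unit_inv)
  also have "\<dots> = lB"
    unfolding lY_unt by (simp add: Comp_reassoc[OF LUnit_nat])
  finally show ?thesis .
qed

lemma mA_jY_left: "mA \<cdot> (jY \<otimes> \<one> A) = lY"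
proof -
  have "mA \<cdot> (jY \<otimes> \<one> A) = lY \<cdot> ((\<one> OY \<otimes> lB) \<cdot>
      ((\<alpha> OY OB A \<cdot> ((\<one> OY \<otimes> unt B) \<otimes> \<one> A)) \<cdot> (inv_arrow C (\<rho> OY) \<otimes> \<one> A)))"
    by (simp add: mA_def jY_def)
  also have "\<alpha> OY OB A \<cdot> ((\<one> OY \<otimes> unt B) \<otimes> \<one> A) = (\<one> OY \<otimes> (unt B \<otimes> \<one> A)) \<cdot> \<alpha> OY \<I> A"
    by (intro Assoc_nat) simp_all
  finally show ?thesis by (simp add: Comp_reassoc[OF lB_unt] Assoc_Unit_inv)
qed

lemma mA_iB_right: "mA \<cdot> (\<one> A \<otimes> iB) = rB"
proof -
  have "mA \<cdot> (\<one> A \<otimes> iB) = lY \<cdot> ((\<one> OY \<otimes> lB) \<cdot> (\<alpha> OY OB A \<cdot> ((\<one> OY \<otimes> \<one> OB) \<otimes> iB)))"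
    by (simp add: mA_def)
  also have "\<alpha> OY OB A \<cdot> ((\<one> OY \<otimes> \<one> OB) \<otimes> iB) = (\<one> OY \<otimes> (\<one> OB \<otimes> iB)) \<cdot> \<alpha> OY OB OB"
    by (intro Assoc_nat) simp_all
  also have "lY \<cdot> ((\<one> OY \<otimes> lB) \<cdot> \<dots>) = (lY \<cdot> (\<one> OY \<otimes> iB)) \<cdot> ((\<one> OY \<otimes> mlt B) \<cdot> \<alpha> OY OB OB)"
    by (simp add: lB_iB)
  also have "\<dots> = rB" unfolding lY_iB by (simp add: rB_def)
  finally show ?thesis .
qed

text \<open>
  The analogue for monoids of the composite of two monads along a distributive law. Its unit is
  \<open>u \<otimes> u\<close>, written as the image of the unit of \<open>B\<close>.
\<close>
definition wreath :: "('o, 'a) mon" where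
  "wreath = \<lparr>obj = A, mlt = mA, unt = iB \<cdot> unt B\<rparr>"

lemma wreath_simps [simp]: "obj wreath = A" "mlt wreath = mA" "unt wreath = iB \<cdot> unt B"
  by (simp_all add: wreath_def)

lemma is_mon_wreath [simp]: "is_mon C wreath"
proof -
  have "mA \<cdot> ((iB \<cdot> unt B) \<otimes> \<one> A) = (mA \<cdot> (iB \<otimes> \<one> A)) \<cdot> (unt B \<otimes> \<one> A)" by simp
  then have 1: "mA \<cdot> ((iB \<cdot> unt B) \<otimes> \<one> A) = \<ell> A" unfolding mA_iB_left lB_unt .
  have "mA \<cdot> (\<one> A \<otimes> (iB \<cdot> unt B)) = (mA \<cdot> (\<one> A \<otimes> iB)) \<cdot> (\<one> A \<otimes> unt B)" by simp
  then have 2: "mA \<cdot> (\<one> A \<otimes> (iB \<cdot> unt B)) = \<rho> A" unfolding mA_iB_right rB_unt .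
  show ?thesis
    unfolding is_mon_def
    by (intro conjI) (simp_all add: 1 2 associative_eq[OF associative_mA_mA])
qed

lemma conv_iB_jY: "iB \<star>\<^bsub>wreath\<^esub> jY = x" "jY \<star>\<^bsub>wreath\<^esub> iB = \<one> A"
proof -
  have "iB \<star>\<^bsub>wreath\<^esub> jY = (mA \<cdot> (iB \<otimes> \<one> A)) \<cdot> (\<one> OB \<otimes> jY)" by (simp add: conv_def)
  then show "iB \<star>\<^bsub>wreath\<^esub> jY = x" unfolding mA_iB_left lB_jY .
  have "jY \<star>\<^bsub>wreath\<^esub> iB = (mA \<cdot> (jY \<otimes> \<one> A)) \<cdot> (\<one> OY \<otimes> iB)" by (simp add: conv_def)
  then show "jY \<star>\<^bsub>wreath\<^esub> iB = \<one> A" unfolding mA_jY_left lY_iB .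
qed

lemma is_mon_hom_iB: "is_mon_hom C B wreath iB"
proof -
  have "iB \<star>\<^bsub>wreath\<^esub> iB = (mA \<cdot> (iB \<otimes> \<one> A)) \<cdot> (\<one> OB \<otimes> iB)" by (simp add: conv_def)
  then have "iB \<star>\<^bsub>wreath\<^esub> iB = iB \<cdot> mlt B" unfolding mA_iB_left lB_iB .
  then show ?thesis by (simp add: is_mon_hom_iff)
qed

lemma is_mon_hom_jY: "is_mon_hom C Y wreath jY"
proof -
  have "jY \<star>\<^bsub>wreath\<^esub> jY = (mA \<cdot> (jY \<otimes> \<one> A)) \<cdot> (\<one> OY \<otimes> jY)" by (simp add: conv_def)
  then have "jY \<star>\<^bsub>wreath\<^esub> jY = jY \<cdot> mlt Y" unfolding mA_jY_left lY_jY .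
  moreover have "jY \<cdot> unt Y = iB \<cdot> unt B"
    by (simp add: jY_def iB_def RUnit_inv_nat LUnit_inv_nat LUnit_eq_RUnit)
  ultimately show ?thesis by (simp add: is_mon_hom_iff)
qed

text \<open>
  Put \<open>f = j \<star> i\<close>. Composed with \<open>lY\<close> it becomes \<open>j \<star> f\<close>, and composed with \<open>lB\<close> it becomes
  \<open>i \<star> f\<close>; the latter uses the compatibility of \<open>i\<close> and \<open>j\<close> with \<open>x\<close>. As \<open>mA\<close> is built from these
  actions, composing it with \<open>f\<close> gives \<open>j \<star> (i \<star> f)\<close>, that is \<open>f \<star> f\<close>.
\<close>
lemma wreath_universal:
  assumes N: "is_mon C N" and i: "is_mon_hom C B N i" and j: "is_mon_hom C Y N j"
    and eq: "i \<star>\<^bsub>N\<^esub> j = j \<star>\<^bsub>N\<^esub> i \<cdot> x"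
  shows "is_mon_hom C wreath N (j \<star>\<^bsub>N\<^esub> i)"
    and "j \<star>\<^bsub>N\<^esub> i \<cdot> iB = i" and "j \<star>\<^bsub>N\<^esub> i \<cdot> jY = j"
proof -
  note [simp] = N is_mon_hom_simps[OF i] is_mon_hom_simps[OF j] eq[symmetric]
  let ?f = "j \<star>\<^bsub>N\<^esub> i"
  show fi: "?f \<cdot> iB = i" and "?f \<cdot> jY = j" by (simp_all add: iB_def jY_def)
  have lY: "?f \<cdot> lY = j \<star>\<^bsub>N\<^esub> ?f" by (simp add: lY_def)
  have lB: "?f \<cdot> lB = i \<star>\<^bsub>N\<^esub> ?f" by (simp add: lB_def rB_def)
  have "?f \<cdot> mA = (?f \<cdot> lY) \<cdot> ((\<one> OY \<otimes> lB) \<cdot> \<alpha> OY OB A)" by (simp add: mA_def)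
  also have "\<dots> = ?f \<star>\<^bsub>N\<^esub> ?f" unfolding lY by (simp add: lB)
  finally have "?f \<cdot> mlt wreath = ?f \<star>\<^bsub>N\<^esub> ?f" by simp
  moreover have "?f \<cdot> unt wreath = (?f \<cdot> iB) \<cdot> unt B" by simp
  then have "?f \<cdot> unt wreath = unt N" unfolding fi by simp
  ultimately show "is_mon_hom C wreath N ?f" by (simp add: is_mon_hom_iff)
qed

end

section \<open>The categories of split epimorphisms and of distributive laws\<close>

context monoidal_category begin

lemma category_SplitEpiMon: "category (SplitEpiMon C S)"
proof -
  have Id: "is_split_epi_hom C E E (\<one> (obj B)) (\<one> (obj A))"
    if "is_split_epi C S E" and [simp]: "E = (B, A, i, s)" for E B A i s
    using that by (auto simp: is_split_epi_def is_split_epi_hom_def is_mon_hom_Id is_mon_hom_simps)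
  have Comp: "is_split_epi_hom C E E'' (b' \<cdot> b) (a' \<cdot> a)"
    if E: "is_split_epi C S E" "is_split_epi C S E'" "is_split_epi C S E''"
      and hom: "is_split_epi_hom C E E' b a" "is_split_epi_hom C E' E'' b' a'" for E E' E'' a b a' b'
  proof -
    obtain B A i s B' A' i' s' B'' A'' i'' s''
      where [simp]: "E = (B, A, i, s)" "E' = (B', A', i', s')" "E'' = (B'', A'', i'', s'')"
      by (metis prod_cases4)
    have mon: "is_mon C B" "is_mon C A" "is_mon C B'" "is_mon C A'" "is_mon C B''" "is_mon C A''"
      and i: "is_mon_hom C B A i" "is_mon_hom C A B s" "is_mon_hom C B' A' i'" "is_mon_hom C A' B' s'"
        "is_mon_hom C B'' A'' i''" "is_mon_hom C A'' B'' s''"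
      using E by (auto simp: is_split_epi_def)
    have b: "is_mon_hom C B B' b" "is_mon_hom C A A' a" "is_mon_hom C B' B'' b'" "is_mon_hom C A' A'' a'"
      and eq: "s' \<cdot> a = b \<cdot> s" "i' \<cdot> b = a \<cdot> i" "s'' \<cdot> a' = b' \<cdot> s'" "i'' \<cdot> b' = a' \<cdot> i'"
      using hom by (auto simp: is_split_epi_hom_def)
    note [simp] = i[THEN is_mon_hom_simps(1)] i[THEN is_mon_hom_simps(2)] i[THEN is_mon_hom_simps(3)]
      b[THEN is_mon_hom_simps(1)] b[THEN is_mon_hom_simps(2)] b[THEN is_mon_hom_simps(3)]
    have "s'' \<cdot> (a' \<cdot> a) = b' \<cdot> (b \<cdot> s)" by (simp add: Comp_reassoc[OF eq(3)] eq(1))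
    moreover have "i'' \<cdot> (b' \<cdot> b) = a' \<cdot> (a \<cdot> i)" by (simp add: Comp_reassoc[OF eq(4)] eq(2))
    ultimately show ?thesis
      using is_mon_hom_Comp[OF mon(1,3,5) b(1,3)] is_mon_hom_Comp[OF mon(2,4,6) b(2,4)]
      by (simp add: is_split_epi_hom_def)
  qed
  have Ar: "b \<in> Ar C" "a \<in> Ar C" "Dom C b = obj (fst E)" "Dom C a = obj (fst (snd E))"
    "Cod C b = obj (fst E')" "Cod C a = obj (fst (snd E'))"
    if "is_split_epi_hom C E E' b a" for E E' a b
    using that by (auto simp: is_split_epi_hom_def is_mon_hom_def split: prod.splits)
  have ob: "obj B \<in> Ob C" "obj A \<in> Ob C" if "is_split_epi C S (B, A, i, s)" for B A i s
    using that by (auto simp: is_split_epi_def)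
  show ?thesis
    by unfold_locales (auto simp: SplitEpiMon_def hom_def ob Ar Id intro: Comp)
qed

lemma category_DistLaw: "category (DistLaw C S)"
proof -
  have Id: "is_dist_law_hom C L L (\<one> (obj B)) (\<one> (obj Y))"
    if "is_dist_law C S L" and [simp]: "L = (B, Y, e, x)" for L B Y e x
    using that
    by (auto simp: is_dist_law_def is_dist_law_hom_def is_mon_hom_Id is_mon_hom_simps is_distributive_law_def Let_def)
  have Comp: "is_dist_law_hom C L L'' (b' \<cdot> b) (y' \<cdot> y)"
    if L: "is_dist_law C S L" "is_dist_law C S L'" "is_dist_law C S L''"
      and hom: "is_dist_law_hom C L L' b y" "is_dist_law_hom C L' L'' b' y'" for L L' L'' y b y' b'
  proof -
    obtain B Y e x B' Y' e' x' B'' Y'' e'' x''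
      where [simp]: "L = (B, Y, e, x)" "L' = (B', Y', e', x')" "L'' = (B'', Y'', e'', x'')"
      by (metis prod_cases4)
    have mon: "is_mon C B" "is_mon C Y" "is_mon C B'" "is_mon C Y'" "is_mon C B''" "is_mon C Y''"
      and e: "is_mon_hom C Y (trivial_mon C) e" "is_mon_hom C Y' (trivial_mon C) e'"
        "is_mon_hom C Y'' (trivial_mon C) e''"
      and x [simp]: "x \<in> Ar C" "Dom C x = obj B \<odot> obj Y" "Cod C x = obj Y \<odot> obj B"
        "x' \<in> Ar C" "Dom C x' = obj B' \<odot> obj Y'" "Cod C x' = obj Y' \<odot> obj B'"
        "x'' \<in> Ar C" "Dom C x'' = obj B'' \<odot> obj Y''" "Cod C x'' = obj Y'' \<odot> obj B''"
      using L by (auto simp: is_dist_law_def is_distributive_law_def Let_def)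
    have b: "is_mon_hom C B B' b" "is_mon_hom C Y Y' y" "is_mon_hom C B' B'' b'" "is_mon_hom C Y' Y'' y'"
      and eq: "e' \<cdot> y = e" "x' \<cdot> (b \<otimes> y) = (y \<otimes> b) \<cdot> x" "e'' \<cdot> y' = e'"
        "x'' \<cdot> (b' \<otimes> y') = (y' \<otimes> b') \<cdot> x'"
      using hom by (auto simp: is_dist_law_hom_def)
    note [simp] = e[THEN is_mon_hom_simps(1)] e[THEN is_mon_hom_simps(2)] e[THEN is_mon_hom_simps(3)]
      b[THEN is_mon_hom_simps(1)] b[THEN is_mon_hom_simps(2)] b[THEN is_mon_hom_simps(3)]
    have "e'' \<cdot> (y' \<cdot> y) = e" by (simp add: Comp_reassoc[OF eq(3)] eq(1))
    moreover have "x'' \<cdot> ((b' \<cdot> b) \<otimes> (y' \<cdot> y)) = (x'' \<cdot> (b' \<otimes> y')) \<cdot> (b \<otimes> y)" by simp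
    then have "x'' \<cdot> ((b' \<cdot> b) \<otimes> (y' \<cdot> y)) = (y' \<otimes> b') \<cdot> (x' \<cdot> (b \<otimes> y))" unfolding eq(4) by simp
    then have "x'' \<cdot> ((b' \<cdot> b) \<otimes> (y' \<cdot> y)) = ((y' \<cdot> y) \<otimes> (b' \<cdot> b)) \<cdot> x" by (simp add: eq(2))
    ultimately show ?thesis
      using is_mon_hom_Comp[OF mon(1,3,5) b(1,3)] is_mon_hom_Comp[OF mon(2,4,6) b(2,4)]
      by (simp add: is_dist_law_hom_def)
  qed
  have Ar: "b \<in> Ar C" "y \<in> Ar C" "Dom C b = obj (fst L)" "Dom C y = obj (fst (snd L))"
    "Cod C b = obj (fst L')" "Cod C y = obj (fst (snd L'))"
    if "is_dist_law_hom C L L' b y" for L L' y b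
    using that by (auto simp: is_dist_law_hom_def is_mon_hom_def split: prod.splits)
  have ob: "obj B \<in> Ob C" "obj Y \<in> Ob C" if "is_dist_law C S (B, Y, e, x)" for B Y e x
    using that by (auto simp: is_dist_law_def)
  show ?thesis
    by unfold_locales (auto simp: DistLaw_def hom_def ob Ar Id intro: Comp)
qed

end

section \<open>The distributive law of a split epimorphism\<close>
locale pullback_span_class = monoidal_span_class C S
  for C :: "('o, 'a, 'z) mcat_scheme" (structure) and S +
  assumes has_rel_pullbacks: "has_rel_pullbacks C S"
begin

text \<open>
  The projections of the relative pullback of \<open>s\<close> along the unit of \<open>B\<close>, regarded as the inclusion
  of the kernel of \<open>s\<close> and the counit of this kernel.
\<close>
definition ker_incl :: "('o, 'a) mon \<Rightarrow> 'a \<Rightarrow> 'a" where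
  "ker_incl B s = pr1 C S s (unt B)"

definition ker_counit :: "('o, 'a) mon \<Rightarrow> 'a \<Rightarrow> 'a" where
  "ker_counit B s = pr2 C S s (unt B)"

text \<open>
  The monoid on the kernel. Its structure is determined by the conditions, since the two projections
  are jointly monic.
\<close>
definition ker_mon :: "('o, 'a) mon \<Rightarrow> ('o, 'a) mon \<Rightarrow> 'a \<Rightarrow> ('o, 'a) mon" where
  "ker_mon A B s = (SOME P. is_mon C P \<and> obj P = Dom C (ker_incl B s) \<and>
     is_mon_hom C P A (ker_incl B s) \<and> is_mon_hom C P (trivial_mon C) (ker_counit B s))"

definition ker_law :: "('o, 'a) mon \<Rightarrow> ('o, 'a) mon \<Rightarrow> 'a \<Rightarrow> 'a \<Rightarrow> 'a" where
  "ker_law A B i s =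
     inv_arrow C (ker_incl B s \<star>\<^bsub>A\<^esub> i) \<cdot> (i \<star>\<^bsub>A\<^esub> ker_incl B s)"

lemma is_split_epi_iff:
  "is_split_epi C S (B, A, i, s) \<longleftrightarrow>
     is_mon C B \<and> is_mon C A \<and> is_mon_hom C B A i \<and> is_mon_hom C A B s \<and>
     s \<cdot> i = \<one> (obj B) \<and> (\<one> (obj A), s) \<in> S \<and> invertible C (ker_incl B s \<star>\<^bsub>A\<^esub> i)"
  by (simp add: is_split_epi_def ker_incl_def conv_def)

lemma ker_mon:
  assumes "is_mon C B" "is_mon C A" "is_mon_hom C A B s" "(\<one> (obj A), s) \<in> S"
  shows "is_rel_pullback C S s (unt B) (ker_incl B s) (ker_counit B s)"
    and "is_mon C (ker_mon A B s)" "obj (ker_mon A B s) = Dom C (ker_incl B s)"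
    and "is_mon_hom C (ker_mon A B s) A (ker_incl B s)"
    and "is_mon_hom C (ker_mon A B s) (trivial_mon C) (ker_counit B s)"
proof -
  show pb: "is_rel_pullback C S s (unt B) (ker_incl B s) (ker_counit B s)"
    unfolding ker_incl_def ker_counit_def using assms
    by (intro split_epi_rel_pullback monoidal_category_axioms admissible monoidal_class has_rel_pullbacks)
  have "\<exists>P. is_mon C P \<and> obj P = Dom C (ker_incl B s) \<and>
     is_mon_hom C P A (ker_incl B s) \<and> is_mon_hom C P (trivial_mon C) (ker_counit B s)"
    by (rule rel_pullback_mon[OF pb assms(2,1) is_mon_trivial_mon assms(3) is_mon_hom_unt[OF assms(1)]])
  from someI_ex[OF this]
  show "is_mon C (ker_mon A B s)" "obj (ker_mon A B s) = Dom C (ker_incl B s)"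
    "is_mon_hom C (ker_mon A B s) A (ker_incl B s)"
    "is_mon_hom C (ker_mon A B s) (trivial_mon C) (ker_counit B s)"
    unfolding ker_mon_def by blast+
qed

end

locale split_epi_object = pullback_span_class C S
  for C :: "('o, 'a, 'z) mcat_scheme" (structure) and S +
  fixes B A :: "('o, 'a) mon" and i s :: 'a
  assumes is_split_epi: "is_split_epi C S (B, A, i, s)"
begin

abbreviation p where "p \<equiv> ker_incl B s"
abbreviation e where "e \<equiv> ker_counit B s"
abbreviation P where "P \<equiv> ker_mon A B s"
abbreviation x where "x \<equiv> ker_law A B i s"

lemma data:
  "is_mon C B" "is_mon C A" "is_mon_hom C B A i" "is_mon_hom C A B s" "(\<one> (obj A), s) \<in> S"
  "s \<cdot> i = \<one> (obj B)" "invertible C (p \<star>\<^bsub>A\<^esub> i)"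
  using is_split_epi by (auto simp: is_split_epi_iff)

lemmas pullback = ker_mon(1)[OF data(1,2,4,5)]
lemmas ker = ker_mon(2-)[OF data(1,2,4,5)]

lemma simps [simp]:
  "is_mon C B" "is_mon C A" "is_mon C P" "s \<cdot> i = \<one> (obj B)" "invertible C (p \<star>\<^bsub>A\<^esub> i)"
  "i \<in> Ar C" "Dom C i = obj B" "Cod C i = obj A" "i \<cdot> mlt B = i \<star>\<^bsub>A\<^esub> i" "i \<cdot> unt B = unt A"
  "s \<in> Ar C" "Dom C s = obj A" "Cod C s = obj B" "s \<cdot> mlt A = s \<star>\<^bsub>B\<^esub> s" "s \<cdot> unt A = unt B"
  "p \<in> Ar C" "Dom C p = obj P" "Cod C p = obj A" "p \<cdot> mlt P = p \<star>\<^bsub>A\<^esub> p" "p \<cdot> unt P = unt A"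
  "e \<in> Ar C" "Dom C e = obj P" "Cod C e = \<I>"
  "s \<cdot> p = unt B \<cdot> e"
  using data ker is_mon_hom_simps[OF data(3)] is_mon_hom_simps[OF data(4)] is_mon_hom_simps[OF ker(3)]
    is_mon_hom_simps[OF ker(4)] rel_pullback_simps(7)[OF pullback]
  by simp_all

lemma jointly_monic:
  assumes "h \<in> hom C D (obj P)" "k \<in> hom C D (obj P)" "p \<cdot> h = p \<cdot> k" "e \<cdot> h = e \<cdot> k"
  shows "h = k"
  using rel_pullback_jointly_monic[OF pullback] assms by simp

lemma lift:
  assumes "(a, c) \<in> S" "Cod C a = obj A" "Cod C c = \<I>" "s \<cdot> a = unt B \<cdot> c"
  shows "\<exists>h. h \<in> hom C (Dom C a) (obj P) \<and> p \<cdot> h = a \<and> e \<cdot> h = c"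
  using rel_pullback_lift[OF pullback assms(1)] assms(2-) by simp

lemma x_simps [simp]:
  "x \<in> Ar C" "Dom C x = obj B \<odot> obj P" "Cod C x = obj P \<odot> obj B"
  "p \<star>\<^bsub>A\<^esub> i \<cdot> x = i \<star>\<^bsub>A\<^esub> p"
  by (simp_all add: ker_law_def)

lemma x_reassoc [simp]:
  "t \<in> Ar C \<Longrightarrow> Cod C t = obj B \<odot> obj P \<Longrightarrow> p \<star>\<^bsub>A\<^esub> i \<cdot> (x \<cdot> t) = i \<star>\<^bsub>A\<^esub> p \<cdot> t"
  by (rule Comp_reassoc) simp_all

lemma distributive_law: "is_distributive_law C B P x"
  by (rule is_distributive_law_factorization[OF data(2,1) ker(1) data(3) ker(3)]) simp_all

text \<open>
  Restrict \<open>(\<one> A, s)\<close> along the section \<open>i\<close> and compose the first leg with \<open>s\<close>.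
\<close>
lemma span_B: "(\<one> (obj B), \<one> (obj B)) \<in> S"
proof -
  have "(s \<cdot> (\<one> (obj A) \<cdot> i), \<one> (obj B) \<cdot> (s \<cdot> i)) \<in> S"
    by (intro POST PRE data) simp_all
  then show ?thesis by simp
qed

text \<open>
  Reflection reduces this to \<open>(p, e)\<close>, which is in the class by definition of the pullback, and to
  \<open>(e, e)\<close>, a precomposite of \<open>(\<one> \<I>, \<one> \<I>)\<close>.
\<close>
lemma span_P: "(\<one> (obj P), e) \<in> S"
proof -
  have "(\<one> \<I> \<cdot> e, \<one> \<I> \<cdot> e) \<in> S" by (intro PRE span_unit) simp_all
  then have "(e \<cdot> \<one> (obj P), e) \<in> S" and "(p \<cdot> \<one> (obj P), e) \<in> S"
    using rel_pullback_simps(1)[OF pullback] by simp_all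
  then show ?thesis
    by (intro rel_pullback_reflect[OF pullback, of "\<one> (obj P)" e]) simp_all
qed

text \<open>
  \<open>s\<close> sends \<open>p \<star> i\<close> to \<open>(u \<cdot> e) \<star> 1\<close>: the factorisation turns \<open>s\<close> into the projection \<open>e \<otimes> 1\<close>.
\<close>
lemma s_factor: "s \<cdot> p \<star>\<^bsub>A\<^esub> i = dl_proj C B e"
  using is_mon_hom_conv[OF data(2,1,4), of p i] conv_unt_Comp(1)[of B e "\<one> (obj B)"]
  by (simp add: dl_proj_def)

lemma dl_proj_simps [simp]: "dl_proj C B e \<in> Ar C" "Dom C (dl_proj C B e) = obj P \<odot> obj B"
  "Cod C (dl_proj C B e) = obj B"
  by (simp_all add: dl_proj_def)

lemma dl_proj_x: "dl_proj C B e \<cdot> x = \<rho> (obj B) \<cdot> (\<one> (obj B) \<otimes> e)"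
proof -
  have "dl_proj C B e \<cdot> x = s \<cdot> i \<star>\<^bsub>A\<^esub> p"
    unfolding s_factor[symmetric] by simp
  then show ?thesis
    using is_mon_hom_conv[OF data(2,1,4), of i p] conv_unt_Comp(2)[of B e "\<one> (obj B)"] by simp
qed

text \<open>
  The isomorphism \<open>p \<star> i\<close> over \<open>B\<close> identifies the relative pullback of \<open>e \<otimes> 1\<close> with that of \<open>s\<close>,
  which is \<open>P\<close>. The arrow \<open>g\<close> that it induces is inverse to the comparison arrow.
\<close>
lemma invertible_comparison: "invertible C (dl_comparison C S B P e)"
proof -
  let ?f = "dl_comparison C S B P e" and ?q = "p \<star>\<^bsub>A\<^esub> i"
  let ?p = "pr1 C S (dl_proj C B e) (unt B)" and ?e = "pr2 C S (dl_proj C B e) (unt B)"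
  note ax = monoidal_category_axioms admissible monoidal_class has_rel_pullbacks data(1) ker(1,4)
    span_P span_B
  have "is_dl_comparison C S B P e ?f"
    unfolding dl_comparison_def by (rule theI'[OF dl_comparison_unique_existence[OF ax]])
  then have f [simp]: "?f \<in> Ar C" "Dom C ?f = obj P" "Cod C ?f = Dom C ?p"
      "?p \<cdot> ?f = (\<one> (obj P) \<otimes> unt B) \<cdot> inv_arrow C (\<rho> (obj P))" "?e \<cdot> ?f = e"
    unfolding is_dl_comparison_def pb_obj_def by auto
  have pb: "is_rel_pullback C S (dl_proj C B e) (unt B) ?p ?e"
    by (rule dl_rel_pullback[OF ax])
  note pb_simps = rel_pullback_simps[OF pb]
  note [simp] = pb_simps(2-6)
  have "s \<cdot> (?q \<cdot> ?p) = (s \<cdot> ?q) \<cdot> ?p" by simp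
  then have "s \<cdot> (?q \<cdot> ?p) = unt B \<cdot> ?e" unfolding s_factor pb_simps(7) .
  moreover have "(?q \<cdot> ?p, \<one> \<I> \<cdot> ?e) \<in> S" by (intro POST pb_simps) simp_all
  ultimately obtain g where "g \<in> hom C (Dom C ?p) (obj P)" and pg: "p \<cdot> g = ?q \<cdot> ?p" "e \<cdot> g = ?e"
    using lift[of "?q \<cdot> ?p" ?e] by auto
  then have g [simp]: "g \<in> Ar C" "Dom C g = Dom C ?p" "Cod C g = obj P" by auto
  have "g \<cdot> ?f = \<one> (obj P)"
    by (rule jointly_monic[of _ "obj P"])
      (simp_all add: Comp_reassoc[OF pg(1)] Comp_reassoc[OF pg(2)])
  moreover have pfg: "?p \<cdot> (?f \<cdot> g) = ?p"
  proof (rule cancel_left[of ?q])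
    have "?q \<cdot> (?p \<cdot> (?f \<cdot> g)) = (?q \<cdot> (?p \<cdot> ?f)) \<cdot> g" by (simp del: f(4))
    also have "\<dots> = p \<cdot> g" by simp
    finally show "?q \<cdot> (?p \<cdot> (?f \<cdot> g)) = ?q \<cdot> ?p" unfolding pg .
  qed simp_all
  have "?f \<cdot> g = \<one> (Dom C ?p)"
    by (rule rel_pullback_jointly_monic[OF pb, of _ "Dom C ?p"])
      (simp_all add: pfg Comp_reassoc[OF f(5)] pg del: f(4))
  ultimately show ?thesis by (intro invertibleI[of _ "obj P" "Dom C ?p" g]) simp_all
qed

lemma is_dist_law: "is_dist_law C S (B, P, e, x)"
  unfolding is_dist_law_def
  using data ker distributive_law span_B span_P dl_proj_x invertible_comparison by simp

end

section \<open>The equivalence\<close>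
context pullback_span_class begin

lemma split_epi_objectI: "is_split_epi C S (B, A, i, s) \<Longrightarrow> split_epi_object C S B A i s"
  by unfold_locales

definition kernel_law :: "('o, 'a) split_epi \<Rightarrow> ('o, 'a) dist_law" where
  "kernel_law = (\<lambda>(B, A, i, s). (B, ker_mon A B s, ker_counit B s, ker_law A B i s))"

text \<open>
  The restriction of \<open>a\<close> to the kernels.
\<close>
definition ker_map :: "('o, 'a) split_epi \<Rightarrow> ('o, 'a) split_epi \<Rightarrow> 'a \<Rightarrow> 'a" where
  "ker_map = (\<lambda>(B, A, i, s) (B', A', i', s') a.
     THE y. y \<in> hom C (Dom C (ker_incl B s)) (Dom C (ker_incl B' s')) \<and>
       ker_incl B' s' \<cdot> y = a \<cdot> ker_incl B s \<and> ker_counit B' s' \<cdot> y = ker_counit B s)"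

text \<open>
  The arrow exists because \<open>(a \<cdot> p, e)\<close> is a compatible span in the class. It commutes with the
  distributive laws because \<open>a\<close> preserves both \<open>p \<star> i\<close> and \<open>i \<star> p\<close>.
\<close>
lemma ker_map:
  assumes E: "is_split_epi C S (B, A, i, s)" and E': "is_split_epi C S (B', A', i', s')"
    and hom: "is_split_epi_hom C (B, A, i, s) (B', A', i', s') b a"
  defines "y \<equiv> ker_map (B, A, i, s) (B', A', i', s') a"
  shows "y \<in> hom C (obj (ker_mon A B s)) (obj (ker_mon A' B' s'))"
    "ker_incl B' s' \<cdot> y = a \<cdot> ker_incl B s" "ker_counit B' s' \<cdot> y = ker_counit B s"
    "is_dist_law_hom C (kernel_law (B, A, i, s)) (kernel_law (B', A', i', s')) b y"
proof -
  interpret E: split_epi_object C S B A i s by (rule split_epi_objectI[OF E])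
  interpret E': split_epi_object C S B' A' i' s' by (rule split_epi_objectI[OF E'])
  have a: "is_mon_hom C A A' a" and b: "is_mon_hom C B B' b" and eq: "s' \<cdot> a = b \<cdot> s" "i' \<cdot> b = a \<cdot> i"
    using hom by (auto simp: is_split_epi_hom_def)
  note [simp] = is_mon_hom_simps[OF a] is_mon_hom_simps[OF b]
  have "s' \<cdot> (a \<cdot> E.p) = b \<cdot> (s \<cdot> E.p)"
    by (simp add: Comp_reassoc[OF eq(1)] del: E.simps(24))
  then have "s' \<cdot> (a \<cdot> E.p) = unt B' \<cdot> E.e" by (simp flip: Comp_assoc')
  moreover have "(a \<cdot> E.p, \<one> \<I> \<cdot> E.e) \<in> S"
    by (intro POST rel_pullback_simps(1)[OF E.pullback]) simp_all
  ultimately have "\<exists>h. h \<in> hom C (Dom C (a \<cdot> E.p)) (obj E'.P) \<and> E'.p \<cdot> h = a \<cdot> E.p \<and> E'.e \<cdot> h = E.e"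
    by (intro E'.lift) simp_all
  moreover have "h = h'" if "h \<in> hom C (obj E.P) (obj E'.P)" "E'.p \<cdot> h = a \<cdot> E.p" "E'.e \<cdot> h = E.e"
    "h' \<in> hom C (obj E.P) (obj E'.P)" "E'.p \<cdot> h' = a \<cdot> E.p" "E'.e \<cdot> h' = E.e" for h h'
    by (rule E'.jointly_monic[of h "obj E.P" h']) (use that in simp_all)
  ultimately have "\<exists>!y. y \<in> hom C (obj E.P) (obj E'.P) \<and> E'.p \<cdot> y = a \<cdot> E.p \<and> E'.e \<cdot> y = E.e"
    by (intro ex_ex1I) auto
  from theI'[OF this] show y: "y \<in> hom C (obj E.P) (obj E'.P)" "E'.p \<cdot> y = a \<cdot> E.p" "E'.e \<cdot> y = E.e"
    unfolding y_def ker_map_def by auto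
  then have [simp]: "y \<in> Ar C" "Dom C y = obj E.P" "Cod C y = obj E'.P" by auto
  have "is_mon_hom C E.P E'.P y"
    by (rule rel_pullback_mon_hom[OF E'.pullback _ _ _ _ E'.ker(1) _ _ E'.ker(2-4)])
      (simp_all add: y E.ker(4) is_mon_hom_Comp[OF E.ker(1) E.data(2) E'.data(2) E.ker(3) a])
  moreover have "E'.x \<cdot> (b \<otimes> y) = (y \<otimes> b) \<cdot> E.x"
  proof (rule cancel_left[of "E'.p \<star>\<^bsub>A'\<^esub> i'"])
    have "E'.p \<star>\<^bsub>A'\<^esub> i' \<cdot> (E'.x \<cdot> (b \<otimes> y)) = (a \<cdot> i) \<star>\<^bsub>A'\<^esub> (a \<cdot> E.p)" by (simp add: eq y)
    also have "\<dots> = a \<cdot> i \<star>\<^bsub>A\<^esub> E.p" by (rule is_mon_hom_conv[OF E.data(2) E'.data(2) a, symmetric]) simp_all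
    also have "\<dots> = (a \<cdot> E.p \<star>\<^bsub>A\<^esub> i) \<cdot> E.x" by simp
    also have "a \<cdot> E.p \<star>\<^bsub>A\<^esub> i = (a \<cdot> E.p) \<star>\<^bsub>A'\<^esub> (a \<cdot> i)" by (rule is_mon_hom_conv[OF E.data(2) E'.data(2) a]) simp_all
    also have "\<dots> \<cdot> E.x = E'.p \<star>\<^bsub>A'\<^esub> i' \<cdot> ((y \<otimes> b) \<cdot> E.x)" by (simp add: eq y)
    finally show "E'.p \<star>\<^bsub>A'\<^esub> i' \<cdot> (E'.x \<cdot> (b \<otimes> y)) = E'.p \<star>\<^bsub>A'\<^esub> i' \<cdot> ((y \<otimes> b) \<cdot> E.x)" .
  qed simp_all
  ultimately show "is_dist_law_hom C (kernel_law (B, A, i, s)) (kernel_law (B', A', i', s')) b y"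
    using b y by (simp add: is_dist_law_hom_def kernel_law_def)
qed

text \<open>
  Let \<open>?f = p \<star> i\<close>. A morphism \<open>a\<close> with \<open>a \<cdot> i = i' \<cdot> b\<close> and \<open>a \<cdot> p = p' \<cdot> y\<close> satisfies
  \<open>a \<cdot> ?f = (p' \<cdot> y) \<star> (i' \<cdot> b)\<close>, which determines it. Conversely, the right-hand side \<open>?g\<close> is a monoid
  morphism on the wreath product, because compatibility of \<open>(b, y)\<close> with the distributive laws is
  just the condition in the universal property. The same property makes \<open>?f\<close> an isomorphism of
  monoids, so \<open>a = ?g \<cdot> ?f\<inverse>\<close> is a monoid morphism.
\<close>
lemma split_epi_hom_from_dist_law_hom:
  assumes E: "is_split_epi C S (B, A, i, s)" and E': "is_split_epi C S (B', A', i', s')"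
    and hom: "is_dist_law_hom C (kernel_law (B, A, i, s)) (kernel_law (B', A', i', s')) b y"
  shows "\<exists>!a. is_split_epi_hom C (B, A, i, s) (B', A', i', s') b a \<and> ker_map (B, A, i, s) (B', A', i', s') a = y"
proof -
  interpret E: split_epi_object C S B A i s by (rule split_epi_objectI[OF E])
  interpret E': split_epi_object C S B' A' i' s' by (rule split_epi_objectI[OF E'])
  interpret W: distributive_law C B E.P E.x
    using E.data E.ker E.distributive_law by unfold_locales
  have b: "is_mon_hom C B B' b" and y: "is_mon_hom C E.P E'.P y"
    and eq: "E'.e \<cdot> y = E.e" "E'.x \<cdot> (b \<otimes> y) = (y \<otimes> b) \<cdot> E.x"
    using hom by (auto simp: is_dist_law_hom_def kernel_law_def)
  note [simp] = is_mon_hom_simps[OF b] is_mon_hom_simps[OF y]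
  let ?f = "E.p \<star>\<^bsub>A\<^esub> i" and ?g = "(E'.p \<cdot> y) \<star>\<^bsub>A'\<^esub> (i' \<cdot> b)"
  note f = W.wreath_universal[OF E.data(2,3) E.ker(3) E.x_simps(4)[symmetric]]
  have p'y: "is_mon_hom C E.P A' (E'.p \<cdot> y)" and i'b: "is_mon_hom C B A' (i' \<cdot> b)"
    using is_mon_hom_Comp[OF E.ker(1) E'.ker(1) E'.data(2) y E'.ker(3)]
      is_mon_hom_Comp[OF E.data(1) E'.data(1,2) b E'.data(3)] by blast+
  have "(i' \<cdot> b) \<star>\<^bsub>A'\<^esub> (E'.p \<cdot> y) = E'.p \<star>\<^bsub>A'\<^esub> i' \<cdot> (E'.x \<cdot> (b \<otimes> y))" by simp
  also have "\<dots> = ?g \<cdot> E.x" unfolding eq by simp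
  finally have "(i' \<cdot> b) \<star>\<^bsub>A'\<^esub> (E'.p \<cdot> y) = ?g \<cdot> E.x" .
  note g = W.wreath_universal[OF E'.data(2) i'b p'y this]
  define a where "a = ?g \<cdot> inv_arrow C ?f"
  have a: "is_mon_hom C A A' a"
    unfolding a_def using f(1) g(1) E.data E'.data
    by (intro is_mon_hom_Comp[of A W.wreath A'] is_mon_hom_inv_arrow) simp_all
  have [simp]: "a \<in> Ar C" "Dom C a = obj A" "Cod C a = obj A'" using is_mon_hom_simps[OF a] by auto
  have af: "a \<cdot> ?f = ?g" by (simp add: a_def)
  have "a \<cdot> i = a \<cdot> (?f \<cdot> W.iB)" unfolding f(2) ..
  also have "\<dots> = ?g \<cdot> W.iB" by (simp add: Comp_reassoc[OF af] del: conv_TensA)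
  finally have ai: "a \<cdot> i = i' \<cdot> b" unfolding g(2) .
  have "a \<cdot> E.p = a \<cdot> (?f \<cdot> W.jY)" unfolding f(3) ..
  also have "\<dots> = ?g \<cdot> W.jY" by (simp add: Comp_reassoc[OF af] del: conv_TensA)
  finally have ap: "a \<cdot> E.p = E'.p \<cdot> y" unfolding g(3) .
  have "s' \<cdot> a = b \<cdot> s"
  proof (rule cancel_right[of ?f])
    have "(s' \<cdot> a) \<cdot> ?f = s' \<cdot> ?g" by (simp add: af)
    also have "\<dots> = (s' \<cdot> (E'.p \<cdot> y)) \<star>\<^bsub>B'\<^esub> (s' \<cdot> (i' \<cdot> b))"
      by (rule is_mon_hom_conv[OF E'.data(2,1,4)]) simp_all
    also have "\<dots> = (b \<cdot> (s \<cdot> E.p)) \<star>\<^bsub>B'\<^esub> (b \<cdot> (s \<cdot> i))"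
    proof -
      have "s' \<cdot> (E'.p \<cdot> y) = unt B' \<cdot> E.e" by (simp add: Comp_reassoc[OF E'.simps(24)] eq)
      moreover have "s' \<cdot> (i' \<cdot> b) = b" by (simp add: Comp_reassoc[OF E'.simps(4)])
      moreover have "b \<cdot> (unt B \<cdot> E.e) = unt B' \<cdot> E.e"
        by (rule Comp_reassoc[OF is_mon_hom_simps(5)[OF b]]) simp_all
      ultimately show ?thesis by simp
    qed
    also have "\<dots> = b \<cdot> (s \<cdot> ?f)"
      by (simp only: is_mon_hom_conv[OF E.data(2,1,4)] E.simps is_mon_hom_conv[OF E.data(1) E'.data(1) b]
          Comp_simps Id_simps is_mon_simps Comp_Id_simps)
    finally show "(s' \<cdot> a) \<cdot> ?f = (b \<cdot> s) \<cdot> ?f" by simp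
  qed simp_all
  then have a_hom: "is_split_epi_hom C (B, A, i, s) (B', A', i', s') b a"
    using a b ai by (simp add: is_split_epi_hom_def)
  moreover have "ker_map (B, A, i, s) (B', A', i', s') a = y"
    by (rule E'.jointly_monic[of _ "obj E.P"]) (use ker_map(1-3)[OF E E' a_hom] ap eq(1) in simp_all)
  moreover have "a' = a"
    if h: "is_split_epi_hom C (B, A, i, s) (B', A', i', s') b a'"
      and k: "ker_map (B, A, i, s) (B', A', i', s') a' = y" for a'
  proof (rule cancel_right[of ?f])
    have a': "is_mon_hom C A A' a'" and "i' \<cdot> b = a' \<cdot> i"
      using h by (auto simp: is_split_epi_hom_def)
    moreover have "E'.p \<cdot> y = a' \<cdot> E.p" using ker_map(2)[OF E E' h] unfolding k .
    ultimately show "a' \<cdot> ?f = a \<cdot> ?f"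
      unfolding af by (simp add: is_mon_hom_conv[OF E.data(2) E'.data(2) a'])
    show "a' \<in> Ar C" "Dom C a' = Cod C ?f" using is_mon_hom_simps[OF a'] by simp_all
  qed simp_all
  ultimately show ?thesis by blast
qed

text \<open>
  The split epimorphism is the wreath product with the inclusion of \<open>B\<close> and the projection to \<open>B\<close>.
  The projection is the monoid morphism that the universal property yields for \<open>u \<cdot> e\<close> and \<open>1\<close>; the
  condition for this is \<open>(e \<otimes> 1) \<cdot> x = 1 \<otimes> e\<close>. The comparison arrow \<open>?f\<close> identifies \<open>Y\<close> with the
  kernel, and under this identification the map \<open>p \<star> i\<close> becomes \<open>jY \<star> iB = 1\<close>, so it is invertible.
\<close>
lemma dist_law_essential_image:
  assumes L: "is_dist_law C S (B, Y, e, x)"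
  shows "\<exists>E f. is_split_epi C S E \<and> fst (kernel_law E) = B \<and> is_dist_law_hom C (B, Y, e, x) (kernel_law E) (\<one> (obj B)) f \<and> invertible C f"
proof -
  have mon [simp]: "is_mon C B" "is_mon C Y" and e: "is_mon_hom C Y (trivial_mon C) e"
    and x: "is_distributive_law C B Y x" and S: "(\<one> (obj Y), e) \<in> S" "(\<one> (obj B), \<one> (obj B)) \<in> S"
    and ex: "dl_proj C B e \<cdot> x = \<rho> (obj B) \<cdot> (\<one> (obj B) \<otimes> e)"
    and inv: "invertible C (dl_comparison C S B Y e)"
    using L by (auto simp: is_dist_law_def)
  interpret W: distributive_law C B Y x using mon x by unfold_locales
  note [simp] = is_mon_hom_simps(1-3)[OF e, simplified]
  let ?f = "dl_comparison C S B Y e" and ?s = "dl_proj C B e"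
  note ax = monoidal_category_axioms admissible monoidal_class
  have "is_dl_comparison C S B Y e ?f"
    unfolding dl_comparison_def
    by (rule theI'[OF dl_comparison_unique_existence[OF ax has_rel_pullbacks mon e S]])
  then have f: "?f \<in> Ar C" "Dom C ?f = obj Y" "Cod C ?f = Dom C (ker_incl B ?s)"
      "ker_incl B ?s \<cdot> ?f = W.jY" "ker_counit B ?s \<cdot> ?f = e"
    unfolding is_dl_comparison_def pb_obj_def ker_incl_def ker_counit_def W.jY_def by auto
  have s_conv: "?s = (unt B \<cdot> e) \<star>\<^bsub>B\<^esub> \<one> (obj B)"
    by (simp add: dl_proj_def conv_unt_Comp)
  have ue: "is_mon_hom C Y B (unt B \<cdot> e)"
    using is_mon_hom_Comp[OF mon(2) is_mon_trivial_mon mon(1) e is_mon_hom_unt[OF mon(1)]] .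
  have "\<one> (obj B) \<star>\<^bsub>B\<^esub> (unt B \<cdot> e) = (unt B \<cdot> e) \<star>\<^bsub>B\<^esub> \<one> (obj B) \<cdot> x"
    unfolding s_conv[symmetric] ex by (simp add: conv_unt_Comp)
  note s = W.wreath_universal[OF mon(1) is_mon_hom_Id[OF mon(1)] ue this, folded s_conv]
  have s_S: "(\<one> (obj W.wreath), ?s) \<in> S"
    using dl_proj_leg(2)[OF ax mon e S] by simp
  note ker = ker_mon[OF mon(1) W.is_mon_wreath s(1) s_S]
  note [simp] = rel_pullback_simps(2-6)[OF ker(1)] f
  have s_simps [simp]: "?s \<in> Ar C" "Dom C ?s = W.A" "Cod C ?s = obj B" using is_mon_hom_simps[OF s(1)] by auto
  let ?q = "ker_incl B ?s \<star>\<^bsub>W.wreath\<^esub> W.iB"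
  have q: "?q \<in> hom C (Dom C (ker_incl B ?s) \<odot> obj B) W.A" by simp
  \<comment> \<open>A one-sided inverse suffices, as \<open>?f \<otimes> 1\<close> is invertible.\<close>
  have qf: "?q \<cdot> (?f \<otimes> \<one> (obj B)) = \<one> W.A" by (simp add: W.conv_iB_jY)
  have fB: "invertible C (?f \<otimes> \<one> (obj B))" using inv by simp
  have "?q = inv_arrow C (?f \<otimes> \<one> (obj B))"
    by (rule cancel_right[OF fB]) (use fB qf in simp_all)
  then have "invertible C ?q" using fB by simp
  then have E: "is_split_epi C S (B, W.wreath, W.iB, ?s)"
    unfolding is_split_epi_iff using s s_S W.is_mon_hom_iB by simp
  interpret E: split_epi_object C S B W.wreath W.iB ?s by (rule split_epi_objectI[OF E])
  have "is_mon_hom C Y E.P ?f"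
    by (rule rel_pullback_mon_hom[OF ker(1) _ _ _ _ ker(2) _ _ ker(3,4,5)])
      (simp_all add: W.is_mon_hom_jY e)
  moreover have "E.x \<cdot> (\<one> (obj B) \<otimes> ?f) = (?f \<otimes> \<one> (obj B)) \<cdot> x"
    by (rule cancel_left[of ?q]) (simp_all add: W.conv_iB_jY)
  ultimately have "is_dist_law_hom C (B, Y, e, x) (kernel_law (B, W.wreath, W.iB, ?s)) (\<one> (obj B)) ?f"
    by (simp add: is_dist_law_hom_def kernel_law_def is_mon_hom_Id)
  then show ?thesis
    using E inv by (intro exI[of _ "(B, W.wreath, W.iB, ?s)"] exI[of _ ?f]) (simp add: kernel_law_def)
qed

lemma is_dist_law_hom_inv:
  assumes L: "is_dist_law C S L" and L': "is_dist_law C S L'"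
    and hom: "is_dist_law_hom C L L' b y" and inv: "invertible C b" "invertible C y"
  shows "is_dist_law_hom C L' L (inv_arrow C b) (inv_arrow C y)"
proof -
  obtain B Y e x B' Y' e' x' where [simp]: "L = (B, Y, e, x)" "L' = (B', Y', e', x')"
    by (metis prod_cases4)
  have mon [simp]: "is_mon C B" "is_mon C Y" "is_mon C B'" "is_mon C Y'"
    and e: "is_mon_hom C Y (trivial_mon C) e" "is_mon_hom C Y' (trivial_mon C) e'"
    and x: "is_distributive_law C B Y x" "is_distributive_law C B' Y' x'"
    using L L' by (auto simp: is_dist_law_def)
  note [simp] = is_mon_hom_simps(1-3)[OF e(1)] is_mon_hom_simps(1-3)[OF e(2)]
    is_distributive_law_simps[OF x(1)] is_distributive_law_simps[OF x(2)]
  have b: "is_mon_hom C B B' b" and y: "is_mon_hom C Y Y' y"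
    and eq: "e' \<cdot> y = e" "x' \<cdot> (b \<otimes> y) = (y \<otimes> b) \<cdot> x"
    using hom by (auto simp: is_dist_law_hom_def)
  note [simp] = is_mon_hom_simps(1-3)[OF b] is_mon_hom_simps(1-3)[OF y] inv
  have "e \<cdot> inv_arrow C y = e'" unfolding eq(1)[symmetric] by simp
  moreover have "x \<cdot> (inv_arrow C b \<otimes> inv_arrow C y) = (inv_arrow C y \<otimes> inv_arrow C b) \<cdot> x'"
  proof (rule cancel_left[of "y \<otimes> b"])
    show "(y \<otimes> b) \<cdot> (x \<cdot> (inv_arrow C b \<otimes> inv_arrow C y)) =
      (y \<otimes> b) \<cdot> ((inv_arrow C y \<otimes> inv_arrow C b) \<cdot> x')"
      by (simp add: Comp_reassoc[OF eq(2)[symmetric]])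
  qed simp_all
  ultimately show ?thesis
    using is_mon_hom_inv_arrow[OF mon(1,3) b] is_mon_hom_inv_arrow[OF mon(2,4) y]
    by (simp add: is_dist_law_hom_def)
qed

lemma ker_map_unique:
  assumes E: "is_split_epi C S (B, A, i, s)" and E': "is_split_epi C S (B', A', i', s')"
    and hom: "is_split_epi_hom C (B, A, i, s) (B', A', i', s') b a"
    and y: "y \<in> hom C (obj (ker_mon A B s)) (obj (ker_mon A' B' s'))"
      "ker_incl B' s' \<cdot> y = a \<cdot> ker_incl B s" "ker_counit B' s' \<cdot> y = ker_counit B s"
  shows "ker_map (B, A, i, s) (B', A', i', s') a = y"
proof -
  interpret E': split_epi_object C S B' A' i' s' by (rule split_epi_objectI[OF E'])
  show ?thesis
    by (rule E'.jointly_monic[of _ "obj (ker_mon A B s)"])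
      (use ker_map(1-3)[OF E E' hom] y in simp_all)
qed

definition kernel_law_map where
  "kernel_law_map = (\<lambda>(E, E', b, a). (kernel_law E, kernel_law E', b, ker_map E E' a))"

lemma is_dist_law_kernel_law: "is_split_epi C S E \<Longrightarrow> is_dist_law C S (kernel_law E)"
  by (cases E) (auto simp: kernel_law_def intro!: split_epi_object.is_dist_law split_epi_objectI)

lemma is_functor_kernel_law: "is_functor (SplitEpiMon C S) (DistLaw C S) kernel_law kernel_law_map"
  unfolding is_functor_def
proof (intro conjI ballI impI)
  fix E assume "E \<in> Ob (SplitEpiMon C S)"
  then have E: "is_split_epi C S E" by (simp add: SplitEpiMon_def)
  then show "kernel_law E \<in> Ob (DistLaw C S)" by (simp add: DistLaw_def is_dist_law_kernel_law)
  obtain B A i s where [simp]: "E = (B, A, i, s)" by (metis prod_cases4)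
  interpret E: split_epi_object C S B A i s using E by (intro split_epi_objectI) simp
  have "ker_map E E (\<one> (obj A)) = \<one> (obj E.P)"
    unfolding \<open>E = _\<close>
    by (rule ker_map_unique[of _ _ _ _ _ _ _ _ "\<one> (obj B)"])
      (simp_all add: is_split_epi_hom_def is_mon_hom_Id E.is_split_epi)
  then show "kernel_law_map (\<one>\<^bsub>SplitEpiMon C S\<^esub> E) = \<one>\<^bsub>DistLaw C S\<^esub> (kernel_law E)"
    by (simp add: kernel_law_map_def SplitEpiMon_def DistLaw_def kernel_law_def)
next
  fix f assume "f \<in> Ar (SplitEpiMon C S)"
  then obtain E E' b a where [simp]: "f = (E, E', b, a)" and
    f: "is_split_epi C S E" "is_split_epi C S E'" "is_split_epi_hom C E E' b a"
    by (auto simp: SplitEpiMon_def)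
  obtain B A i s B' A' i' s' where [simp]: "E = (B, A, i, s)" "E' = (B', A', i', s')"
    by (metis prod_cases4)
  have "is_dist_law_hom C (kernel_law E) (kernel_law E') b (ker_map E E' a)"
    using ker_map(4) f by simp
  then show "kernel_law_map f \<in> hom (DistLaw C S) (kernel_law (Dom (SplitEpiMon C S) f)) (kernel_law (Cod (SplitEpiMon C S) f))"
    using f by (simp add: hom_def DistLaw_def SplitEpiMon_def kernel_law_map_def is_dist_law_kernel_law)
  fix g assume "g \<in> Ar (SplitEpiMon C S)" and "Cod (SplitEpiMon C S) f = Dom (SplitEpiMon C S) g"
  then obtain E'' b' a' where [simp]: "g = (E', E'', b', a')" and
    g: "is_split_epi C S E''" "is_split_epi_hom C E' E'' b' a'"
    by (auto simp: SplitEpiMon_def)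
  obtain B'' A'' i'' s'' where [simp]: "E'' = (B'', A'', i'', s'')"
    by (metis prod_cases4)
  interpret E: split_epi_object C S B A i s using f by (intro split_epi_objectI) simp
  interpret E': split_epi_object C S B' A' i' s' using f by (intro split_epi_objectI) simp
  interpret E'': split_epi_object C S B'' A'' i'' s'' using g by (intro split_epi_objectI) simp
  note f' = ker_map[OF E.is_split_epi E'.is_split_epi, of b a]
    and g' = ker_map[OF E'.is_split_epi E''.is_split_epi, of b' a']
  interpret SE: category "SplitEpiMon C S" by (rule category_SplitEpiMon)
  have "is_split_epi_hom C E E'' (b' \<cdot> b) (a' \<cdot> a)"
    using SE.Comp_hom[of f E E' g E''] f g by (simp add: hom_def SplitEpiMon_def)
  moreover have [simp]: "a \<in> Ar C" "Dom C a = obj A" "Cod C a = obj A'"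
    "a' \<in> Ar C" "Dom C a' = obj A'" "Cod C a' = obj A''"
    using f g by (auto simp: is_split_epi_hom_def is_mon_hom_def)
  ultimately have "ker_map E E'' (a' \<cdot> a) = ker_map E' E'' a' \<cdot> ker_map E E' a"
    unfolding \<open>E = _\<close> \<open>E' = _\<close> \<open>E'' = _\<close>
    by (intro ker_map_unique[OF E.is_split_epi E''.is_split_epi])
      (use f f' g g' in \<open>simp_all add: Comp_reassoc[OF g'(2)] Comp_reassoc[OF g'(3)]\<close>)
  then show "kernel_law_map (g \<cdot>\<^bsub>SplitEpiMon C S\<^esub> f) = kernel_law_map g \<cdot>\<^bsub>DistLaw C S\<^esub> kernel_law_map f"
    by (simp add: kernel_law_map_def SplitEpiMon_def DistLaw_def)
qed

lemma kernel_law_fully_faithful: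
  assumes "E \<in> Ob (SplitEpiMon C S)" "E' \<in> Ob (SplitEpiMon C S)" "g \<in> hom (DistLaw C S) (kernel_law E) (kernel_law E')"
  shows "\<exists>!f. f \<in> hom (SplitEpiMon C S) E E' \<and> kernel_law_map f = g"
proof -
  obtain b y where g: "g = (kernel_law E, kernel_law E', b, y)" "is_dist_law_hom C (kernel_law E) (kernel_law E') b y"
    using assms(3) by (auto simp: hom_def DistLaw_def)
  obtain B A i s B' A' i' s' where E: "E = (B, A, i, s)" "E' = (B', A', i', s')"
    by (metis prod_cases4)
  have split: "is_split_epi C S E" "is_split_epi C S E'" using assms by (simp_all add: SplitEpiMon_def)
  then have "\<exists>!a. is_split_epi_hom C E E' b a \<and> ker_map E E' a = y"
    using split_epi_hom_from_dist_law_hom g(2) unfolding E by blast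
  then obtain a where a: "is_split_epi_hom C E E' b a" "ker_map E E' a = y"
    and unique: "\<And>a'. is_split_epi_hom C E E' b a' \<Longrightarrow> ker_map E E' a' = y \<Longrightarrow> a' = a"
    by blast
  show ?thesis
  proof (rule ex1I[of _ "(E, E', b, a)"])
    show "(E, E', b, a) \<in> hom (SplitEpiMon C S) E E' \<and> kernel_law_map (E, E', b, a) = g"
      using split a g by (simp add: hom_def SplitEpiMon_def kernel_law_map_def)
    show "f = (E, E', b, a)" if f: "f \<in> hom (SplitEpiMon C S) E E' \<and> kernel_law_map f = g" for f
    proof -
      obtain F F' b' a' where f_def: "f = (F, F', b', a')" by (metis prod_cases4)
      have "F = E" "F' = E'" "b' = b" "is_split_epi_hom C E E' b' a'" "ker_map E E' a' = y"
        using f g by (auto simp: hom_def SplitEpiMon_def kernel_law_map_def f_def)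
      then show ?thesis using unique unfolding f_def by blast
    qed
  qed
qed

lemma kernel_law_essentially_surjective:
  assumes "L \<in> Ob (DistLaw C S)"
  shows "\<exists>E \<in> Ob (SplitEpiMon C S). \<exists>k \<in> hom (DistLaw C S) L (kernel_law E). invertible (DistLaw C S) k"
proof -
  interpret D: category "DistLaw C S" by (rule category_DistLaw)
  obtain B Y e x where L [simp]: "L = (B, Y, e, x)" by (metis prod_cases4)
  have dl: "is_dist_law C S L" using assms by (simp add: DistLaw_def)
  obtain E f where E: "is_split_epi C S E" and f: "fst (kernel_law E) = B"
      "is_dist_law_hom C L (kernel_law E) (\<one> (obj B)) f" "invertible C f"
    using dist_law_essential_image[OF dl[unfolded L]] unfolding L by blast
  obtain P e' x' where FE: "kernel_law E = (B, P, e', x')" using f(1) by (metis prod_cases4 fst_conv)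
  have dl': "is_dist_law C S (B, P, e', x')" using is_dist_law_kernel_law[OF E] by (simp add: FE)
  have B: "obj B \<in> Ob C" using dl by (simp add: is_dist_law_def)
  have fY: "f \<in> hom C (obj Y) (obj P)" using f(2) by (simp add: FE is_dist_law_hom_def is_mon_hom_def)
  have inv: "is_dist_law_hom C (B, P, e', x') L (inv_arrow C (\<one> (obj B))) (inv_arrow C f)"
    using f(2,3) B by (intro is_dist_law_hom_inv[OF dl dl']) (simp_all add: FE)
  let ?k = "(L, kernel_law E, \<one> (obj B), f)" and ?l = "(kernel_law E, L, inv_arrow C (\<one> (obj B)), inv_arrow C f)"
  have k: "?k \<in> hom (DistLaw C S) L (kernel_law E)" and l: "?l \<in> hom (DistLaw C S) (kernel_law E) L"
    using dl dl' inv f(2) by (simp_all add: hom_def DistLaw_def FE)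
  moreover have "?l \<cdot>\<^bsub>DistLaw C S\<^esub> ?k = \<one>\<^bsub>DistLaw C S\<^esub> L" "?k \<cdot>\<^bsub>DistLaw C S\<^esub> ?l = \<one>\<^bsub>DistLaw C S\<^esub> (kernel_law E)"
    using f(3) B fY by (simp_all add: DistLaw_def FE)
  ultimately have "invertible (DistLaw C S) ?k"
    by (rule D.invertibleI)
  then show ?thesis using E k by (intro bexI[of _ E] bexI[of _ ?k]) (simp_all add: SplitEpiMon_def)
qed

end

theorem theorem1p1:
  fixes C :: "('o, 'a, 'z) mcat_scheme" and S :: "('a \<times> 'a) set"
  assumes "monoidal_category C"
    and "admissible C S"
    and "monoidal_class C S"
    and "has_rel_pullbacks C S"
  shows "equivalent_categories (SplitEpiMon C S) (DistLaw C S)"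
proof -
  interpret pullback_span_class C S
    using assms by (intro pullback_span_class.intro monoidal_span_class.intro
        monoidal_span_class_axioms.intro pullback_span_class_axioms.intro)
  show ?thesis
    using category_SplitEpiMon category_DistLaw is_functor_kernel_law kernel_law_fully_faithful kernel_law_essentially_surjective
    by (rule equivalent_categories_fully_faithful)
qed

end
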